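(* Let $I=I_2\sqcup I_3\sqcup I_4$ and let $(\mathbf{X}_n^{(i)})_{i\in I}$ be independent unnormalized Wigner matrices with uniformly controlled moments and real parameters $\beta_i\in\mathbb{R}$ (as defined in the context). Let $(b_n^{(i)})_n$ be band widths of slow growth for $i\in I_2$, of full proportion for $i\in I_3$, and of proper proportion $c_i=\lim_n b_n^{(i)}/n\in(0,1)$ for $i\in I_4$, and let $\mathcal{O}_n=(\mathbf{\Theta}_n^{(i)})_{i\in I}$ be the corresponding normalized random band matrices. Write $\mathbf{c}_4=(c_i)_{i\in I_4}$. Then for any test graph $T$ with labels in $I$, $$\lim_{n\to\infty}\tau^0\big[T(\mathcal{O}_n)\big]=\begin{cases}p_F(\mathbf{c}_4)\displaystyle\prod_{i\in I}\beta_i^{\mathrm{cong}_i(T)}&\text{if $T$ is a colored double tree,}\\0&\text{otherwise,}\end{cases}$$ where $F=T_1\sqcup\cdots\sqcup T_s$ is the forest of colored double trees obtained from $T$ by contracting the edges with labels in $I_2$ and removing the edges with labels in $I_3$ (keeping all vertices, including isolated ones), and $p_F(\mathbf{c}_4)=\prod_{r=1}^sp_{T_r}(\mathbf{c}_4)$, with $p_{T_r}$ defined in the context.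
   Context: Wigner matrices: for each $n$, $(\mathbf{X}_n^{(i)})_{i\in I}$ are random Hermitian $n\times n$ matrices such that the entries $(\mathbf{X}_n^{(i)}(j,k):1\le j\le k\le n,\ i\in I)$ are independent; diagonal entries are real-valued; for $j<k$, $\mathbb{E}\mathbf{X}_n^{(i)}(j,k)=0$, $\mathbb{E}|\mathbf{X}_n^{(i)}(j,k)|^2=1$, $\mathbb{E}[\mathbf{X}_n^{(i)}(j,k)^2]=\beta_i$; and for every finite $I_0\subset I$ and $\ell\in\mathbb{N}$, $\sup_n\sup_{i\in I_0}\sup_{1\le j\le k\le n}\mathbb{E}|\mathbf{X}_n^{(i)}(j,k)|^\ell<\infty$. Random band matrices: with nonnegative integers $b_n$, $\mathbf{\Xi}_n(j,k)=\mathbf{1}\{|j-k|\le b_n\}\mathbf{X}_n(j,k)$. Slow growth: $b_n\to\infty$, $b_n=o(n)$, $\mathbf{\Theta}_n=(2b_n)^{-1/2}\mathbf{\Xi}_n$. Proportional growth: $b_n/n\to c\in(0,1]$, $\mathbf{\Theta}_n=(2c-c^2)^{-1/2}n^{-1/2}\mathbf{\Xi}_n$; full proportion means $c=1$, proper means $c\in(0,1)$. A test graph $T=(V,E,\mathrm{src},\mathrm{tar},\gamma)$ with labels in $I$ is a finite, connected directed multigraph (loops and multiple edges allowed, $V\ne\emptyset$) with $\gamma:E\to I$; $\tau^0[T(\mathcal{O}_n)]=\mathbb{E}[\frac1n\sum_{\phi:V\hookrightarrow[n]}\prod_{e\in E}\mathbf{\Theta}_n^{(\gamma(e))}(\phi(\mathrm{tar}(e)),\phi(\mathrm{src}(e)))]$,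 sum over injective maps. $T$ is a colored double tree if, forgetting orientation and multiplicity of edges, it becomes a tree, there are exactly two edges between adjacent vertices, and the two edges of each such pair (twin edges $[e]$) share the same label $\gamma([e])$; twin edges are congruent if they have the same orientation. $\mathrm{cong}_i(T)$ is the number of pairs of congruent twin edges with label $i$ ($0^0=1$). Contracting twin edges means removing them and merging their two endpoints. For a colored double tree $S=(V,E)$ with labels in $I_4$, writing $\widetilde E$ for the set of pairs of twin edges and $\{\mathrm{src}([e]),\mathrm{tar}([e])\}$ for the endpoints of $[e]$, $$p_S(\mathbf{c}_4)=\frac{\displaystyle\int_{[0,1]^V}\prod_{[e]\in\widetilde E}\mathbf{1}\{|x_{\mathrm{src}([e])}-x_{\mathrm{tar}([e])}|\le c_{\gamma([e])}\}\,\prod_{v\in V}dx_v}{\displaystyle\prod_{[e]\in\widetilde E}(2c_{\gamma([e])}-c_{\gamma([e])}^2)},$$ so that $p_S=1$ for a single isolated vertex. *)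

theory Defs
  imports
    "HOL-Probability.Probability"
    "HOL-Library.Landau_Symbols"
    "Graph_Theory.Graph_Theory"
begin

text \<open>
  Matrices are functions of their row and column indices, and the index range of an
  \<open>n\<close>-by-\<open>n\<close> matrix is \<open>{1..n}\<close>.  A family of random matrices is written
  \<open>X n i j k \<omega>\<close>: size, label, row, column, sample point; the probability space \<open>M n\<close> may
  depend on the size.
\<close>

definition wigner_family ::
  "(nat \<Rightarrow> 'w measure) \<Rightarrow> 'i set \<Rightarrow> ('i \<Rightarrow> real)
     \<Rightarrow> (nat \<Rightarrow> 'i \<Rightarrow> nat \<Rightarrow> nat \<Rightarrow> 'w \<Rightarrow> complex) \<Rightarrow> bool" where
  "wigner_family M I \<beta> X \<longleftrightarrow>
     (\<forall>n. prob_space (M n)) \<and>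
     (\<forall>n. \<forall>i\<in>I. \<forall>j\<in>{1..n}. \<forall>k\<in>{1..n}. \<forall>\<omega>\<in>space (M n). X n i k j \<omega> = cnj (X n i j k \<omega>)) \<and>
     (\<forall>n. \<forall>i\<in>I. \<forall>j\<in>{1..n}. \<forall>\<omega>\<in>space (M n). X n i j j \<omega> \<in> \<real>) \<and>
     (\<forall>n. prob_space.indep_vars (M n) (\<lambda>_. borel) (\<lambda>(i, j, k). X n i j k)
        {(i, j, k). i \<in> I \<and> 1 \<le> j \<and> j \<le> k \<and> k \<le> n}) \<and>
     (\<forall>n. \<forall>i\<in>I. \<forall>j k. 1 \<le> j \<and> j < k \<and> k \<le> n \<longrightarrow>
        (LINT \<omega>|M n. X n i j k \<omega>) = 0 \<and>
        (LINT \<omega>|M n. (cmod (X n i j k \<omega>))\<^sup>2) = 1 \<and>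
        (LINT \<omega>|M n. (X n i j k \<omega>)\<^sup>2) = complex_of_real (\<beta> i)) \<and>
     (\<forall>I0 l. finite I0 \<and> I0 \<subseteq> I \<longrightarrow>
        (SUP n. SUP i\<in>I0. SUP j\<in>{1..n}. SUP k\<in>{j..n}.
           \<integral>\<^sup>+ \<omega>. ennreal (cmod (X n i j k \<omega>) ^ l) \<partial>M n) < \<infinity>)"

definition slow_growth :: "(nat \<Rightarrow> nat) \<Rightarrow> bool" where
  "slow_growth b \<longleftrightarrow> filterlim b at_top sequentially \<and> (\<lambda>n. real (b n)) \<in> o(\<lambda>n. real n)"

definition proportional_growth :: "(nat \<Rightarrow> nat) \<Rightarrow> real \<Rightarrow> bool" where
  "proportional_growth b c \<longleftrightarrow> 0 < c \<and> c \<le> 1 \<and> (\<lambda>n. real (b n) / real n) \<longlonglongrightarrow> c"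

definition full_proportion :: "(nat \<Rightarrow> nat) \<Rightarrow> real \<Rightarrow> bool" where
  "full_proportion b c \<longleftrightarrow> proportional_growth b c \<and> c = 1"

definition proper_proportion :: "(nat \<Rightarrow> nat) \<Rightarrow> real \<Rightarrow> bool" where
  "proper_proportion b c \<longleftrightarrow> proportional_growth b c \<and> c < 1"

definition band_matrix ::
  "nat \<Rightarrow> (nat \<Rightarrow> nat \<Rightarrow> 'w \<Rightarrow> complex) \<Rightarrow> nat \<Rightarrow> nat \<Rightarrow> 'w \<Rightarrow> complex" where
  "band_matrix b A j k \<omega> = of_bool (\<bar>int j - int k\<bar> \<le> int b) * A j k \<omega>"

text \<open>
  The set \<open>Is\<close> contains the labels of slow growth.  If \<open>b i n = 0\<close> for such a label, the
  normalization is \<open>0 powr (- 1/2) = 0\<close>; this affects only finitely many \<open>n\<close> per label.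
\<close>

definition normalized_band ::
  "'i set \<Rightarrow> ('i \<Rightarrow> real) \<Rightarrow> ('i \<Rightarrow> nat \<Rightarrow> nat) \<Rightarrow> (nat \<Rightarrow> 'i \<Rightarrow> nat \<Rightarrow> nat \<Rightarrow> 'w \<Rightarrow> complex)
     \<Rightarrow> nat \<Rightarrow> 'i \<Rightarrow> nat \<Rightarrow> nat \<Rightarrow> 'w \<Rightarrow> complex" where
  "normalized_band Is c b X n i j k \<omega> =
     complex_of_real
       (if i \<in> Is then (2 * real (b i n)) powr (- 1/2)
        else (2 * c i - (c i)\<^sup>2) powr (- 1/2) * real n powr (- 1/2))
     * band_matrix (b i n) (X n i) j k \<omega>"

text \<open>
  Test graphs.  Non-emptiness of the vertex set is part of
  \<^const>\<open>Digraph_Component.connected\<close>, which ignores the orientation of the arcs.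
\<close>

definition test_graph :: "'i set \<Rightarrow> ('e \<Rightarrow> 'i) \<Rightarrow> ('v, 'e) pre_digraph \<Rightarrow> bool" where
  "test_graph I \<gamma> T \<longleftrightarrow>
     fin_digraph T \<and> Digraph_Component.connected T \<and> (\<forall>e\<in>arcs T. \<gamma> e \<in> I)"

definition injective_trace ::
  "'w measure \<Rightarrow> nat \<Rightarrow> ('i \<Rightarrow> nat \<Rightarrow> nat \<Rightarrow> 'w \<Rightarrow> complex) \<Rightarrow> ('e \<Rightarrow> 'i)
     \<Rightarrow> ('v, 'e) pre_digraph \<Rightarrow> complex" where
  "injective_trace M n A \<gamma> T =
     (LINT \<omega>|M. 1 / of_nat n *
        (\<Sum>\<phi> | \<phi> \<in> verts T \<rightarrow>\<^sub>E {1..n} \<and> inj_on \<phi> (verts T).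
           \<Prod>e\<in>arcs T. A (\<gamma> e) (\<phi> (head T e)) (\<phi> (tail T e)) \<omega>))"

text \<open>
  The library's \<^const>\<open>Digraph_Component.tree\<close> only excludes directed cycles, so it is not
  the undirected notion.  The digraph \<^term>\<open>mk_symmetric G\<close> forgets orientation and multiplicity
  and replaces each undirected edge by two opposite arcs.  Its cycles of length 2 traverse an edge
  back and forth; those of length 1 are the loops, and those of length at least 3 are the
  cycles of the underlying undirected graph.
\<close>

definition underlying_tree :: "('v, 'e) pre_digraph \<Rightarrow> bool" where
  "underlying_tree G \<longleftrightarrow>
     Digraph_Component.connected G \<and>
     (\<forall>p. pre_digraph.cycle (with_proj (mk_symmetric G)) p \<longrightarrow> length p = 2)"

definition twins :: "('v, 'e) pre_digraph \<Rightarrow> 'e \<Rightarrow> 'e set" where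
  "twins G e = {e' \<in> arcs G. {tail G e', head G e'} = {tail G e, head G e}}"

definition twin_pairs :: "('v, 'e) pre_digraph \<Rightarrow> 'e set set" where
  "twin_pairs G = twins G ` arcs G"

definition colored_double_tree :: "('e \<Rightarrow> 'i) \<Rightarrow> ('v, 'e) pre_digraph \<Rightarrow> bool" where
  "colored_double_tree \<gamma> G \<longleftrightarrow>
     underlying_tree G \<and>
     (\<forall>e\<in>arcs G. card (twins G e) = 2 \<and> (\<forall>e'\<in>twins G e. \<gamma> e' = \<gamma> e))"

definition cong_count :: "('e \<Rightarrow> 'i) \<Rightarrow> ('v, 'e) pre_digraph \<Rightarrow> 'i \<Rightarrow> nat" where
  "cong_count \<gamma> G i =
     card {P \<in> twin_pairs G. (\<forall>e\<in>P. \<gamma> e = i) \<and>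
       (\<forall>e\<in>P. \<forall>e'\<in>P. tail G e = tail G e' \<and> head G e = head G e')}"

text \<open>
  In a colored double tree, the label of a twin pair and the unordered pair of its endpoints do not depend on the chosen
  representative.
\<close>

definition twin_rep :: "'e set \<Rightarrow> 'e" where
  "twin_rep P = (SOME e. e \<in> P)"

definition p_tree :: "('i \<Rightarrow> real) \<Rightarrow> ('e \<Rightarrow> 'i) \<Rightarrow> ('v, 'e) pre_digraph \<Rightarrow> real" where
  "p_tree c \<gamma> S =
     (LINT x : (verts S \<rightarrow>\<^sub>E {0..1}) | (\<Pi>\<^sub>M v\<in>verts S. lborel).
        \<Prod>P\<in>twin_pairs S.
          of_bool (\<bar>x (tail S (twin_rep P)) - x (head S (twin_rep P))\<bar> \<le> c (\<gamma> (twin_rep P))))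
     / (\<Prod>P\<in>twin_pairs S. 2 * c (\<gamma> (twin_rep P)) - (c (\<gamma> (twin_rep P)))\<^sup>2)"

text \<open>
  Contraction of a set \<open>A\<close> of arcs: the new vertices are the classes of vertices joined by
  undirected paths in \<open>A\<close>.
\<close>

definition merged :: "('v, 'e) pre_digraph \<Rightarrow> 'e set \<Rightarrow> 'v \<Rightarrow> 'v set" where
  "merged G A v = pre_digraph.scc_of (with_proj (mk_symmetric (G\<lparr>arcs := arcs G \<inter> A\<rparr>))) v"

definition contract_arcs :: "('v, 'e) pre_digraph \<Rightarrow> 'e set \<Rightarrow> ('v set, 'e) pre_digraph" where
  "contract_arcs G A =
     \<lparr>verts = merged G A ` verts G, arcs = arcs G - A,
      tail = (\<lambda>e. merged G A (tail G e)), head = (\<lambda>e. merged G A (head G e))\<rparr>"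

definition remove_arcs :: "('v, 'e) pre_digraph \<Rightarrow> 'e set \<Rightarrow> ('v, 'e) pre_digraph" where
  "remove_arcs G A = G\<lparr>arcs := arcs G - A\<rparr>"

definition components :: "('v, 'e) pre_digraph \<Rightarrow> ('v, 'e) pre_digraph set" where
  "components G =
     induce_subgraph G ` pre_digraph.sccs_verts (with_proj (mk_symmetric G))"

definition reduced_forest ::
  "'i set \<Rightarrow> 'i set \<Rightarrow> ('e \<Rightarrow> 'i) \<Rightarrow> ('v, 'e) pre_digraph \<Rightarrow> ('v set, 'e) pre_digraph" where
  "reduced_forest I\<^sub>2 I\<^sub>3 \<gamma> T =
     remove_arcs (contract_arcs T {e \<in> arcs T. \<gamma> e \<in> I\<^sub>2}) {e \<in> arcs T. \<gamma> e \<in> I\<^sub>3}"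

definition p_forest :: "('i \<Rightarrow> real) \<Rightarrow> ('e \<Rightarrow> 'i) \<Rightarrow> ('v, 'e) pre_digraph \<Rightarrow> real" where
  "p_forest c \<gamma> F = (\<Prod>S\<in>components F. p_tree c \<gamma> S)"

text \<open>
  The product over all labels is restricted to the finitely many with a nonzero exponent, because
  \<^const>\<open>prod\<close> over an infinite set is 1; the omitted factors are \<open>\<beta> i ^ 0 = 1\<close>.
\<close>

definition cong_weight ::
  "'i set \<Rightarrow> ('i \<Rightarrow> real) \<Rightarrow> ('e \<Rightarrow> 'i) \<Rightarrow> ('v, 'e) pre_digraph \<Rightarrow> real" where
  "cong_weight I \<beta> \<gamma> T = (\<Prod>i | i \<in> I \<and> cong_count \<gamma> T i \<noteq> 0. \<beta> i ^ cong_count \<gamma> T i)"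

end

theory Submission
  imports Defs
begin

text \<open>
  Independence and centering annihilate every injective trace in which some non-loop arc has no
  partner with the same label and the same ends.  Otherwise the arcs of a spanning tree have disjoint
  partners, and each such pair carries the weight of one step of a random walk on the band, whose
  total mass is bounded.  Every further arc contributes a scaling factor that tends to \<open>0\<close>, so the
  limit vanishes unless \<open>T\<close> is a doubled spanning tree.  For a doubled tree the expectation of each
  summand is the constant \<open>\<Prod>\<^sub>i \<beta>\<^sub>i\<^bsup>cong\<^sub>i(T)\<^esup>\<close>, and what remains is a sum over injections of the vertices into
  \<open>{1..n}\<close>, which is evaluated by removing leaves one at a time: a leaf attached by a slowly
  growing band is identified with its neighbour in the limit, whereas a proportional band integrates
  the leaf against an explicit kernel.  The integral over the classes of identified vertices obeys the same
  recursion.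
\<close>

section \<open>Spanning trees\<close>

text \<open>The convergence behind leaf removal is not uniform: near the ends of
  \<open>{1..n}\<close> a slowly growing band is cut off and loses about half of its mass. Errors
  are therefore controlled only on average over the position of the neighbour, and the basic
  estimate must accept an arbitrary nonnegative function at an arbitrary vertex and bound everything
  by a constant times its sum. This works because a band is symmetric, so its column sums obey the
  same bound as its row sums, and any vertex can play the role of root.

  For the recursion to close, every vertex carries a continuous test function, which absorbs the
  messages of its removed leaves. Injectivity costs little, since a leaf has to avoid a bounded
  number of sites, each of weight tending to 0.

  When arcs remain beyond the doubled spanning tree, convergence of the tree average supplies the
  bound against which the surplus scaling factors win. The forest enters only at the end: until then
  full and proper proportions are treated alike, components are not separated, and contraction is
  merely a map that says which vertices share a coordinate.\<close>

definition arc_rel :: "('v, 'e) pre_digraph \<Rightarrow> 'e set \<Rightarrow> 'v rel" where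
  "arc_rel G A = (\<Union>e\<in>A. {(tail G e, head G e), (head G e, tail G e)})"

lemma sym_arc_rel: "sym (arc_rel G A)"
  by (auto simp: arc_rel_def sym_def)

lemma arc_rel_insert:
  "arc_rel G (insert e A) = insert (tail G e, head G e) (insert (head G e, tail G e) (arc_rel G A))"
  by (auto simp: arc_rel_def)

text \<open>In \<open>grown G V S\<close>, the set \<open>S\<close> contains exactly one arc of \<open>G\<close>, of either orientation, for
  each edge of a tree on \<open>V\<close> that is built by attaching leaves.\<close>

inductive grown :: "('v, 'e) pre_digraph \<Rightarrow> 'v set \<Rightarrow> 'e set \<Rightarrow> bool" for G where
  root: "grown G {v} {}"
| leaf: "grown G V S \<Longrightarrow> u \<in> V \<Longrightarrow> v \<notin> V \<Longrightarrow> {tail G e, head G e} = {u, v}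
    \<Longrightarrow> grown G (insert v V) (insert e S)"

lemma grown_finite:
  assumes "grown G V S" shows "finite V" "finite S" "V \<noteq> {}"
  using assms by (induction) auto

lemma grown_ends:
  assumes "grown G V S" "e \<in> S"
  shows "tail G e \<in> V \<and> head G e \<in> V \<and> tail G e \<noteq> head G e"
  using assms by (induction) (auto simp: doubleton_eq_iff)

text \<open>The newest arc is the only one that touches the newest leaf. Recovering an arc of
  \<open>S\<close> from its unordered ends is what later lets \<open>S\<close> index both the twin
  pairs and the independent matrix entries.\<close>

lemma grown_ends_inj:
  assumes "grown G V S"
  shows "\<forall>e\<in>S. \<forall>e'\<in>S. {tail G e, head G e} = {tail G e', head G e'} \<longrightarrow> e = e'"
  using assms
proof (induction)
  case (leaf V S u v d)
  have S: "{tail G e, head G e} \<subseteq> V" if "e \<in> S" for e using grown_ends[OF leaf(1) that] by auto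
  have d: "\<not> {tail G d, head G d} \<subseteq> V" using leaf by auto
  show ?case
  proof (intro ballI impI)
    fix e e' assume e: "e \<in> insert d S" "e' \<in> insert d S" and eq: "{tail G e, head G e} = {tail G e', head G e'}"
    have "e = d \<longleftrightarrow> e' = d" using e eq d S[of e] S[of e'] by (metis insertE)
    then show "e = e'" using leaf.IH e eq by blast
  qed
qed auto

lemma grown_leaf_notin:
  assumes "grown G V S" "v \<notin> V" "{tail G e, head G e} = {u, v}"
  shows "e \<notin> S"
  using grown_ends[OF assms(1)] assms(2,3) by (metis insert_absorb insert_iff singletonD)

lemma rtrancl_exit:
  assumes "(x, y) \<in> r\<^sup>*" "x \<in> A" "y \<notin> A"
  obtains a b where "(a, b) \<in> r" "a \<in> A" "b \<notin> A"
  using assms by (induction) auto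

lemma connected_rtrancl:
  assumes "wf_digraph G" "connected G" "x \<in> verts G" "y \<in> verts G"
  shows "(x, y) \<in> (arc_rel G (arcs G))\<^sup>*"
proof -
  have "reachable (with_proj (mk_symmetric G)) x y"
    using assms by (auto simp: connected_def strongly_connected_def)
  from reachable_rtranclI[OF this] show ?thesis
    by (simp add: parcs_mk_symmetric arc_rel_def)
qed

text \<open>A largest vertex set that can be grown inside \<open>G\<close> must be everything:
  otherwise a path leaving it contains an arc with exactly one end inside, and this arc attaches one
  more leaf.\<close>

lemma grown_spanning_exists:
  assumes "fin_digraph G" "connected G"
  obtains S where "S \<subseteq> arcs G" "grown G (verts G) S"
proof -
  interpret fin_digraph G by fact
  define P where "P V \<longleftrightarrow> V \<subseteq> verts G \<and> (\<exists>S\<subseteq>arcs G. grown G V S)" for V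
  obtain v where v: "v \<in> verts G"
    using assms(2) by (auto simp: connected_def strongly_connected_def)
  have "P {v}" using v by (auto simp: P_def intro: grown.root)
  moreover have "\<forall>V. P V \<longrightarrow> card V < Suc (card (verts G))"
    by (auto simp: P_def less_Suc_eq_le intro: card_mono)
  ultimately have "\<exists>V. P V \<and> (\<forall>V'. P V' \<longrightarrow> card V' \<le> card V)"
    by (rule ex_has_greatest_nat)
  then obtain V where V: "P V" and mx: "\<And>V'. P V' \<Longrightarrow> card V' \<le> card V" by blast
  obtain S where S: "S \<subseteq> arcs G" "grown G V S" "V \<subseteq> verts G" using V by (auto simp: P_def)
  have "V = verts G"
  proof (rule ccontr)
    assume "V \<noteq> verts G"
    then obtain y where y: "y \<in> verts G" "y \<notin> V" using S by auto
    obtain x where x: "x \<in> V" using grown_finite[OF S(2)] by auto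
    have "(x, y) \<in> (arc_rel G (arcs G))\<^sup>*"
      using connected_rtrancl[OF wf_digraph assms(2)] x y S(3) by auto
    from rtrancl_exit[OF this x y(2)]
    obtain a b where ab: "(a, b) \<in> arc_rel G (arcs G)" "a \<in> V" "b \<notin> V" .
    then obtain e where e: "e \<in> arcs G" "{tail G e, head G e} = {a, b}"
      by (auto simp: arc_rel_def)
    have "grown G (insert b V) (insert e S)" using S ab e by (intro grown.leaf) auto
    moreover have "b \<in> verts G" using e by (metis doubleton_eq_iff head_in_verts tail_in_verts)
    ultimately have "P (insert b V)" unfolding P_def using S e
      by (intro conjI exI[of _ "insert e S"]) auto
    from mx[OF this] show False using ab grown_finite[OF S(2)] by auto
  qed
  with S that show ?thesis by auto
qed

text \<open>The newest leaf has only one neighbour. On a closed walk through at least three distinct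
  vertices it would have two, so the walk avoids it and lives in the smaller tree.\<close>

lemma grown_no_cycle:
  assumes "grown G V S" "distinct xs" "length xs \<ge> 3"
    "\<And>i. i < length xs \<Longrightarrow> (xs ! i, xs ! (Suc i mod length xs)) \<in> arc_rel G S"
  shows False
  using assms
proof (induction)
  case (root v)
  have "(xs ! 0, xs ! (Suc 0 mod length xs)) \<in> arc_rel G {}" using root by force
  then show ?case by (auto simp: arc_rel_def)
next
  case (leaf V S u v e)
  let ?m = "length xs"
  have inV: "a \<in> V \<and> b \<in> V" if "(a, b) \<in> arc_rel G S" for a b
    using that grown_ends[OF leaf(1)] by (auto simp: arc_rel_def)
  have nb: "a = u" if "(a, v) \<in> arc_rel G (insert e S) \<or> (v, a) \<in> arc_rel G (insert e S)" for a
    using that inV leaf(2,3,4) by (auto simp: arc_rel_insert doubleton_eq_iff)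
  show ?case
  proof (cases "v \<in> set xs")
    case False
    have "(xs ! i, xs ! (Suc i mod ?m)) \<in> arc_rel G S" if "i < ?m" for i
    proof -
      have "Suc i mod ?m < ?m" using leaf(7) by (intro mod_less_divisor) linarith
      then have "xs ! i \<noteq> v" "xs ! (Suc i mod ?m) \<noteq> v" using False that nth_mem by metis+
      then show ?thesis using leaf(8)[OF that] leaf(4) by (auto simp: arc_rel_insert doubleton_eq_iff)
    qed
    then show ?thesis using leaf.IH leaf.prems by auto
  next
    case True
    then obtain i where i: "i < ?m" "xs ! i = v" by (auto simp: in_set_conv_nth)
    \<comment> \<open>\<open>j\<close> and \<open>k\<close> are the cyclic successor and predecessor
      of position \<open>i\<close>. They differ because the length exceeds 2, yet both carry the
      vertex \<open>u\<close>.\<close>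
    define j where "j = Suc i mod ?m"
    define k where "k = (if i = 0 then ?m - 1 else i - 1)"
    have k: "k < ?m" "Suc k mod ?m = i" using i leaf(7) by (auto simp: k_def)
    have j: "j < ?m" unfolding j_def using leaf(7) by (intro mod_less_divisor) linarith
    have "j \<noteq> k"
    proof (cases "Suc i = ?m")
      case True then show ?thesis using leaf(7) by (simp add: j_def k_def) 
    next
      case False then have "j = Suc i" using i by (auto simp: j_def)
      then show ?thesis using leaf(7) by (auto simp: k_def split: if_splits)
    qed
    moreover have "xs ! j = u" using nb leaf(8)[OF i(1)] i by (auto simp: j_def)
    moreover have "xs ! k = u" using nb leaf(8)[OF k(1)] i k by auto
    ultimately show False using leaf(6) j k by (metis nth_eq_iff_index_eq)
  qed
qed

lemma grown_rtrancl:
  assumes "grown G V S" "x \<in> V" "y \<in> V"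
  shows "(x, y) \<in> (arc_rel G S)\<^sup>*"
  using assms
proof (induction arbitrary: x y)
  case (leaf V S u v e)
  let ?r = "arc_rel G (insert e S)"
  have mono: "(arc_rel G S)\<^sup>* \<subseteq> ?r\<^sup>*" by (intro rtrancl_mono) (auto simp: arc_rel_insert)
  have uv: "(u, v) \<in> ?r\<^sup>*" "(v, u) \<in> ?r\<^sup>*" using leaf(4) by (auto simp: arc_rel_insert doubleton_eq_iff)
  have "(x, u) \<in> ?r\<^sup>*" if "x \<in> insert v V" for x
    using that uv leaf.IH[of x u] leaf(2) mono by auto
  moreover have "(u, y) \<in> ?r\<^sup>*" if "y \<in> insert v V" for y
    using that uv leaf.IH[of u y] leaf(2) mono by auto
  ultimately show ?case using leaf.prems by (metis rtrancl_trans)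
qed auto

section \<open>Cycles of the underlying graph and doubled spanning trees\<close>

lemma wf_arcs_subset: "wf_digraph G \<Longrightarrow> S \<subseteq> arcs G \<Longrightarrow> wf_digraph (G\<lparr>arcs := S\<rparr>)"
  by (auto simp: wf_digraph_def)

text \<open>Reachability in a digraph only relates vertices, whereas the reflexive closure relates
  every element of the type to itself; hence the two membership conditions.\<close>

lemma reachable_restrict_arcs:
  assumes "wf_digraph G" "A \<subseteq> arcs G"
  shows "reachable (with_proj (mk_symmetric (G\<lparr>arcs := A\<rparr>))) x y
     \<longleftrightarrow> x \<in> verts G \<and> y \<in> verts G \<and> (x, y) \<in> (arc_rel G A)\<^sup>*"
proof -
  interpret S: pair_wf_digraph "mk_symmetric (G\<lparr>arcs := A\<rparr>)"
    using wf_arcs_subset[OF assms] by (rule wf_digraph.wellformed_mk_symmetric)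
  show ?thesis unfolding S.reachable_conv by (auto simp: parcs_mk_symmetric arc_rel_def)
qed

text \<open>Otherwise the arc and the path joining its ends in the spanning tree form a cycle of length
  other than 2.\<close>

lemma underlying_tree_chord:
  assumes "wf_digraph G" "underlying_tree G" "grown G (verts G) S" "S \<subseteq> arcs G" "e \<in> arcs G"
  shows "(tail G e, head G e) \<in> arc_rel G S"
proof (rule ccontr)
  assume nin: "(tail G e, head G e) \<notin> arc_rel G S"
  define x y where "x = tail G e" and "y = head G e"
  interpret wf_digraph G by fact
  let ?H = "mk_symmetric (G\<lparr>arcs := S\<rparr>)"
  interpret H: pair_wf_digraph ?H
    using wf_arcs_subset[OF assms(1,4)] by (rule wf_digraph.wellformed_mk_symmetric)
  interpret Y: pair_wf_digraph "mk_symmetric G"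
    by (rule wellformed_mk_symmetric)
  have xy: "x \<in> verts G" "y \<in> verts G" using assms(5) by (auto simp: x_def y_def)
  have sub: "parcs ?H \<subseteq> parcs (mk_symmetric G)" using assms(4) by (auto simp: parcs_mk_symmetric)
  have "reachable (with_proj ?H) x y"
    using reachable_restrict_arcs[OF assms(1,4)] xy grown_rtrancl[OF assms(3)] by auto
  then obtain p where p: "H.apath x p y" using H.reachable_apath by blast
  have yx: "(y, x) \<in> parcs (mk_symmetric G)" using assms(5)
    by (force simp: parcs_mk_symmetric x_def y_def)
  \<comment> \<open>The closing step \<open>(y, x)\<close> makes the cycle one longer than
    \<open>p\<close>, so length 1 is the only case that an underlying tree would permit. A loop is
    covered as well: then \<open>p\<close> is empty and the cycle has length 1.\<close>
  have len: "length p \<noteq> 1"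
  proof
    assume "length p = 1"
    then obtain d where "p = [d]" by (cases p) auto
    then have "(x, y) \<in> parcs ?H" using p by (auto simp: H.apath_simps)
    then show False using nin by (auto simp: parcs_mk_symmetric arc_rel_def x_def y_def)
  qed
  have aw: "H.awalk x p y" and di: "distinct (pawalk_verts x p)" 
    using p by (auto simp: H.apath_def)
  have "Y.awalk x p y" using aw sub by (auto simp: H.awalk_def Y.awalk_def)
  then have "Y.awalk x (p @ [(y, x)]) x"
    using yx xy by (intro Y.awalk_appendI) (auto simp: Y.awalk_simps)
  moreover have "distinct (tl (pawalk_verts x (p @ [(y, x)])))"
  proof -
    have cas: "pcas x p y" using aw by (auto simp: H.awalk_def)
    have vs: "pawalk_verts x p = x # map snd p" if "pcas x p y" for p :: "('a \<times> 'a) list" and x y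
      using that by (induct x p y rule: pcas.induct) auto
    have c2: "pcas x (p @ [(y, x)]) x" using \<open>Y.awalk x (p @ [(y, x)]) x\<close> by (simp only: Y.awalk_def)
    show ?thesis unfolding vs[OF c2] using di unfolding vs[OF cas] by auto
  qed
  ultimately have "Y.cycle (p @ [(y, x)])" unfolding Y.cycle_def by blast
  then have "length (p @ [(y, x)]) = 2" using assms(2) unfolding underlying_tree_def by blast
  then show False using len by auto
qed

text \<open>The vertices of a cycle, read off as second components of its steps, form a closed walk
  in the tree. \<open>grown_no_cycle\<close> excludes lengths from 3 on and a cycle of length 1
  would be a loop in \<open>S\<close>, so only walking back and forth along one edge
  remains.\<close>

lemma grown_underlying_tree:
  assumes "wf_digraph G" "connected G" "grown G (verts G) S"
    "\<And>e. e \<in> arcs G \<Longrightarrow> (tail G e, head G e) \<in> arc_rel G S"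
  shows "underlying_tree G"
  unfolding underlying_tree_def
proof (intro conjI allI impI)
  fix p assume cyc: "pre_digraph.cycle (with_proj (mk_symmetric G)) p"
  interpret wf_digraph G by fact
  interpret Y: pair_wf_digraph "mk_symmetric G"
    by (rule wellformed_mk_symmetric)
  obtain u where u: "Y.awalk u p u" "distinct (tl (pawalk_verts u p))" "p \<noteq> []"
    using cyc unfolding Y.cycle_def by auto
  have cas: "pcas u p u" and arcs: "set p \<subseteq> parcs (mk_symmetric G)" using u by (auto simp: Y.awalk_def)
  have vs: "pawalk_verts x p = x # map snd p" if "pcas x p y" for p :: "('a \<times> 'a) list" and x y
    using that by (induct x p y rule: pcas.induct) auto
  have casnth: "pcas x p y \<Longrightarrow> i < length p \<Longrightarrow> p ! i = ((x # map snd p) ! i, map snd p ! i)"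
    for p :: "('a \<times> 'a) list" and x y i
  proof (induct x p y arbitrary: i rule: pcas.induct)
    case (2 u e es v) then show ?case by (cases i) auto
  qed auto
  have lastu: "p \<noteq> [] \<Longrightarrow> pcas x p y \<Longrightarrow> snd (last p) = y" for p :: "('a \<times> 'a) list" and x y
    by (induct x p y rule: pcas.induct) auto
  define xs where "xs = map snd p"
  have dx: "distinct xs" using u(2) unfolding vs[OF cas] xs_def by simp
  have lx: "length xs = length p" by (simp add: xs_def)
  have sub: "parcs (mk_symmetric G) \<subseteq> arc_rel G S"
    using assms(4) sym_arc_rel[of G S] by (auto simp: parcs_mk_symmetric sym_def)
  have adj: "(xs ! i, xs ! (Suc i mod length xs)) \<in> arc_rel G S" if "i < length xs" for i
  proof (cases "Suc i = length xs")
    case True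
    have "xs ! i = u" using lastu[OF u(3) cas] True u(3) 
      by (metis One_nat_def diff_Suc_1 last_conv_nth last_map length_map map_is_Nil_conv xs_def)
    moreover have "p ! 0 = (u, xs ! 0)" using casnth[OF cas, of 0] u(3) by (auto simp: xs_def)
    moreover have "p ! 0 \<in> set p" using u(3) by simp
    ultimately show ?thesis using True arcs sub by auto
  next
    case False
    then have "Suc i < length xs" using that by auto
    moreover have "p ! Suc i = (xs ! i, xs ! Suc i)" 
      using casnth[OF cas, of "Suc i"] calculation by (auto simp: xs_def)
    moreover have "p ! Suc i \<in> set p" using calculation lx by (metis nth_mem)
    ultimately show ?thesis using arcs sub by auto
  qed
  have "\<not> length xs \<ge> 3" using grown_no_cycle[OF assms(3) dx _ adj] by blast
  moreover have "length xs \<noteq> 1"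
  proof
    assume "length xs = 1"
    then have "(xs ! 0, xs ! 0) \<in> arc_rel G S" using adj[of 0] by auto
    then obtain e where "e \<in> S" "tail G e = head G e" by (auto simp: arc_rel_def)
    then show False using grown_ends[OF assms(3)] by blast
  qed
  moreover have "length xs > 0" using u(3) lx by simp
  ultimately show "length p = 2" using lx by linarith
qed (use assms in auto)

text \<open>Only the injectivity of unordered ends on \<open>S\<close> is assumed, not that
  \<open>S\<close> is a spanning tree. The result thus applies both to the test graph and to the
  reduced forest, where \<open>S\<close> is replaced by the arcs that survive.\<close>

lemma twins_doubled:
  assumes ar: "arcs G = S \<union> p ` S"
    and p': "\<forall>e\<in>S. {tail G (p e), head G (p e)} = {tail G e, head G e}"
    and inj': "\<forall>d\<in>S. \<forall>e\<in>S. {tail G d, head G d} = {tail G e, head G e} \<longrightarrow> d = e"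
  shows "e \<in> S \<Longrightarrow> twins G e = {e, p e}"
    and "twin_pairs G = twins G ` S" and "inj_on (twins G) S"
proof -
  have p: "{tail G (p e), head G (p e)} = {tail G e, head G e}" if "e \<in> S" for e
    using p' that by (rule bspec)
  have inj: "d = e" if "d \<in> S" "e \<in> S" "{tail G d, head G d} = {tail G e, head G e}" for d e
    using inj'[THEN bspec, THEN bspec, THEN mp, OF that] .
  have tw: "twins G e = {e, p e}" if e: "e \<in> S" for e
  proof -
    have "d \<in> {e, p e}" if "d \<in> twins G e" for d
    proof -
      have d: "d \<in> arcs G" "{tail G d, head G d} = {tail G e, head G e}"
        using that by (simp_all add: twins_def)
      from d(1) consider "d \<in> S" | s where "s \<in> S" "d = p s" unfolding ar by blast
      then show ?thesis
      proof cases
        case 1 then show ?thesis using inj[OF _ e d(2)] by simp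
      next
        case 2
        then have "{tail G s, head G s} = {tail G e, head G e}" using p[OF 2(1)] d(2) by simp
        then show ?thesis using inj[OF 2(1) e] 2 by simp
      qed
    qed
    moreover have "{e, p e} \<subseteq> twins G e" using e p[OF e] unfolding twins_def ar by simp
    ultimately show ?thesis by blast
  qed
  then show "e \<in> S \<Longrightarrow> twins G e = {e, p e}" .
  have "twins G (p e) = twins G e" if "e \<in> S" for e using p[OF that] unfolding twins_def by simp
  then have "twins G ` p ` S = twins G ` S" unfolding image_image by (rule image_cong[OF refl])
  then show "twin_pairs G = twins G ` S" unfolding twin_pairs_def ar image_Un by (simp only: Un_absorb)
  show "inj_on (twins G) S"
  proof (rule inj_onI)
    fix d e assume e: "d \<in> S" "e \<in> S" and eq: "twins G d = twins G e"
    have "d \<in> twins G d" using tw[OF e(1)] by simp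
    then have "d \<in> twins G e" unfolding eq .
    then have "{tail G d, head G d} = {tail G e, head G e}" by (simp only: twins_def mem_Collect_eq)
    then show "d = e" by (rule inj[OF e])
  qed
qed

text \<open>In an underlying tree every arc is parallel to some arc \<open>s\<close> of the spanning
  tree, and the twin class of \<open>s\<close> is already exhausted by \<open>s\<close> and
  \<open>p s\<close>. The set equation on the right is the form in which the case distinction is
  made; its failure produces surplus arcs.\<close>

lemma colored_double_tree_iff:
  assumes "wf_digraph G" "connected G" "grown G (verts G) S" "S \<subseteq> arcs G"
    and p: "\<And>e. e \<in> S \<Longrightarrow> p e \<in> arcs G \<and> p e \<noteq> e \<and> \<gamma> (p e) = \<gamma> e \<and>
             {tail G (p e), head G (p e)} = {tail G e, head G e}"
  shows "colored_double_tree \<gamma> G \<longleftrightarrow> arcs G = S \<union> p ` S"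
proof
  assume cdt: "colored_double_tree \<gamma> G"
  have "e \<in> S \<union> p ` S" if e: "e \<in> arcs G" for e
  proof -
    have "(tail G e, head G e) \<in> arc_rel G S"
      using underlying_tree_chord assms(1,3,4) cdt e by (auto simp: colored_double_tree_def)
    then obtain s where s: "s \<in> S" "{tail G e, head G e} = {tail G s, head G s}"
      by (fastforce simp: arc_rel_def)
    have sub: "{s, p s, e} \<subseteq> twins G s" using s p[OF s(1)] e assms(4) by (auto simp: twins_def)
    have "card (twins G s) = 2" using cdt s assms(4) by (auto simp: colored_double_tree_def)
    moreover have "card {s, p s} = 2" using p[OF s(1)] by auto
    ultimately have "twins G s = {s, p s}" using sub
      by (intro card_subset_eq[symmetric]) (auto intro: card_ge_0_finite)
    then show ?thesis using sub s by auto
  qed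
  then show "arcs G = S \<union> p ` S" using assms(4) p by auto
next
  assume ar: "arcs G = S \<union> p ` S"
  have rel: "(tail G e, head G e) \<in> arc_rel G S" if "e \<in> arcs G" for e
    using that p unfolding ar by (auto simp: arc_rel_def doubleton_eq_iff; force)
  have "\<forall>e\<in>S. {tail G (p e), head G (p e)} = {tail G e, head G e}" using p by blast
  from twins_doubled(1)[OF ar this grown_ends_inj[OF assms(3)]]
  have tw: "twins G s = {s, p s}" if "s \<in> S" for s using that .
  have "card (twins G e) = 2 \<and> (\<forall>e'\<in>twins G e. \<gamma> e' = \<gamma> e)" if "e \<in> arcs G" for e
  proof -
    have "e \<in> S \<union> p ` S" using that ar by simp
    then obtain s where s: "s \<in> S" "e = s \<or> e = p s" by blast
    then have "twins G e = {s, p s}" using p[OF s(1)] tw[OF s(1)] by (auto simp: twins_def)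
    then show ?thesis using s(2) p[OF s(1)] by auto
  qed
  moreover have "underlying_tree G" using grown_underlying_tree assms rel by auto
  ultimately show "colored_double_tree \<gamma> G" by (auto simp: colored_double_tree_def)
qed

section \<open>Sums over embeddings of a tree\<close>

lemma sum_PiE_insert:
  fixes F :: "('a \<Rightarrow> 'b) \<Rightarrow> 'c::comm_monoid_add"
  assumes "v \<notin> V"
  shows "(\<Sum>\<phi>\<in>insert v V \<rightarrow>\<^sub>E A. F \<phi>) = (\<Sum>\<phi>\<in>V \<rightarrow>\<^sub>E A. \<Sum>k\<in>A. F (\<phi>(v := k)))"
proof -
  have "(\<Sum>\<phi>\<in>insert v V \<rightarrow>\<^sub>E A. F \<phi>) = (\<Sum>(k, \<phi>)\<in>A \<times> (V \<rightarrow>\<^sub>E A). F (\<phi>(v := k)))"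
    unfolding PiE_insert_eq
    by (subst sum.reindex) (auto intro!: inj_combinator assms sum.cong)
  also have "\<dots> = (\<Sum>\<phi>\<in>V \<rightarrow>\<^sub>E A. \<Sum>k\<in>A. F (\<phi>(v := k)))"
    unfolding sum.cartesian_product[symmetric] by (rule sum.swap)
  finally show ?thesis .
qed

lemma band_count:
  "(\<Sum>k=1..n. of_bool (\<bar>int j - int k\<bar> \<le> int b) :: real) \<le> 2 * real b + 1"
proof -
  have "{k \<in> {1..n}. \<bar>int j - int k\<bar> \<le> int b} \<subseteq> {j - b..j + b}" by auto
  then have "card {k \<in> {1..n}. \<bar>int j - int k\<bar> \<le> int b} \<le> card {j - b..j + b}"
    by (intro card_mono) auto
  also have "\<dots> \<le> 2 * b + 1" by auto
  finally have "real (card {k \<in> {1..n}. \<bar>int j - int k\<bar> \<le> int b}) \<le> 2 * real b + 1" by linarith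
  then show ?thesis by (simp add: Int_def of_bool_def sum.If_cases flip: sum.inter_filter)
qed

definition band_weight ::
  "('v, 'e) pre_digraph \<Rightarrow> ('e \<Rightarrow> real) \<Rightarrow> ('e \<Rightarrow> nat) \<Rightarrow> 'e set \<Rightarrow> ('v \<Rightarrow> nat) \<Rightarrow> real" where
  "band_weight G w b S \<phi> =
     (\<Prod>e\<in>S. w e * of_bool (\<bar>int (\<phi> (tail G e)) - int (\<phi> (head G e))\<bar> \<le> int (b e)))"

lemma band_weight_cong:
  "(\<And>e. e \<in> S \<Longrightarrow> \<phi> (tail G e) = \<psi> (tail G e) \<and> \<phi> (head G e) = \<psi> (head G e))
    \<Longrightarrow> band_weight G w b S \<phi> = band_weight G w b S \<psi>"
  unfolding band_weight_def by (intro prod.cong) auto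

lemma band_weight_nonneg: "(\<And>e. e \<in> S \<Longrightarrow> 0 \<le> w e) \<Longrightarrow> 0 \<le> band_weight G w b S \<phi>"
  unfolding band_weight_def by (intro prod_nonneg) auto

lemma band_weight_leaf:
  assumes "grown G V S" "u \<in> V" "v \<notin> V" "{tail G e, head G e} = {u, v}"
  shows "band_weight G w b (insert e S) (\<phi>(v := k))
    = band_weight G w b S \<phi> * (w e * of_bool (\<bar>int (\<phi> u) - int k\<bar> \<le> int (b e)))"
proof -
  have "e \<notin> S" using grown_leaf_notin assms by metis
  moreover have "band_weight G w b S (\<phi>(v := k)) = band_weight G w b S \<phi>"
    using grown_ends[OF assms(1)] assms(3) by (intro band_weight_cong) auto
  ultimately show ?thesis
    using grown_finite[OF assms(1)] assms
    by (auto simp: band_weight_def doubleton_eq_iff abs_minus_commute)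
qed

text \<open>Summing out a leaf costs at most its band mass
  \<open>w e * (2 * real (b e) + 1)\<close>. The function \<open>h\<close> may sit at any vertex,
  because the errors to which this is applied are small only in the mean over positions.\<close>

lemma grown_marginal_bound:
  assumes "grown G V S" "x \<in> V" "\<And>e. e \<in> S \<Longrightarrow> 0 \<le> w e" "\<And>j. 0 \<le> h j"
  shows "(\<Sum>\<phi>\<in>V \<rightarrow>\<^sub>E {1..n}. band_weight G w b S \<phi> * h (\<phi> x))
     \<le> (\<Prod>e\<in>S. w e * (2 * real (b e) + 1)) * (\<Sum>j=1..n. h j)"
  using assms
proof (induction arbitrary: x h)
  case (root v)
  have "(\<Sum>\<phi>\<in>{v} \<rightarrow>\<^sub>E {1..n}. h (\<phi> v)) = (\<Sum>j=1..n. h j)"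
    by (subst sum_PiE_insert) auto
  then show ?case using root by (simp add: band_weight_def)
next
  case (leaf V S u v e)
  let ?i = "\<lambda>j k. of_bool (\<bar>int j - int k\<bar> \<le> int (b e)) :: real"
  have fin: "finite S" "e \<notin> S" using grown_finite[OF leaf(1)] grown_leaf_notin leaf by metis+
  have we: "0 \<le> w e" and wS: "\<And>e. e \<in> S \<Longrightarrow> 0 \<le> w e" using leaf.prems by auto
  have bn: "0 \<le> band_weight G w b S \<phi>" for \<phi> using wS by (rule band_weight_nonneg)
  have pn: "0 \<le> (\<Prod>e\<in>S. w e * (2 * real (b e) + 1))" using wS by (intro prod_nonneg) auto
  have eq: "(\<Sum>\<phi>\<in>insert v V \<rightarrow>\<^sub>E {1..n}. band_weight G w b (insert e S) \<phi> * h (\<phi> x))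
     = (\<Sum>\<phi>\<in>V \<rightarrow>\<^sub>E {1..n}. band_weight G w b S \<phi> * (\<Sum>k=1..n. w e * ?i (\<phi> u) k * h ((\<phi>(v := k)) x)))"
    by (simp only: sum_PiE_insert[OF leaf(3)] band_weight_leaf[OF leaf(1-4)] sum_distrib_left mult_ac)
  show ?case
  proof (cases "x = v")
    \<comment> \<open>If \<open>h\<close> sits on the leaf, it is replaced by its band sum at the
      neighbour \<open>u\<close>, to which the induction hypothesis applies. Exchanging the two sums
      then leaves column sums, bounded like row sums by symmetry of the band.\<close>
    case True
    have "(\<Sum>\<phi>\<in>V \<rightarrow>\<^sub>E {1..n}. band_weight G w b S \<phi> * (\<Sum>k=1..n. w e * ?i (\<phi> u) k * h ((\<phi>(v := k)) x)))
      = (\<Sum>\<phi>\<in>V \<rightarrow>\<^sub>E {1..n}. band_weight G w b S \<phi> * (\<lambda>j. \<Sum>k=1..n. w e * ?i j k * h k) (\<phi> u))"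
      using True by simp
    also have "\<dots> \<le> (\<Prod>e\<in>S. w e * (2 * real (b e) + 1)) * (\<Sum>j=1..n. \<Sum>k=1..n. w e * ?i j k * h k)"
      using leaf.IH[OF leaf(2) wS, of "\<lambda>j. \<Sum>k=1..n. w e * ?i j k * h k"] leaf.prems(3) we
      by (simp add: sum_nonneg)
    also have "(\<Sum>j=1..n. \<Sum>k=1..n. w e * ?i j k * h k) = (\<Sum>k=1..n. w e * (\<Sum>j=1..n. ?i k j) * h k)"
      unfolding sum_distrib_left sum_distrib_right
      by (subst sum.swap) (simp only: abs_minus_commute[of "int _" "int _"])
    also have "(\<Prod>e\<in>S. w e * (2 * real (b e) + 1)) * \<dots>
        \<le> (\<Prod>e\<in>S. w e * (2 * real (b e) + 1)) * (\<Sum>k=1..n. w e * (2 * real (b e) + 1) * h k)"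
      using we leaf.prems(3) band_count
      by (intro mult_left_mono[OF _ pn] sum_mono mult_right_mono mult_left_mono) auto
    also have "(\<Sum>k=1..n. w e * (2 * real (b e) + 1) * h k) = w e * (2 * real (b e) + 1) * (\<Sum>k=1..n. h k)"
      by (simp only: sum_distrib_left)
    finally show ?thesis unfolding eq prod.insert[OF fin] by (simp only: mult_ac)
  next
    case False
    then have x: "x \<in> V" using leaf.prems by auto
    have "(\<Sum>\<phi>\<in>V \<rightarrow>\<^sub>E {1..n}. band_weight G w b S \<phi> * (\<Sum>k=1..n. w e * ?i (\<phi> u) k * h ((\<phi>(v := k)) x)))
      = (\<Sum>\<phi>\<in>V \<rightarrow>\<^sub>E {1..n}. band_weight G w b S \<phi> * (w e * (\<Sum>k=1..n. ?i (\<phi> u) k) * h (\<phi> x)))"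
      unfolding sum_distrib_left sum_distrib_right using False by simp
    also have "\<dots> \<le> (\<Sum>\<phi>\<in>V \<rightarrow>\<^sub>E {1..n}. band_weight G w b S \<phi> * (w e * (2 * real (b e) + 1) * h (\<phi> x)))"
      using we leaf.prems(3) band_count bn by (intro sum_mono mult_right_mono mult_left_mono) auto
    also have "\<dots> = w e * (2 * real (b e) + 1) * (\<Sum>\<phi>\<in>V \<rightarrow>\<^sub>E {1..n}. band_weight G w b S \<phi> * h (\<phi> x))"
      by (simp add: sum_distrib_left mult_ac)
    also have "\<dots> \<le> w e * (2 * real (b e) + 1) * ((\<Prod>e\<in>S. w e * (2 * real (b e) + 1)) * (\<Sum>j=1..n. h j))"
      using leaf.IH[OF x wS, of h] leaf.prems(3) we by (intro mult_left_mono) auto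
    finally show ?thesis unfolding eq using fin by (simp add: mult_ac)
  qed
qed

section \<open>Sums over injections and removal of one leaf\<close>

definition injections :: "'v set \<Rightarrow> nat \<Rightarrow> ('v \<Rightarrow> nat) set" where
  "injections V n = {\<phi>. \<phi> \<in> V \<rightarrow>\<^sub>E {1..n} \<and> inj_on \<phi> V}"

lemma injections_subset: "injections V n \<subseteq> V \<rightarrow>\<^sub>E {1..n}"
  by (auto simp: injections_def)

lemma sum_injections_insert:
  fixes F :: "('v \<Rightarrow> nat) \<Rightarrow> real"
  assumes "v \<notin> V" "finite V"
  shows "(\<Sum>\<phi>\<in>injections (insert v V) n. F \<phi>) = (\<Sum>\<phi>\<in>injections V n. \<Sum>k\<in>{1..n} - \<phi> ` V. F (\<phi>(v := k)))"
proof -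
  have "(\<Sum>\<phi>\<in>injections W n. H \<phi>) = (\<Sum>\<phi>\<in>W \<rightarrow>\<^sub>E {1..n}. if inj_on \<phi> W then H \<phi> else 0)"
    if "finite W" for W and H :: "('v \<Rightarrow> nat) \<Rightarrow> real"
    unfolding injections_def using that
    by (simp add: sum.inter_filter[symmetric] finite_PiE)
  note conv = this
  have inj: "inj_on (\<phi>(v := k)) (insert v V) \<longleftrightarrow> inj_on \<phi> V \<and> k \<notin> \<phi> ` V" for \<phi> :: "'v \<Rightarrow> nat" and k
    using assms(1) by (auto simp: inj_on_def)
  show ?thesis
    unfolding conv[OF finite_insert[THEN iffD2, OF assms(2)]] conv[OF assms(2)] sum_PiE_insert[OF assms(1)] inj
    by (intro sum.cong refl) (auto simp: sum.inter_filter[symmetric] set_diff_eq)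
qed

text \<open>For the trace all test functions are 1. The general form is needed by the induction:
  removing a leaf multiplies the test function of its neighbour by the leaf's message. Positions are
  rescaled to the unit interval so that test functions do not depend on \<open>n\<close>.\<close>

definition band_avg ::
  "('v, 'e) pre_digraph \<Rightarrow> ('e \<Rightarrow> real) \<Rightarrow> ('e \<Rightarrow> nat) \<Rightarrow> nat \<Rightarrow> 'v set \<Rightarrow> 'e set \<Rightarrow> ('v \<Rightarrow> real \<Rightarrow> real) \<Rightarrow> real" where
  "band_avg G w b n V S f = (\<Sum>\<phi>\<in>injections V n.
     band_weight G w b S \<phi> * (\<Prod>v\<in>V. f v (real (\<phi> v) / real n))) / real n"

definition band_sum :: "real \<Rightarrow> nat \<Rightarrow> nat \<Rightarrow> (real \<Rightarrow> real) \<Rightarrow> nat \<Rightarrow> real" where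
  "band_sum w b n f j = (\<Sum>k=1..n. w * of_bool (\<bar>int j - int k\<bar> \<le> int b) * f (real k / real n))"

lemma prod_fun_upd_mult:
  fixes f :: "'v \<Rightarrow> 'a \<Rightarrow> 'b::comm_monoid_mult"
  assumes "finite V" "u \<in> V"
  shows "(\<Prod>x\<in>V. (f(u := \<lambda>y. f u y * g y)) x (p x)) = (\<Prod>x\<in>V. f x (p x)) * g (p u)"
proof -
  have "(\<Prod>x\<in>V - {u}. (f(u := \<lambda>y. f u y * g y)) x (p x)) = (\<Prod>x\<in>V - {u}. f x (p x))"
    by (rule prod.cong) auto
  then show ?thesis
    unfolding prod.remove[OF assms, of "\<lambda>x. (f(u := \<lambda>y. f u y * g y)) x (p x)"]
      prod.remove[OF assms, of "\<lambda>x. f x (p x)"]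
    by (simp only: fun_upd_same mult.assoc mult.commute mult.left_commute)
qed

text \<open>Two errors arise. Replacing the band sum at the leaf by \<open>g\<close> costs their
  distance, which \<open>grown_marginal_bound\<close> at \<open>u\<close> turns into an average over
  all positions. The leaf must also avoid the at most \<open>card V\<close> occupied sites, each of
  which contributes at most \<open>w e * B v\<close>.\<close>

lemma band_avg_leaf_diff:
  assumes G: "grown G V S" "u \<in> V" "v \<notin> V" "{tail G e, head G e} = {u, v}"
    and w: "\<And>d. d \<in> S \<Longrightarrow> 0 \<le> w d" and we: "0 \<le> w e" and n: "0 < n"
    and B: "\<And>x y. x \<in> insert v V \<Longrightarrow> y \<in> {0..1} \<Longrightarrow> \<bar>f x y\<bar> \<le> B x"
  shows "\<bar>band_avg G w b n (insert v V) (insert e S) f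
      - band_avg G w b n V S (f(u := \<lambda>x. f u x * g x))\<bar>
    \<le> (\<Prod>v\<in>V. B v) * (\<Prod>e\<in>S. w e * (2 * real (b e) + 1))
      * ((\<Sum>j=1..n. \<bar>band_sum (w e) (b e) n (f v) j - g (real j / real n)\<bar>) / real n + real (card V) * w e * B v)"
proof -
  have finV: "finite V" using grown_finite[OF G(1)] by auto
  have B0: "0 \<le> B x" if "x \<in> insert v V" for x using B[OF that, of 0] by auto
  have unit: "real k / real n \<in> {0..1}" if "k \<in> {1..n}" for k using that n by auto
  let ?W = "band_weight G w b S"
  let ?t = "\<lambda>j k. w e * of_bool (\<bar>int j - int k\<bar> \<le> int (b e)) * f v (real k / real n)"
  let ?P = "\<lambda>\<phi>. \<Prod>x\<in>V. f x (real (\<phi> x) / real n)"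
  let ?R = "\<lambda>\<phi>. (\<Sum>k\<in>{1..n} - \<phi> ` V. ?t (\<phi> u) k) - g (real (\<phi> u) / real n)"
  define h where "h j = \<bar>band_sum (w e) (b e) n (f v) j - g (real j / real n)\<bar> + real (card V) * (w e * B v)" for j
  have h0: "0 \<le> h j" for j using we B0[of v] by (auto simp: h_def)
  have upd: "(\<Prod>x\<in>insert v V. f x (real ((\<phi>(v := k)) x) / real n)) = f v (real k / real n) * ?P \<phi>" for \<phi> k
    using finV G(3) by (simp cong: prod.cong) (intro disjI2 prod.cong refl, auto)
  have 1: "band_avg G w b n (insert v V) (insert e S) f
     = (\<Sum>\<phi>\<in>injections V n. ?W \<phi> * ?P \<phi> * (\<Sum>k\<in>{1..n} - \<phi> ` V. ?t (\<phi> u) k)) / real n"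
    unfolding band_avg_def sum_injections_insert[OF G(3) finV] band_weight_leaf[OF G] upd
    by (simp add: sum_distrib_left mult_ac)
  have 2: "band_avg G w b n V S (f(u := \<lambda>x. f u x * g x))
     = (\<Sum>\<phi>\<in>injections V n. ?W \<phi> * ?P \<phi> * g (real (\<phi> u) / real n)) / real n"
  proof -
    define F where "F = f(u := \<lambda>x. f u x * g x)"
    have "(\<Prod>x\<in>V. F x (real (\<phi> x) / real n)) = ?P \<phi> * g (real (\<phi> u) / real n)" for \<phi>
      unfolding F_def by (rule prod_fun_upd_mult[OF finV G(2)])
    then show ?thesis unfolding band_avg_def F_def[symmetric] by (simp add: mult.assoc)
  qed
  have R: "\<bar>?R \<phi>\<bar> \<le> h (\<phi> u)" if "\<phi> \<in> injections V n" for \<phi>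
  proof -
    have sub: "\<phi> ` V \<subseteq> {1..n}" using that by (auto simp: injections_def)
    have "(\<Sum>k\<in>{1..n} - \<phi> ` V. ?t (\<phi> u) k) = band_sum (w e) (b e) n (f v) (\<phi> u) - (\<Sum>k\<in>\<phi> ` V. ?t (\<phi> u) k)"
      unfolding band_sum_def using sub by (intro sum_diff) auto
    moreover have "\<bar>\<Sum>k\<in>\<phi> ` V. ?t (\<phi> u) k\<bar> \<le> real (card V) * (w e * B v)"
    proof -
      have "\<bar>\<Sum>k\<in>\<phi> ` V. ?t (\<phi> u) k\<bar> \<le> (\<Sum>k\<in>\<phi> ` V. \<bar>?t (\<phi> u) k\<bar>)" by (rule sum_abs)
      also have "\<dots> \<le> (\<Sum>k\<in>\<phi> ` V. w e * B v)"
      proof (rule sum_mono)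
        fix k assume "k \<in> \<phi> ` V"
        then have "\<bar>f v (real k / real n)\<bar> \<le> B v" using sub by (intro B unit) auto
        then show "\<bar>?t (\<phi> u) k\<bar> \<le> w e * B v" using we B0[of v] by (auto simp: abs_mult mult_left_mono)
      qed
      also have "\<dots> \<le> real (card V) * (w e * B v)"
        using card_image_le[OF finV, of \<phi>] we B0[of v] by (simp add: mult_right_mono)
      finally show ?thesis .
    qed
    ultimately show ?thesis unfolding h_def by linarith
  qed
  have W0: "0 \<le> ?W \<phi>" for \<phi> using w by (rule band_weight_nonneg)
  have PB: "\<bar>?P \<phi>\<bar> \<le> (\<Prod>v\<in>V. B v)" if "\<phi> \<in> injections V n" for \<phi>
    unfolding abs_prod using that by (intro prod_mono) (auto simp: injections_def intro!: B unit)
  have PB0: "0 \<le> (\<Prod>v\<in>V. B v)" using B0 by (intro prod_nonneg) auto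
  have diff: "band_avg G w b n (insert v V) (insert e S) f - band_avg G w b n V S (f(u := \<lambda>x. f u x * g x))
     = (\<Sum>\<phi>\<in>injections V n. ?W \<phi> * ?P \<phi> * ?R \<phi>) / real n"
    unfolding 1 2 by (simp only: diff_divide_distrib[symmetric] sum_subtractf[symmetric] right_diff_distrib[symmetric])
  define Z where "Z = (\<Sum>j=1..n. \<bar>band_sum (w e) (b e) n (f v) j - g (real j / real n)\<bar>) / real n + real (card V) * w e * B v"
  have hZ: "(\<Sum>j=1..n. h j) = real n * Z"
    using n unfolding h_def Z_def by (simp add: sum.distrib distrib_left)
  have "\<bar>\<Sum>\<phi>\<in>injections V n. ?W \<phi> * ?P \<phi> * ?R \<phi>\<bar>
     \<le> (\<Sum>\<phi>\<in>injections V n. \<bar>?W \<phi> * ?P \<phi> * ?R \<phi>\<bar>)" by (rule sum_abs)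
  also have "\<dots> \<le> (\<Sum>\<phi>\<in>injections V n. ?W \<phi> * (\<Prod>v\<in>V. B v) * h (\<phi> u))"
    unfolding abs_mult using W0 PB R PB0 
    by (intro sum_mono mult_mono) (auto intro!: mult_nonneg_nonneg)
  \<comment> \<open>All terms are nonnegative by now, so the sum may be enlarged from injections to
    all maps, where the marginal bound is available.\<close>
  also have "\<dots> \<le> (\<Sum>\<phi>\<in>V \<rightarrow>\<^sub>E {1..n}. ?W \<phi> * (\<Prod>v\<in>V. B v) * h (\<phi> u))"
    using W0 PB0 h0 finV by (intro sum_mono2 injections_subset finite_PiE) (auto intro!: mult_nonneg_nonneg)
  also have "\<dots> = (\<Prod>v\<in>V. B v) * (\<Sum>\<phi>\<in>V \<rightarrow>\<^sub>E {1..n}. ?W \<phi> * h (\<phi> u))"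
    by (simp add: sum_distrib_left mult_ac)
  also have "\<dots> \<le> (\<Prod>v\<in>V. B v) * ((\<Prod>e\<in>S. w e * (2 * real (b e) + 1)) * (\<Sum>j=1..n. h j))"
    using grown_marginal_bound[OF G(1,2) w h0] PB0 by (intro mult_left_mono) auto
  finally have "\<bar>\<Sum>\<phi>\<in>injections V n. ?W \<phi> * ?P \<phi> * ?R \<phi>\<bar>
     \<le> real n * ((\<Prod>v\<in>V. B v) * (\<Prod>e\<in>S. w e * (2 * real (b e) + 1)) * Z)"
    unfolding hZ by (simp only: mult_ac)
  then show ?thesis unfolding diff Z_def[symmetric] using n by (simp add: pos_divide_le_eq mult.commute)
qed

section \<open>Limits of the band kernels\<close>

lemma unit_dominated_convergence:
  fixes s :: "nat \<Rightarrow> real \<Rightarrow> real"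
  assumes [measurable]: "\<And>n. s n \<in> borel_measurable borel" "f \<in> borel_measurable borel"
    and lim: "AE y in lborel. y \<in> {0..1} \<longrightarrow> (\<lambda>n. s n y) \<longlonglongrightarrow> f y"
    and bound: "\<And>n y. y \<in> {0..1} \<Longrightarrow> \<bar>s n y\<bar> \<le> B"
  shows "(\<lambda>n. LINT y:{0..1}|lborel. s n y) \<longlonglongrightarrow> (LINT y:{0..1}|lborel. f y)"
  unfolding set_lebesgue_integral_def
proof (rule integral_dominated_convergence[where w = "\<lambda>y. indicator {0..1} y * B"])
  show "AE y in lborel. (\<lambda>n. indicator {0..1} y *\<^sub>R s n y) \<longlonglongrightarrow> indicator {0..1} y *\<^sub>R f y"
    using lim by eventually_elim (auto simp: indicator_def)
  show "AE y in lborel. norm (indicator {0..1} y *\<^sub>R s n y) \<le> indicator {0..1} y * B" for n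
    using bound by (auto simp: indicator_def)
qed auto

text \<open>Strictly ordered limits make the truth value eventually constant. At equality it could
  oscillate, so the applications discard the boundary of the band as a null set.\<close>

lemma of_bool_le_tendsto:
  fixes s c :: "nat \<Rightarrow> real"
  assumes "s \<longlonglongrightarrow> x" "c \<longlonglongrightarrow> y" "x \<noteq> y"
  shows "(\<lambda>n. of_bool (s n \<le> c n) :: real) \<longlonglongrightarrow> of_bool (x \<le> y)"
proof -
  have "eventually (\<lambda>n. (s n \<le> c n) = (x \<le> y)) sequentially"
  proof (cases "x < y")
    case True
    with order_tendstoD(2)[OF tendsto_diff[OF assms(1,2)], of 0]
    show ?thesis by (auto elim: eventually_mono)
  next
    case False
    with assms(3) order_tendstoD(1)[OF tendsto_diff[OF assms(1,2)], of 0]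
    show ?thesis by (auto elim: eventually_mono)
  qed
  then show ?thesis by (intro tendsto_eventually) (auto elim: eventually_mono)
qed

text \<open>The index \<open>k\<close> of the interval \<open>((k - 1) / n, k / n]\<close> that
  contains \<open>y\<close>. It turns averages over \<open>{1..n}\<close> into integrals of step
  functions, to which dominated convergence applies. At \<open>y = 0\<close> the value is 0, which
  lies outside the index range.\<close>

definition cell :: "nat \<Rightarrow> real \<Rightarrow> nat" where "cell n y = nat \<lceil>real n * y\<rceil>"

lemma measurable_cell[measurable]: "cell n \<in> measurable borel (count_space UNIV)"
  unfolding cell_def by measurable

lemma cell_bounds:
  assumes "0 < n" "0 < y" "y \<le> 1"
  shows "cell n y \<in> {1..n}" "real n * y \<le> real (cell n y)" "real (cell n y) < real n * y + 1"
proof -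
  have pos: "0 < real n * y" using assms by simp
  then have "0 < \<lceil>real n * y\<rceil>" by simp
  then have eq: "real (cell n y) = of_int \<lceil>real n * y\<rceil>" by (simp add: cell_def)
  have "real n * y \<le> real n" using assms by (simp add: mult_left_le)
  then have "\<lceil>real n * y\<rceil> \<le> int n" by (simp add: ceiling_le_iff)
  then show "cell n y \<in> {1..n}" using \<open>0 < \<lceil>real n * y\<rceil>\<close> unfolding cell_def atLeastAtMost_iff by linarith
  show "real n * y \<le> real (cell n y)" unfolding eq by (rule le_of_int_ceiling)
  show "real (cell n y) < real n * y + 1" unfolding eq using ceiling_correct[of "real n * y"] by linarith
qed

lemma cell_unit: "y \<in> {0..1} \<Longrightarrow> real (cell n y) / real n \<in> {0..1}"
  using cell_bounds(1)[of n y] by (cases "n = 0"; cases "y = 0") (auto simp: cell_def[of _ 0])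

lemma cell_tendsto:
  assumes "0 < y" "y \<le> 1"
  shows "(\<lambda>n. real (cell n y) / real n) \<longlonglongrightarrow> y"
proof (rule tendsto_sandwich[where f = "\<lambda>_. y" and h = "\<lambda>n. y + 1 / real n"])
  show "(\<lambda>n. y + 1 / real n) \<longlonglongrightarrow> y" by real_asymp
  show "\<forall>\<^sub>F n in sequentially. y \<le> real (cell n y) / real n"
    using eventually_gt_at_top[of 0]
  proof eventually_elim
    case (elim n) then show ?case using cell_bounds(2)[OF elim assms] by (simp add: field_simps)
  qed
  show "\<forall>\<^sub>F n in sequentially. real (cell n y) / real n \<le> y + 1 / real n"
    using eventually_gt_at_top[of 0]
  proof eventually_elim
    case (elim n) then show ?case using cell_bounds(3)[OF elim assms] by (simp add: field_simps)
  qed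
qed auto

lemma riemann_sum_cell:
  fixes a :: "nat \<Rightarrow> real"
  assumes "0 < n"
  shows "(\<Sum>k=1..n. a k) / real n = (LINT y:{0..1}|lborel. a (cell n y))"
proof -
  let ?J = "\<lambda>k. {(real k - 1) / real n<..real k / real n}"
  \<comment> \<open>At \<open>y = 0\<close> the left side is \<open>a 0\<close>, while no half-open
    cell contains \<open>y\<close>. The point is discarded as a null set below.\<close>
  have eq: "indicator {0..1} y *\<^sub>R a (cell n y) = (\<Sum>k=1..n. a k * indicator (?J k) y)" if "y \<noteq> 0" for y
  proof -
    have iff: "y \<in> ?J k \<longleftrightarrow> real n * y \<le> real k \<and> real k < real n * y + 1" for k
      using assms by (auto simp: field_simps)
    show ?thesis
    proof (cases "y \<in> {0..1}")
      case True
      with that have y: "0 < y" "y \<le> 1" by auto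
      note cb = cell_bounds[OF assms y]
      have "y \<in> ?J k \<longleftrightarrow> k = cell n y" for k unfolding iff using cb by linarith
      then have "(\<Sum>k=1..n. a k * indicator (?J k) y) = (\<Sum>k=1..n. if k = cell n y then a k else 0)"
        by (intro sum.cong) (auto simp: indicator_def)
      then show ?thesis using cb(1) True by (simp add: sum.delta')
    next
      case False
      have "y \<notin> ?J k" if "k \<in> {1..n}" for k
      proof
        assume "y \<in> ?J k"
        moreover have "(real k - 1) / real n \<ge> 0" "real k / real n \<le> 1" using that assms by auto
        ultimately show False using False by auto
      qed
      then have "(\<Sum>k=1..n. a k * indicator (?J k) y) = 0" by (intro sum.neutral) auto
      then show ?thesis using False by simp
    qed
  qed
  have len: "measure lborel (?J k) = 1 / real n" for k
    using assms by (subst measure_lborel_Ioc) (auto simp: field_simps)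
  have int: "integrable lborel (\<lambda>y. a k * indicator (?J k) y)" for k
    by (intro integrable_mult_right) (auto simp: integrable_indicator_iff emeasure_lborel_Ioc divide_right_mono)
  have "(LINT y:{0..1}|lborel. a (cell n y)) = (LINT y|lborel. (\<Sum>k=1..n. a k * indicator (?J k) y))"
    unfolding set_lebesgue_integral_def
  proof (rule integral_cong_AE)
    have [measurable]: "(\<lambda>y. a (cell n y)) \<in> borel_measurable borel"
      by (rule measurable_compose[OF measurable_cell]) simp
    show "(\<lambda>y. indicator {0..1} y *\<^sub>R a (cell n y)) \<in> borel_measurable lborel"
      "(\<lambda>y. (\<Sum>k=1..n. a k * indicator (?J k) y)) \<in> borel_measurable lborel" by measurable
    show "AE y in lborel. indicator {0..1} y *\<^sub>R a (cell n y) = (\<Sum>k=1..n. a k * indicator (?J k) y)"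
      using AE_lborel_singleton[of "0::real"] by eventually_elim (rule eq)
  qed
  also have "\<dots> = (\<Sum>k=1..n. LINT y|lborel. a k * indicator (?J k) y)"
    by (rule Bochner_Integration.integral_sum) (rule int)
  also have "\<dots> = (\<Sum>k=1..n. a k * (1 / real n))"
    by (intro sum.cong refl) (simp add: len)
  finally show ?thesis by (simp add: sum_divide_distrib)
qed

text \<open>Summing over the position of a leaf at the end of an edge with weight \<open>w\<close> and band width \<open>b\<close>
  turns a test function \<open>f\<close> of the leaf into \<open>band_sum w b n f\<close>, a function of its neighbour.  The
  operator \<open>K\<close> is the limit of this message.\<close>

definition kernel_limit :: "(nat \<Rightarrow> real) \<Rightarrow> (nat \<Rightarrow> nat) \<Rightarrow> ((real \<Rightarrow> real) \<Rightarrow> real \<Rightarrow> real) \<Rightarrow> bool" where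
  "kernel_limit w b K \<longleftrightarrow>
     (\<forall>n. 0 \<le> w n) \<and> w \<longlonglongrightarrow> 0 \<and> Bseq (\<lambda>n. w n * (2 * real (b n) + 1)) \<and>
     (\<forall>f. continuous_on UNIV f \<longrightarrow> continuous_on UNIV (K f) \<and>
       (\<forall>x\<in>{0<..<1}. (\<lambda>n. band_sum (w n) (b n) n f (cell n x)) \<longlonglongrightarrow> K f x))"

lemma continuous_unit_bound:
  fixes f :: "real \<Rightarrow> real"
  assumes "continuous_on UNIV f"
  obtains B where "0 \<le> B" "\<And>y. y \<in> {0..1} \<Longrightarrow> \<bar>f y\<bar> \<le> B"
proof -
  have "compact (f ` {0..1})"
    using assms continuous_on_subset by (intro compact_continuous_image) blast+
  then obtain B where "\<And>y. y \<in> {0..1} \<Longrightarrow> \<bar>f y\<bar> \<le> B"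
    using compact_imp_bounded[THEN bounded_iff[THEN iffD1]] by force
  moreover from this[of 0] have "0 \<le> B" by auto
  ultimately show ?thesis using that by blast
qed

lemma band_sum_bound:
  assumes "0 \<le> w" "\<And>y. y \<in> {0..1} \<Longrightarrow> \<bar>f y\<bar> \<le> B"
  shows "\<bar>band_sum w b n f j\<bar> \<le> w * (2 * real b + 1) * B"
proof -
  have B: "0 \<le> B" using assms(2)[of 0] by auto
  have "\<bar>band_sum w b n f j\<bar> \<le> (\<Sum>k=1..n. \<bar>w * of_bool (\<bar>int j - int k\<bar> \<le> int b) * f (real k / real n)\<bar>)"
    unfolding band_sum_def by (rule sum_abs)
  also have "\<dots> \<le> (\<Sum>k=1..n. w * of_bool (\<bar>int j - int k\<bar> \<le> int b) * B)"
  proof (rule sum_mono)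
    fix k assume "k \<in> {1..n}"
    then have "\<bar>f (real k / real n)\<bar> \<le> B" by (intro assms(2)) auto
    then show "\<bar>w * of_bool (\<bar>int j - int k\<bar> \<le> int b) * f (real k / real n)\<bar>
      \<le> w * of_bool (\<bar>int j - int k\<bar> \<le> int b) * B"
      using assms(1) by (auto simp: abs_mult mult_left_mono)
  qed
  also have "\<dots> = w * (\<Sum>k=1..n. of_bool (\<bar>int j - int k\<bar> \<le> int b)) * B"
    unfolding sum_distrib_left sum_distrib_right ..
  also have "\<dots> \<le> w * (2 * real b + 1) * B"
    using assms(1) B band_count by (intro mult_right_mono mult_left_mono) auto
  finally show ?thesis .
qed

text \<open>Messages are bounded uniformly in \<open>n\<close> by the total band mass, so pointwise
  convergence on the open interval yields convergence of the mean by dominated convergence. Uniform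
  convergence would fail for slow growth: at \<open>j = 1\<close> the band sum of the constant 1
  tends to 1/2 instead of 1.\<close>

lemma kernel_limit_L1:
  assumes "kernel_limit w b K" "continuous_on UNIV f"
  shows "(\<lambda>n. (\<Sum>j=1..n. \<bar>band_sum (w n) (b n) n f j - K f (real j / real n)\<bar>) / real n) \<longlonglongrightarrow> 0"
proof -
  obtain C where C: "\<And>n. w n * (2 * real (b n) + 1) \<le> C"
    using assms(1) unfolding kernel_limit_def Bseq_def real_norm_def abs_le_iff by blast
  have w: "0 \<le> w n" for n using assms(1) by (auto simp: kernel_limit_def)
  have K: "continuous_on UNIV (K f)" using assms by (auto simp: kernel_limit_def)
  obtain B where B: "0 \<le> B" "\<And>y. y \<in> {0..1} \<Longrightarrow> \<bar>f y\<bar> \<le> B"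
    using continuous_unit_bound[OF assms(2)] by blast
  obtain D where D: "0 \<le> D" "\<And>y. y \<in> {0..1} \<Longrightarrow> \<bar>K f y\<bar> \<le> D"
    using continuous_unit_bound[OF K] by blast
  note [measurable] = borel_measurable_continuous_onI[OF K]
  define s where "s n y = \<bar>band_sum (w n) (b n) n f (cell n y) - K f (real (cell n y) / real n)\<bar>" for n y
  have "(\<lambda>n. LINT y:{0..1}|lborel. s n y) \<longlonglongrightarrow> (LINT y:{0..1::real}|lborel. (0::real))"
  proof (rule unit_dominated_convergence)
    have "(\<lambda>y. (\<lambda>k. \<bar>band_sum (w n) (b n) n f k - K f (real k / real n)\<bar>) (cell n y)) \<in> borel_measurable borel" for n
      by (rule measurable_compose[OF measurable_cell]) simp
    then show "s n \<in> borel_measurable borel" for n by (simp add: s_def[abs_def])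
    show "\<bar>s n y\<bar> \<le> C * B + D" if "y \<in> {0..1}" for n y
    proof -
      have "\<bar>band_sum (w n) (b n) n f (cell n y)\<bar> \<le> w n * (2 * real (b n) + 1) * B"
        by (rule band_sum_bound[OF w B(2)])
      also have "\<dots> \<le> C * B" by (rule mult_right_mono[OF C B(1)])
      finally have "\<bar>band_sum (w n) (b n) n f (cell n y)\<bar> \<le> C * B" .
      then show ?thesis using D(2)[OF cell_unit[OF that, of n]] unfolding s_def by linarith
    qed
    have "(\<lambda>n. s n y) \<longlonglongrightarrow> 0" if "y \<noteq> 0" "y \<noteq> 1" "y \<in> {0..1}" for y
    proof -
      have y: "0 < y" "y \<le> 1" "y \<in> {0<..<1}" using that by auto
      have "(\<lambda>n. K f (real (cell n y) / real n)) \<longlonglongrightarrow> K f y"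
        using continuous_on_tendsto_compose[OF K cell_tendsto[OF y(1,2)]] by auto
      moreover have "(\<lambda>n. band_sum (w n) (b n) n f (cell n y)) \<longlonglongrightarrow> K f y"
        using assms y(3) by (auto simp: kernel_limit_def)
      ultimately have "(\<lambda>n. band_sum (w n) (b n) n f (cell n y) - K f (real (cell n y) / real n)) \<longlonglongrightarrow> K f y - K f y"
        by (intro tendsto_diff)
      then show ?thesis unfolding s_def by (intro tendsto_rabs_zero) simp
    qed
    then show "AE y in lborel. y \<in> {0..1} \<longrightarrow> (\<lambda>n. s n y) \<longlonglongrightarrow> 0"
      using AE_lborel_singleton[of "0::real"] AE_lborel_singleton[of "1::real"] by (eventually_elim, blast)
  qed auto
  then have "(\<lambda>n. LINT y:{0..1}|lborel. s n y) \<longlonglongrightarrow> 0" by (simp add: set_lebesgue_integral_def)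
  moreover have "\<forall>\<^sub>F n in sequentially. (LINT y:{0..1}|lborel. s n y)
      = (\<Sum>j=1..n. \<bar>band_sum (w n) (b n) n f j - K f (real j / real n)\<bar>) / real n"
    using eventually_gt_at_top[of 0] by eventually_elim (simp only: riemann_sum_cell s_def)
  ultimately show ?thesis by (rule Lim_transform_eventually)
qed

text \<open>Around an interior point the window of half-width \<open>b n\<close> eventually fits
  into \<open>{1..n}\<close>, its total weight tends to 1, and after rescaling it shrinks to the
  point. Continuity of \<open>f\<close> does the rest.\<close>

lemma slow_growth_kernel:
  assumes "slow_growth b"
  shows "kernel_limit (\<lambda>n. 1 / (2 * real (b n))) b (\<lambda>f. f)"
proof -
  have bt: "filterlim (\<lambda>n. real (b n)) at_top sequentially"
    using assms by (auto simp: slow_growth_def intro: filterlim_compose[OF filterlim_real_sequentially])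
  have bn: "(\<lambda>n. real (b n) / real n) \<longlonglongrightarrow> 0"
    using assms by (auto simp: slow_growth_def dest: smalloD_tendsto)
  have w0: "(\<lambda>n. 1 / (2 * real (b n))) \<longlonglongrightarrow> 0"
    using bt by (intro tendsto_divide_0[OF tendsto_const] filterlim_at_top_imp_at_infinity
        filterlim_tendsto_pos_mult_at_top[OF tendsto_const]) auto
  \<comment> \<open>For \<open>b n = 0\<close> division by zero gives weight 0; otherwise the mass
    is at most 3/2. Hence the uniform bound 2.\<close>
  have wb: "1 / (2 * real (b n)) * (2 * real (b n) + 1) = (if b n = 0 then 0 else 1 + 1 / (2 * real (b n)))" for n
    by (simp add: field_simps)
  have wb32: "1 / (2 * real (b n)) * (2 * real (b n) + 1) \<le> 2" for n unfolding wb by (auto simp: field_simps)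
  have bd: "Bseq (\<lambda>n. 1 / (2 * real (b n)) * (2 * real (b n) + 1))"
    by (rule BseqI'[where K = 2]) (use wb32 in \<open>auto simp del: times_divide_eq_left\<close>)
  have b1: "\<forall>\<^sub>F n in sequentially. 1 \<le> b n"
    using assms by (auto simp: slow_growth_def filterlim_at_top)
  have wlim: "(\<lambda>n. 1 / (2 * real (b n)) * (2 * real (b n) + 1)) \<longlonglongrightarrow> 1"
  proof (rule Lim_transform_eventually)
    show "(\<lambda>n. 1 + 1 / (2 * real (b n))) \<longlonglongrightarrow> 1" using tendsto_add[OF tendsto_const w0, of 1] by simp
    show "\<forall>\<^sub>F n in sequentially. 1 + 1 / (2 * real (b n)) = 1 / (2 * real (b n)) * (2 * real (b n) + 1)"
      using b1 by eventually_elim (auto simp: field_simps)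
  qed
  have "(\<lambda>n. band_sum (1 / (2 * real (b n))) (b n) n f (cell n x)) \<longlonglongrightarrow> f x"
    if f: "continuous_on UNIV f" and x: "x \<in> {0<..<1}" for f :: "real \<Rightarrow> real" and x
  proof -
    have x01: "0 < x" "x \<le> 1" "x < 1" using x by auto
    let ?w = "\<lambda>n. 1 / (2 * real (b n))"
    let ?c = "\<lambda>n. ?w n * (2 * real (b n) + 1)"
    have "(\<lambda>n. band_sum (?w n) (b n) n f (cell n x) - ?c n * f x) \<longlonglongrightarrow> 0"
    proof (rule LIMSEQ_I)
      fix r :: real assume r: "0 < r"
      \<comment> \<open>The tolerance is \<open>r / 3\<close> because the total weight of the window
        is at most 2.\<close>
      have "isCont f x" using f by (simp add: continuous_on_eq_continuous_at)
      then obtain d where d: "0 < d" "\<And>y. \<bar>y - x\<bar> < d \<Longrightarrow> \<bar>f y - f x\<bar> < r / 3"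
        using r unfolding continuous_at_eps_delta dist_real_def by (metis divide_pos_pos zero_less_numeral)
      \<comment> \<open>A window shorter than \<open>e\<close> on each side satisfies the continuity
        estimate and is cut off at neither end of the unit interval.\<close>
      define e where "e = min d (min x (1 - x))"
      have e: "0 < e" using d x by (auto simp: e_def)
      \<comment> \<open>The additional 1 pays for rounding \<open>real n * x\<close> up to
        \<open>cell n x\<close>.\<close>
      have "(\<lambda>n. (real (b n) + 1) / real n) \<longlonglongrightarrow> 0"
      proof -
        have "(\<lambda>n. real (b n) / real n + 1 / real n) \<longlonglongrightarrow> 0 + 0" by (intro tendsto_add bn lim_1_over_n)
        then show ?thesis by (simp add: add_divide_distrib)
      qed
      then have "\<forall>\<^sub>F n in sequentially. (real (b n) + 1) / real n < e" using e by (rule order_tendstoD)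
      then have "\<forall>\<^sub>F n in sequentially. \<bar>band_sum (?w n) (b n) n f (cell n x) - ?c n * f x\<bar> < r"
        using eventually_gt_at_top[of 0] b1
      proof eventually_elim
        case (elim n)
        have cb: "cell n x \<in> {1..n}" "real n * x \<le> real (cell n x)" "real (cell n x) < real n * x + 1"
          using cell_bounds elim x01 by auto
        have small: "real (b n) + 1 < real n * e" using elim by (simp add: field_simps)
        have "real n * e \<le> real n * x" "real n * e \<le> real n * (1 - x)" "real n * e \<le> real n * d"
          by (auto simp: e_def intro!: mult_left_mono)
        moreover have "real n * (1 - x) = real n - real n * x" by (simp add: algebra_simps)
        ultimately have "real (b n + 1) \<le> real (cell n x)" "real (cell n x + b n) \<le> real n"
            and "real (b n) + 1 < real n * d"
          using cb small by linarith+
        then have ranges: "b n + 1 \<le> cell n x" "cell n x + b n \<le> n" "real (b n) + 1 < real n * d"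
          by linarith+
        \<comment> \<open>By \<open>ranges\<close> this subtraction of natural numbers is not
          truncated and the window lies inside \<open>{1..n}\<close>, so it has exactly
          \<open>2 * b n + 1\<close> elements.\<close>
        let ?J = "{cell n x - b n..cell n x + b n}"
        have card: "real (card ?J) = 2 * real (b n) + 1" using ranges(1) by simp
        have "band_sum (?w n) (b n) n f (cell n x) = (\<Sum>k\<in>?J. ?w n * f (real k / real n))"
          unfolding band_sum_def using ranges(1,2)
          by (intro sum.mono_neutral_cong_right) auto
        moreover have "?c n * f x = (\<Sum>k\<in>?J. ?w n * f x)"
          unfolding sum_constant card by simp
        ultimately have "band_sum (?w n) (b n) n f (cell n x) - ?c n * f x
           = (\<Sum>k\<in>?J. ?w n * (f (real k / real n) - f x))"
          by (simp only: sum_subtractf[symmetric] right_diff_distrib)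
        also have "\<bar>\<dots>\<bar> \<le> (\<Sum>k\<in>?J. \<bar>?w n * (f (real k / real n) - f x)\<bar>)" by (rule sum_abs)
        also have "\<dots> \<le> (\<Sum>k\<in>?J. ?w n * (r / 3))"
        proof (rule sum_mono)
          fix k assume "k \<in> ?J"
          then have "\<bar>real k - real (cell n x)\<bar> \<le> real (b n)" by auto
          then have "\<bar>real k - real n * x\<bar> < real n * d" using cb ranges(3) by linarith
          then have "\<bar>real k / real n - x\<bar> < d" using elim(2) by (simp add: abs_less_iff field_simps)
          from d(2)[OF this] show "\<bar>?w n * (f (real k / real n) - f x)\<bar> \<le> ?w n * (r / 3)"
            unfolding abs_mult by (intro mult_mono) auto
        qed
        also have "\<dots> = ?c n * (r / 3)" unfolding sum_constant card by simp
        also have "\<dots> \<le> 2 * (r / 3)" using r wb32 by (intro mult_right_mono) auto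
        finally show ?case using r by simp
      qed
      then show "\<exists>no. \<forall>n\<ge>no. norm (band_sum (?w n) (b n) n f (cell n x) - ?c n * f x - 0) < r"
        by (simp add: eventually_sequentially)
    qed
    from tendsto_add[OF this tendsto_mult[OF wlim tendsto_const[of "f x"]]] show ?thesis by simp
  qed
  then show ?thesis unfolding kernel_limit_def using w0 bd by auto
qed

text \<open>For \<open>c\<close> between 0 and 1 the denominator is the area
  \<open>1 - (1 - c)\<^sup>2\<close> of the band around the diagonal of the unit square, that is,
  the asymptotic fraction of matrix entries inside the band.\<close>

definition prop_kernel :: "real \<Rightarrow> (real \<Rightarrow> real) \<Rightarrow> real \<Rightarrow> real" where
  "prop_kernel c f x = (LINT y:{0..1}|lborel. of_bool (\<bar>x - y\<bar> \<le> c) * f y) / (2 * c - c\<^sup>2)"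

text \<open>For fixed \<open>x\<close> the indicator of the band is discontinuous only at the two
  points \<open>y = x - c\<close> and \<open>y = x + c\<close>. Dominated convergence therefore
  gives both the continuity of the kernel operator and the convergence of the band sums.\<close>

lemma proportional_growth_kernel:
  assumes "proportional_growth b c"
  shows "kernel_limit (\<lambda>n. 1 / ((2 * c - c\<^sup>2) * real n)) b (prop_kernel c)"
proof -
  have c: "0 < c" "c \<le> 1" and bn: "(\<lambda>n. real (b n) / real n) \<longlonglongrightarrow> c"
    using assms by (auto simp: proportional_growth_def)
  have "c * c \<le> 1 * c" using c by (intro mult_right_mono) auto
  then have D: "0 < 2 * c - c\<^sup>2" using c by (simp add: power2_eq_square)
  define E where "E = 2 * c - c\<^sup>2"
  have E: "0 < E" using D by (simp add: E_def)
  have w0: "(\<lambda>n. 1 / (E * real n)) \<longlonglongrightarrow> 0" using E by real_asymp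
  have "(\<lambda>n. 2 * (real (b n) / real n) / E + 1 / (E * real n)) \<longlonglongrightarrow> 2 * c / E + 0"
    using E by (intro tendsto_intros bn w0) auto
  then have "Bseq (\<lambda>n. 2 * (real (b n) / real n) / E + 1 / (E * real n))" by (rule convergent_imp_Bseq[OF convergentI])
  also have "(\<lambda>n. 2 * (real (b n) / real n) / E + 1 / (E * real n)) = (\<lambda>n. 1 / (E * real n) * (2 * real (b n) + 1))"
    by (simp add: fun_eq_iff field_simps add_divide_distrib)
  finally have bd: "Bseq (\<lambda>n. 1 / (E * real n) * (2 * real (b n) + 1))" .
  have AE2: "AE y in lborel. \<bar>x - y\<bar> \<noteq> c" for x :: real
    using AE_lborel_singleton[of "x - c"] AE_lborel_singleton[of "x + c"] by eventually_elim auto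
  have cont: "continuous_on UNIV (prop_kernel c f)" if f: "continuous_on UNIV f" for f
  proof -
    note [measurable] = borel_measurable_continuous_onI[OF f]
    obtain B where B: "0 \<le> B" "\<And>y. y \<in> {0..1} \<Longrightarrow> \<bar>f y\<bar> \<le> B"
      using continuous_unit_bound[OF f] by blast
    show ?thesis unfolding continuous_on_sequentially
    proof (intro allI ballI impI, elim conjE)
      fix u :: "nat \<Rightarrow> real" and x assume u: "u \<longlonglongrightarrow> x"
      have "(\<lambda>n. LINT y:{0..1}|lborel. of_bool (\<bar>u n - y\<bar> \<le> c) * f y)
        \<longlonglongrightarrow> (LINT y:{0..1}|lborel. of_bool (\<bar>x - y\<bar> \<le> c) * f y)"
      proof (rule unit_dominated_convergence)
        show "AE y in lborel. y \<in> {0..1} \<longrightarrow> (\<lambda>n. of_bool (\<bar>u n - y\<bar> \<le> c) * f y) \<longlonglongrightarrow> of_bool (\<bar>x - y\<bar> \<le> c) * f y"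
          using AE2[of x]
          by eventually_elim (intro impI tendsto_intros of_bool_le_tendsto u, auto)
        show "\<bar>of_bool (\<bar>u n - y\<bar> \<le> c) * f y\<bar> \<le> B" if "y \<in> {0..1}" for n y
          using B(2)[OF that] B(1) by auto
      qed auto
      then show "(prop_kernel c f \<circ> u) \<longlonglongrightarrow> prop_kernel c f x"
        unfolding prop_kernel_def comp_def using D by (intro tendsto_divide tendsto_const) auto
    qed
  qed
  have "(\<lambda>n. band_sum (1 / (E * real n)) (b n) n f (cell n x)) \<longlonglongrightarrow> prop_kernel c f x"
    if f: "continuous_on UNIV f" and x: "x \<in> {0<..<1}" for f x
  proof -
    note [measurable] = borel_measurable_continuous_onI[OF f]
    obtain B where B: "0 \<le> B" "\<And>y. y \<in> {0..1} \<Longrightarrow> \<bar>f y\<bar> \<le> B"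
      using continuous_unit_bound[OF f] by blast
    \<comment> \<open>Dividing the integer band condition by \<open>n\<close> makes it a comparison
      of rescaled quantities with limits \<open>x\<close>, \<open>y\<close> and
      \<open>c\<close>.\<close>
    define a where "a n k = of_bool (\<bar>real (cell n x) / real n - real k / real n\<bar> \<le> real (b n) / real n) * f (real k / real n)" for n k
    have "(\<lambda>n. LINT y:{0..1}|lborel. a n (cell n y)) \<longlonglongrightarrow> (LINT y:{0..1}|lborel. of_bool (\<bar>x - y\<bar> \<le> c) * f y)"
    proof (rule unit_dominated_convergence)
      show "(\<lambda>y. a n (cell n y)) \<in> borel_measurable borel" for n
        by (rule measurable_compose[OF measurable_cell]) simp
      show "\<bar>a n (cell n y)\<bar> \<le> B" if "y \<in> {0..1}" for n y
        using B(2)[OF cell_unit[OF that]] B(1) by (auto simp: a_def)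
      have "(\<lambda>n. a n (cell n y)) \<longlonglongrightarrow> of_bool (\<bar>x - y\<bar> \<le> c) * f y"
        if "\<bar>x - y\<bar> \<noteq> c" "y \<noteq> 0" "y \<in> {0..1}" for y
      proof -
        have y: "(\<lambda>n. real (cell n y) / real n) \<longlonglongrightarrow> y" and xx: "(\<lambda>n. real (cell n x) / real n) \<longlonglongrightarrow> x"
          using that x by (auto intro!: cell_tendsto)
        have "(\<lambda>n. f (real (cell n y) / real n)) \<longlonglongrightarrow> f y"
          using continuous_on_tendsto_compose[OF f y] by auto
        then show ?thesis unfolding a_def using that(1)
          by (intro tendsto_mult of_bool_le_tendsto bn tendsto_rabs tendsto_diff xx y)
      qed
      then show "AE y in lborel. y \<in> {0..1} \<longrightarrow> (\<lambda>n. a n (cell n y)) \<longlonglongrightarrow> of_bool (\<bar>x - y\<bar> \<le> c) * f y"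
        using AE2[of x] AE_lborel_singleton[of "0::real"] by (eventually_elim; blast)
    qed auto
    then have "(\<lambda>n. (LINT y:{0..1}|lborel. a n (cell n y)) / E) \<longlonglongrightarrow> prop_kernel c f x"
      unfolding prop_kernel_def E_def[symmetric] using E by (intro tendsto_divide tendsto_const) auto
    moreover have "\<forall>\<^sub>F n in sequentially. (LINT y:{0..1}|lborel. a n (cell n y)) / E
        = band_sum (1 / (E * real n)) (b n) n f (cell n x)"
      using eventually_gt_at_top[of 0]
    proof eventually_elim
      case (elim n)
      have "\<bar>real (cell n x) / real n - real k / real n\<bar> \<le> real (b n) / real n
         \<longleftrightarrow> \<bar>int (cell n x) - int k\<bar> \<le> int (b n)" for k
      proof -
        have "\<bar>real (cell n x) / real n - real k / real n\<bar> = \<bar>real (cell n x) - real k\<bar> / real n"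
          by (simp add: diff_divide_distrib[symmetric])
        then show ?thesis using elim by (simp add: divide_le_cancel) linarith
      qed
      then have "a n k / real n / E = 1 / (E * real n) * of_bool (\<bar>int (cell n x) - int k\<bar> \<le> int (b n)) * f (real k / real n)" for k
        by (simp add: a_def)
      then show ?case
        unfolding band_sum_def by (simp only: riemann_sum_cell[OF elim, of "a n", symmetric] sum_divide_distrib)
    qed
    ultimately show ?thesis by (rule Lim_transform_eventually)
  qed
  then show ?thesis unfolding kernel_limit_def E_def[symmetric] using w0 bd cont E by auto
qed

section \<open>Limits of tree sums\<close>

lemma rtrancl_leaf:
  assumes "grown G V S" "v \<notin> V" "u \<in> V" "{tail G e, head G e} = {u, v}"
    and "(x, y) \<in> (arc_rel G (insert e S \<inter> A))\<^sup>*" "x \<in> V" "y \<in> V"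
  shows "(x, y) \<in> (arc_rel G (S \<inter> A))\<^sup>*"
proof -
  \<comment> \<open>retract the leaf onto its neighbour\<close>
  define \<pi> where "\<pi> z = (if z = v then u else z)" for z
  have inV: "a \<in> V \<and> b \<in> V" if "(a, b) \<in> arc_rel G (S \<inter> A)" for a b
    using that grown_ends[OF assms(1)] by (auto simp: arc_rel_def)
  have "(\<pi> x, \<pi> y) \<in> (arc_rel G (S \<inter> A))\<^sup>*"
    using assms(5)
  proof induction
    case (step y z)
    then have "(y, z) \<in> arc_rel G (S \<inter> A) \<or> {y, z} = {u, v}"
      using assms(4) by (auto simp: arc_rel_def)
    then show ?case
    proof
      assume yz: "(y, z) \<in> arc_rel G (S \<inter> A)"
      then have "\<pi> y = y" "\<pi> z = z" using inV[OF yz] assms(2) by (auto simp: \<pi>_def)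
      then show ?thesis using yz step.IH by (metis rtrancl.rtrancl_into_rtrancl)
    next
      assume "{y, z} = {u, v}"
      then have "\<pi> y = \<pi> z" by (auto simp: \<pi>_def doubleton_eq_iff)
      then show ?thesis using step.IH by simp
    qed
  qed auto
  then show ?thesis using assms(2,6,7) by (auto simp: \<pi>_def split: if_splits)
qed

lemma rtrancl_leaf_isolated:
  assumes "grown G V S" "v \<notin> V" "x \<in> V"
  shows "(v, x) \<notin> (arc_rel G (S \<inter> A))\<^sup>*"
proof
  assume "(v, x) \<in> (arc_rel G (S \<inter> A))\<^sup>*"
  then obtain y where "(v, y) \<in> arc_rel G (S \<inter> A)"
    using assms(2,3) by (cases rule: converse_rtranclE) auto
  then show False using grown_ends[OF assms(1)] assms(2) by (auto simp: arc_rel_def)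
qed

text \<open>A leaf hangs on a single arc, so it cannot join two older classes. It either falls into
  the class of its neighbour or forms a class of its own, and these are the two cases of the
  integral recursion.\<close>

lemma class_map_leaf:
  assumes G: "grown G V S" "u \<in> V" "v \<notin> V" "{tail G e, head G e} = {u, v}"
    and \<kappa>: "\<forall>x\<in>insert v V. \<forall>y\<in>insert v V. \<kappa> x = \<kappa> y \<longleftrightarrow> (x, y) \<in> (arc_rel G (insert e S \<inter> L))\<^sup>*"
  shows "\<forall>x\<in>V. \<forall>y\<in>V. \<kappa> x = \<kappa> y \<longleftrightarrow> (x, y) \<in> (arc_rel G (S \<inter> L))\<^sup>*"
    and "e \<in> L \<Longrightarrow> \<kappa> v = \<kappa> u" and "e \<notin> L \<Longrightarrow> \<kappa> v \<notin> \<kappa> ` V"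
proof -
  have "(x, y) \<in> (arc_rel G (insert e S \<inter> L))\<^sup>* \<longleftrightarrow> (x, y) \<in> (arc_rel G (S \<inter> L))\<^sup>*"
    if "x \<in> V" "y \<in> V" for x y
  proof
    assume "(x, y) \<in> (arc_rel G (insert e S \<inter> L))\<^sup>*"
    from rtrancl_leaf[OF G(1,3,2,4) this that] show "(x, y) \<in> (arc_rel G (S \<inter> L))\<^sup>*" .
  next
    assume "(x, y) \<in> (arc_rel G (S \<inter> L))\<^sup>*"
    moreover have "arc_rel G (S \<inter> L) \<subseteq> arc_rel G (insert e S \<inter> L)" by (auto simp: arc_rel_def)
    ultimately show "(x, y) \<in> (arc_rel G (insert e S \<inter> L))\<^sup>*" using rtrancl_mono by blast
  qed
  then show "\<forall>x\<in>V. \<forall>y\<in>V. \<kappa> x = \<kappa> y \<longleftrightarrow> (x, y) \<in> (arc_rel G (S \<inter> L))\<^sup>*"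
    using \<kappa> by auto
  show "\<kappa> v = \<kappa> u" if "e \<in> L"
  proof -
    have "(v, u) \<in> (arc_rel G (insert e S \<inter> L))\<^sup>*"
      using that G(4) by (auto simp: arc_rel_def doubleton_eq_iff)
    then show ?thesis using \<kappa> G(2) by auto
  qed
  show "\<kappa> v \<notin> \<kappa> ` V" if "e \<notin> L"
  proof
    assume "\<kappa> v \<in> \<kappa> ` V"
    then obtain x where x: "x \<in> V" "\<kappa> v = \<kappa> x" by auto
    then have "(v, x) \<in> (arc_rel G (S \<inter> L))\<^sup>*" using \<kappa> that by auto
    then show False using rtrancl_leaf_isolated[OF G(1,3) x(1)] by blast
  qed
qed

text \<open>Contracting edges of a tree creates no parallel edges: an arc outside \<open>L\<close>
  that attaches a leaf has an end whose class was not present before, so no older arc can share its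
  classes of ends.\<close>

lemma class_map_ends_inj:
  assumes "grown G V S"
    and "\<forall>x\<in>V. \<forall>y\<in>V. \<kappa> x = \<kappa> y \<longleftrightarrow> (x, y) \<in> (arc_rel G (S \<inter> L))\<^sup>*"
    and "d \<in> S - L" "d' \<in> S - L"
    and "{\<kappa> (tail G d), \<kappa> (head G d)} = {\<kappa> (tail G d'), \<kappa> (head G d')}"
  shows "d = d'"
  using assms
proof (induction)
  case (leaf V S u v e)
  note G = leaf.hyps
  note cm = class_map_leaf[OF G leaf.prems(1)]
  have old: "{\<kappa> (tail G d), \<kappa> (head G d)} \<subseteq> \<kappa> ` V" if "d \<in> S" for d
    using grown_ends[OF G(1) that] by auto
  have new: "\<kappa> v \<in> {\<kappa> (tail G e), \<kappa> (head G e)}"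
    using G(4) by (auto simp: doubleton_eq_iff)
  show ?case
  proof (cases "e \<in> L")
    case True
    then show ?thesis using leaf.IH[OF cm(1)] leaf.prems by auto
  next
    case False
    have "e = d \<longleftrightarrow> e = d'" using leaf.prems(2-4) old[of d] old[of d'] new cm(3)[OF False] by (metis DiffD1 insertE subsetD)
    then show ?thesis using leaf.IH[OF cm(1)] leaf.prems by auto
  qed
qed auto

section \<open>Integrals over the unit cube\<close>

lemma cube_measure:
  assumes "finite K"
  shows "(\<Pi>\<^sub>E k\<in>K. {0..1::real}) \<in> sets (\<Pi>\<^sub>M k\<in>K. lborel)"
    and "emeasure (\<Pi>\<^sub>M k\<in>K. lborel) (\<Pi>\<^sub>E k\<in>K. {0..1::real}) = 1"
proof -
  interpret product_sigma_finite "\<lambda>_. lborel :: real measure" by standard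
  show "(\<Pi>\<^sub>E k\<in>K. {0..1::real}) \<in> sets (\<Pi>\<^sub>M k\<in>K. lborel)" using assms by (intro sets_PiM_I_finite) auto
  show "emeasure (\<Pi>\<^sub>M k\<in>K. lborel) (\<Pi>\<^sub>E k\<in>K. {0..1::real}) = 1"
    using assms by (subst emeasure_PiM) auto
qed

text \<open>The cube enters as a product of indicators in the integrand, so that each coordinate
  carries its own factor and can be integrated out separately.\<close>

lemma cube_integrable:
  fixes g :: "('k \<Rightarrow> real) \<Rightarrow> real"
  assumes "finite K" and [measurable]: "g \<in> borel_measurable (\<Pi>\<^sub>M k\<in>K. lborel)"
    and "\<And>x. (\<And>k. k \<in> K \<Longrightarrow> x k \<in> {0..1}) \<Longrightarrow> \<bar>g x\<bar> \<le> B"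
  shows "integrable (\<Pi>\<^sub>M k\<in>K. lborel) (\<lambda>x. (\<Prod>k\<in>K. indicator {0..1} (x k)) * g x)"
proof (rule integrableI_bounded_set[where A = "\<Pi>\<^sub>E k\<in>K. {0..1}" and B = B])
  show "AE x in (\<Pi>\<^sub>M k\<in>K. lborel). x \<in> (\<Pi>\<^sub>E k\<in>K. {0..1}) \<longrightarrow> norm ((\<Prod>k\<in>K. indicator {0..1} (x k)) * g x) \<le> B"
    using assms(3) by (intro AE_I2) (auto simp: PiE_def Pi_def)
  show "AE x in (\<Pi>\<^sub>M k\<in>K. lborel). x \<notin> (\<Pi>\<^sub>E k\<in>K. {0..1}) \<longrightarrow> (\<Prod>k\<in>K. indicator {0..1} (x k)) * g x = 0"
  proof (intro AE_I2 impI)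
    fix x assume "x \<in> space (\<Pi>\<^sub>M k\<in>K. lborel :: real measure)" "x \<notin> (\<Pi>\<^sub>E k\<in>K. {0..1})"
    then obtain k where "k \<in> K" "x k \<notin> {0..1}" by (auto simp: space_PiM PiE_def Pi_def)
    then have "(\<Prod>k\<in>K. indicator {0..1} (x k) :: real) = 0" using assms(1)
      by (intro prod_zero bexI[of _ k]) auto
    then show "(\<Prod>k\<in>K. indicator {0..1} (x k)) * g x = 0" by simp
  qed
qed (use cube_measure[OF assms(1)] in \<open>auto simp: assms(1)\<close>)

text \<open>The map \<open>\<kappa>\<close> encodes a contraction of \<open>G\<close>: the vertices of the contracted graph are the
  values of \<open>\<kappa>\<close>.\<close>

definition cube_integral ::
  "('v, 'e) pre_digraph \<Rightarrow> ('v \<Rightarrow> 'k) \<Rightarrow> ('e \<Rightarrow> real) \<Rightarrow> 'e set \<Rightarrow> 'v set \<Rightarrow> ('v \<Rightarrow> real \<Rightarrow> real) \<Rightarrow> real" where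
  "cube_integral G \<kappa> c A V f = (LINT x|(\<Pi>\<^sub>M k\<in>\<kappa> ` V. lborel). (\<Prod>k\<in>\<kappa> ` V. indicator {0..1} (x k)) *
     ((\<Prod>e\<in>A. of_bool (\<bar>x (\<kappa> (tail G e)) - x (\<kappa> (head G e))\<bar> \<le> c e) / (2 * c e - (c e)\<^sup>2))
      * (\<Prod>v\<in>V. f v (x (\<kappa> v)))))"

text \<open>No coordinate is added, and the two test functions are evaluated at the same one. This
  matches the identity as limiting kernel of a slowly growing band.\<close>

lemma cube_integral_merge:
  assumes "finite V" "u \<in> V" "v \<notin> V" "\<kappa> v = \<kappa> u"
  shows "cube_integral G \<kappa> c A (insert v V) f = cube_integral G \<kappa> c A V (f(u := \<lambda>y. f u y * f v y))"
proof -
  have "insert (\<kappa> v) (\<kappa> ` V) = \<kappa> ` V" using assms by auto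
  moreover have "(\<Prod>z\<in>insert v V. f z (x (\<kappa> z))) = (\<Prod>z\<in>V. (f(u := \<lambda>y. f u y * f v y)) z (x (\<kappa> z)))" for x
    unfolding prod_fun_upd_mult[OF assms(1,2), of f "f v" "\<lambda>z. x (\<kappa> z)"] using assms by simp
  ultimately show ?thesis unfolding cube_integral_def image_insert by simp
qed

text \<open>The coordinate \<open>\<kappa> v\<close> occurs only in its cube indicator, in the
  factor of \<open>e\<close> and in the test function of \<open>v\<close>. Integrating it out by
  Fubini leaves the kernel, evaluated at the coordinate of the neighbour.\<close>

lemma cube_integral_leaf:
  assumes G: "grown G V S" "u \<in> V" "v \<notin> V" "{tail G e, head G e} = {u, v}"
    and A: "A \<subseteq> S" and \<kappa>: "\<kappa> v \<notin> \<kappa> ` V"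
    and f: "\<And>z. z \<in> insert v V \<Longrightarrow> continuous_on UNIV (f z)"
  shows "cube_integral G \<kappa> c (insert e A) (insert v V) f
    = cube_integral G \<kappa> c A V (f(u := \<lambda>y. f u y * prop_kernel (c e) (f v) y))"
proof -
  interpret product_sigma_finite "\<lambda>_. lborel :: real measure" by standard
  let ?K = "\<kappa> ` V"
  let ?D = "\<lambda>e. 2 * c e - (c e)\<^sup>2"
  let ?i = "\<lambda>x e. of_bool (\<bar>x (\<kappa> (tail G e)) - x (\<kappa> (head G e))\<bar> \<le> c e) / ?D e :: real"
  have finV: "finite V" and fin: "finite ?K" using grown_finite[OF G(1)] by auto
  have finA: "finite A" and eA: "e \<notin> A"
    using A grown_finite[OF G(1)] grown_leaf_notin[OF G(1,3,4)] finite_subset by auto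
  have [measurable]: "f z \<in> borel_measurable borel" if "z \<in> insert v V" for z
    using f[OF that] by (rule borel_measurable_continuous_onI)
  define g where "g x = (\<Prod>d\<in>insert e A. ?i x d) * (\<Prod>z\<in>insert v V. f z (x (\<kappa> z)))" for x
  have ends: "tail G d \<in> insert v V \<and> head G d \<in> insert v V" if "d \<in> insert e A" for d
    using that A grown_ends[OF G(1)] G by (cases "d = e") (auto simp: doubleton_eq_iff)
  have gm: "g \<in> borel_measurable (\<Pi>\<^sub>M k\<in>insert (\<kappa> v) ?K. lborel)"
  proof -
    have comp: "(\<lambda>x. x (\<kappa> z)) \<in> borel_measurable (\<Pi>\<^sub>M k\<in>insert (\<kappa> v) ?K. lborel)" if "z \<in> insert v V" for z
      using that measurable_component_singleton[of "\<kappa> z" "insert (\<kappa> v) ?K" "\<lambda>_. lborel :: real measure"] by auto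
    have [measurable]: "(\<lambda>x. ?i x d) \<in> borel_measurable (\<Pi>\<^sub>M k\<in>insert (\<kappa> v) ?K. lborel)" if "d \<in> insert e A" for d
    proof -
      have "(\<lambda>x. x (\<kappa> (tail G d)) - x (\<kappa> (head G d))) \<in> borel_measurable (\<Pi>\<^sub>M k\<in>insert (\<kappa> v) ?K. lborel)"
        by (rule borel_measurable_diff[OF comp comp]) (use ends[OF that] in auto)
      then show ?thesis by measurable
    qed
    have [measurable]: "(\<lambda>x. f z (x (\<kappa> z))) \<in> borel_measurable (\<Pi>\<^sub>M k\<in>insert (\<kappa> v) ?K. lborel)" if "z \<in> insert v V" for z
      using measurable_compose[OF comp[OF that], of "f z" borel] that f borel_measurable_continuous_onI by auto
    show ?thesis unfolding g_def by (intro borel_measurable_times borel_measurable_prod) auto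
  qed
  have "\<exists>B. \<forall>z\<in>insert v V. 0 \<le> B z \<and> (\<forall>y\<in>{0..1}. \<bar>f z y\<bar> \<le> B z)"
    by (intro bchoice ballI) (meson continuous_unit_bound f)
  then obtain B where B: "\<And>z. z \<in> insert v V \<Longrightarrow> 0 \<le> B z"
    "\<And>z y. z \<in> insert v V \<Longrightarrow> y \<in> {0..1} \<Longrightarrow> \<bar>f z y\<bar> \<le> B z" by metis
  have gB: "\<bar>g x\<bar> \<le> (\<Prod>d\<in>insert e A. 1 / \<bar>?D d\<bar>) * (\<Prod>z\<in>insert v V. B z)"
    if "\<And>k. k \<in> insert (\<kappa> v) ?K \<Longrightarrow> x k \<in> {0..1}" for x
    unfolding g_def abs_mult abs_prod
    using B that by (intro mult_mono prod_mono conjI prod_nonneg) (auto simp: abs_divide divide_right_mono)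
  have inner: "(LINT y|lborel. (\<Prod>k\<in>insert (\<kappa> v) ?K. indicator {0..1} ((x(\<kappa> v := y)) k)) * g (x(\<kappa> v := y)))
     = (\<Prod>k\<in>?K. indicator {0..1} (x k)) * ((\<Prod>d\<in>A. ?i x d) * ((\<Prod>z\<in>V. f z (x (\<kappa> z))) * prop_kernel (c e) (f v) (x (\<kappa> u))))" for x
  proof -
    have 1: "(\<Prod>k\<in>insert (\<kappa> v) ?K. indicator {0..1} ((x(\<kappa> v := y)) k) :: real) = indicator {0..1} y * (\<Prod>k\<in>?K. indicator {0..1} (x k))" for y
    proof -
      have "(\<Prod>k\<in>?K. indicator {0..1} ((x(\<kappa> v := y)) k) :: real) = (\<Prod>k\<in>?K. indicator {0..1} (x k))"
        using \<kappa> by (intro prod.cong refl) (metis fun_upd_apply)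
      then show ?thesis using fin \<kappa> by simp
    qed
    have 2: "(\<Prod>d\<in>insert e A. ?i (x(\<kappa> v := y)) d) = of_bool (\<bar>x (\<kappa> u) - y\<bar> \<le> c e) / ?D e * (\<Prod>d\<in>A. ?i x d)" for y
    proof -
      have "(\<Prod>d\<in>A. ?i (x(\<kappa> v := y)) d) = (\<Prod>d\<in>A. ?i x d)"
      proof (rule prod.cong)
        fix d assume "d \<in> A"
        then have "tail G d \<in> V" "head G d \<in> V" using A grown_ends[OF G(1)] by auto
        then have "\<kappa> (tail G d) \<noteq> \<kappa> v" "\<kappa> (head G d) \<noteq> \<kappa> v" using \<kappa> by (metis imageI)+
        then show "?i (x(\<kappa> v := y)) d = ?i x d" by simp
      qed simp
      moreover have "?i (x(\<kappa> v := y)) e = of_bool (\<bar>x (\<kappa> u) - y\<bar> \<le> c e) / ?D e"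
      proof -
        have "\<kappa> u \<noteq> \<kappa> v" using \<kappa> G(2) by (metis imageI)
        then show ?thesis using G(4) by (auto simp: doubleton_eq_iff abs_minus_commute)
      qed
      ultimately show ?thesis unfolding prod.insert[OF finA eA] by (simp only:)
    qed
    have 3: "(\<Prod>z\<in>insert v V. f z ((x(\<kappa> v := y)) (\<kappa> z))) = f v y * (\<Prod>z\<in>V. f z (x (\<kappa> z)))" for y
    proof -
      have "(\<Prod>z\<in>V. f z ((x(\<kappa> v := y)) (\<kappa> z))) = (\<Prod>z\<in>V. f z (x (\<kappa> z)))"
        using \<kappa> by (intro prod.cong refl) (metis fun_upd_apply imageI)
      then show ?thesis using finV G(3) by simp
    qed
    define P where "P = (\<Prod>k\<in>?K. indicator {0..1} (x k)) * ((\<Prod>d\<in>A. ?i x d) * (\<Prod>z\<in>V. f z (x (\<kappa> z)))) / ?D e"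
    have "(\<Prod>k\<in>insert (\<kappa> v) ?K. indicator {0..1} ((x(\<kappa> v := y)) k)) * g (x(\<kappa> v := y))
      = P * (indicator {0..1} y *\<^sub>R (of_bool (\<bar>x (\<kappa> u) - y\<bar> \<le> c e) * f v y))" for y
      unfolding g_def 1 2 3 P_def by simp
    then show ?thesis
      unfolding prop_kernel_def set_lebesgue_integral_def by (simp add: P_def)
  qed
  have "cube_integral G \<kappa> c (insert e A) (insert v V) f
     = (LINT x|(\<Pi>\<^sub>M k\<in>insert (\<kappa> v) ?K. lborel). (\<Prod>k\<in>insert (\<kappa> v) ?K. indicator {0..1} (x k)) * g x)"
    unfolding cube_integral_def g_def image_insert ..
  also have "\<dots> = (LINT x|(\<Pi>\<^sub>M k\<in>?K. lborel). LINT y|lborel. (\<Prod>k\<in>insert (\<kappa> v) ?K. indicator {0..1} ((x(\<kappa> v := y)) k)) * g (x(\<kappa> v := y)))"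
    by (rule product_integral_insert[OF fin \<kappa> cube_integrable[OF _ gm gB]]) (use fin in auto)
  also have "\<dots> = cube_integral G \<kappa> c A V (f(u := \<lambda>y. f u y * prop_kernel (c e) (f v) y))"
    unfolding inner cube_integral_def prod_fun_upd_mult[OF finV G(2), of f "prop_kernel (c e) (f v)" "\<lambda>z. x (\<kappa> z)" for x] ..
  finally show ?thesis .
qed

lemma injections_singleton_sum:
  "(\<Sum>\<phi>\<in>injections {v} n. F (\<phi> v)) = (\<Sum>k=1..n. F k :: real)"
proof -
  have "injections {v} n = {v} \<rightarrow>\<^sub>E {1..n}" by (auto simp: injections_def)
  then show ?thesis by (simp add: sum_PiE_insert)
qed

text \<open>The discrete average and the integral obey the same leaf recursion, the former up to a
  vanishing error. The induction runs over all families of continuous test functions, since the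
  hypothesis is applied to the family in which the neighbour has absorbed the message of the
  leaf.\<close>

theorem band_avg_tendsto:
  fixes w :: "'e \<Rightarrow> nat \<Rightarrow> real" and b :: "'e \<Rightarrow> nat \<Rightarrow> nat"
  assumes "grown G V S"
    and "\<And>e. e \<in> S \<Longrightarrow> kernel_limit (w e) (b e) (if e \<in> L then (\<lambda>f. f) else prop_kernel (c e))"
    and "\<forall>x\<in>V. \<forall>y\<in>V. \<kappa> x = \<kappa> y \<longleftrightarrow> (x, y) \<in> (arc_rel G (S \<inter> L))\<^sup>*"
    and "\<And>v. v \<in> V \<Longrightarrow> continuous_on UNIV (f v)"
  shows "(\<lambda>n. band_avg G (\<lambda>e. w e n) (\<lambda>e. b e n) n V S f) \<longlonglongrightarrow> cube_integral G \<kappa> c (S - L) V f"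
  using assms
proof (induction arbitrary: f)
  case (root v)
  interpret product_sigma_finite "\<lambda>_. lborel :: real measure" by standard
  have f: "continuous_on UNIV (f v)" using root by auto
  note [measurable] = borel_measurable_continuous_onI[OF f]
  obtain B where B: "0 \<le> B" "\<And>y. y \<in> {0..1} \<Longrightarrow> \<bar>f v y\<bar> \<le> B"
    using continuous_unit_bound[OF f] by blast
  have "(\<lambda>n. LINT y:{0..1}|lborel. f v (real (cell n y) / real n)) \<longlonglongrightarrow> (LINT y:{0..1}|lborel. f v y)"
  proof (rule unit_dominated_convergence)
    show "(\<lambda>y. f v (real (cell n y) / real n)) \<in> borel_measurable borel" for n by measurable
    show "\<bar>f v (real (cell n y) / real n)\<bar> \<le> B" if "y \<in> {0..1}" for n y using B(2)[OF cell_unit[OF that]] .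
    have "(\<lambda>n. f v (real (cell n y) / real n)) \<longlonglongrightarrow> f v y" if "y \<noteq> 0" "y \<in> {0..1}" for y
      using continuous_on_tendsto_compose[OF f cell_tendsto[of y]] that by auto
    then show "AE y in lborel. y \<in> {0..1} \<longrightarrow> (\<lambda>n. f v (real (cell n y) / real n)) \<longlonglongrightarrow> f v y"
      using AE_lborel_singleton[of "0::real"] by (eventually_elim, blast)
  qed auto
  moreover have "\<forall>\<^sub>F n in sequentially. (LINT y:{0..1}|lborel. f v (real (cell n y) / real n))
     = band_avg G (\<lambda>e. w e n) (\<lambda>e. b e n) n {v} {} f"
    using eventually_gt_at_top[of 0]
  proof eventually_elim
    case (elim n)
    have "band_avg G (\<lambda>e. w e n) (\<lambda>e. b e n) n {v} {} f = (\<Sum>k=1..n. f v (real k / real n)) / real n"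
      using injections_singleton_sum[of "\<lambda>k. f v (real k / real n)" v n]
      by (simp add: band_avg_def band_weight_def)
    also have "\<dots> = (LINT y:{0..1}|lborel. f v (real (cell n y) / real n))"
      by (rule riemann_sum_cell[OF elim])
    finally show ?case ..
  qed
  ultimately have "(\<lambda>n. band_avg G (\<lambda>e. w e n) (\<lambda>e. b e n) n {v} {} f) \<longlonglongrightarrow> (LINT y:{0..1}|lborel. f v y)"
    by (rule Lim_transform_eventually)
  moreover have "cube_integral G \<kappa> c ({} - L) {v} f = (LINT y:{0..1}|lborel. f v y)"
    using product_integral_singleton[of "\<lambda>y. indicator {0..1} y * f v y" "\<kappa> v"]
    by (simp add: cube_integral_def set_lebesgue_integral_def)
  ultimately show ?case by simp
next
  case (leaf V S u v e)
  note G = leaf.hyps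
  let ?K = "if e \<in> L then (\<lambda>f. f) else prop_kernel (c e)"
  let ?f = "f(u := \<lambda>y. f u y * ?K (f v) y)"
  have finV: "finite V" "finite S" and eS: "e \<notin> S" using grown_finite[OF G(1)] grown_leaf_notin[OF G(1,3,4)] by auto
  have kl: "kernel_limit (w d) (b d) (if d \<in> L then (\<lambda>f. f) else prop_kernel (c d))" if "d \<in> insert e S" for d
    using that by (rule leaf.prems(1))
  have kle: "kernel_limit (w e) (b e) ?K" using kl by auto
  have w: "0 \<le> w d n" if "d \<in> insert e S" for d n using kl[OF that] by (auto simp: kernel_limit_def)
  have cont: "continuous_on UNIV (?K (f v))" using kle leaf.prems(3)[of v] unfolding kernel_limit_def by blast
  have cf: "continuous_on UNIV (?f z)" if "z \<in> V" for z
    using leaf.prems(3) that G(2) cont by (auto intro!: continuous_on_mult)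
  note cm = class_map_leaf[OF G leaf.prems(2)]
  have IH: "(\<lambda>n. band_avg G (\<lambda>e. w e n) (\<lambda>e. b e n) n V S ?f) \<longlonglongrightarrow> cube_integral G \<kappa> c (S - L) V ?f"
    by (rule leaf.IH) (use kl cm(1) cf in auto)
  \<comment> \<open>The integral side of the recursion: merging if the arc is contracted,
    integrating out a coordinate otherwise.\<close>
  have Q: "cube_integral G \<kappa> c (insert e S - L) (insert v V) f = cube_integral G \<kappa> c (S - L) V ?f"
  proof (cases "e \<in> L")
    case True
    from cube_integral_merge[OF finV(1) G(2,3) cm(2)[OF True], of G c "S - L" f]
    show ?thesis using True by simp
  next
    case False
    from cube_integral_leaf[OF G _ cm(3)[OF False], of "S - L" f c] leaf.prems(3)
    show ?thesis using False by (simp add: insert_Diff_if)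
  qed
  have "\<exists>B. \<forall>z\<in>insert v V. 0 \<le> B z \<and> (\<forall>y\<in>{0..1}. \<bar>f z y\<bar> \<le> B z)"
    by (intro bchoice ballI) (meson continuous_unit_bound leaf.prems(3))
  then obtain B where B: "\<And>z. z \<in> insert v V \<Longrightarrow> 0 \<le> B z"
    "\<And>z y. z \<in> insert v V \<Longrightarrow> y \<in> {0..1} \<Longrightarrow> \<bar>f z y\<bar> \<le> B z" by metis
  have "\<exists>C. \<forall>d\<in>S. \<forall>n. w d n * (2 * real (b d n) + 1) \<le> C d"
    by (intro bchoice ballI) (use kl in \<open>auto simp: kernel_limit_def Bseq_def abs_le_iff; meson\<close>)
  then obtain C where C: "\<And>d n. d \<in> S \<Longrightarrow> w d n * (2 * real (b d n) + 1) \<le> C d" by metis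
  \<comment> \<open>The error of \<open>band_avg_leaf_diff\<close> apart from bounded factors. Its
    first part vanishes by \<open>kernel_limit_L1\<close>, its second because the weights tend to
    0.\<close>
  define Z where "Z n = (\<Sum>j=1..n. \<bar>band_sum (w e n) (b e n) n (f v) j - ?K (f v) (real j / real n)\<bar>) / real n
      + real (card V) * w e n * B v" for n
  have Z0: "0 \<le> Z n" for n unfolding Z_def using w[of e n] B(1)[of v]
    by (intro add_nonneg_nonneg divide_nonneg_nonneg sum_nonneg mult_nonneg_nonneg) auto
  have "(\<lambda>n. (\<Sum>j=1..n. \<bar>band_sum (w e n) (b e n) n (f v) j - ?K (f v) (real j / real n)\<bar>) / real n) \<longlonglongrightarrow> 0"
    by (rule kernel_limit_L1[OF kle]) (use leaf.prems(3) in auto)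
  moreover have "(\<lambda>n. real (card V) * w e n * B v) \<longlonglongrightarrow> real (card V) * 0 * B v"
    using kle by (intro tendsto_intros) (auto simp: kernel_limit_def)
  ultimately have "Z \<longlonglongrightarrow> 0 + real (card V) * 0 * B v" unfolding Z_def[abs_def] by (rule tendsto_add)
  then have ZC: "(\<lambda>n. (\<Prod>v\<in>V. B v) * (\<Prod>e\<in>S. C e) * Z n) \<longlonglongrightarrow> 0"
    by (intro tendsto_mult_right_zero) simp
  have "(\<lambda>n. band_avg G (\<lambda>e. w e n) (\<lambda>e. b e n) n (insert v V) (insert e S) f
      - band_avg G (\<lambda>e. w e n) (\<lambda>e. b e n) n V S ?f) \<longlonglongrightarrow> 0"
  proof (rule Lim_null_comparison[OF _ ZC])
    show "\<forall>\<^sub>F n in sequentially. norm (band_avg G (\<lambda>e. w e n) (\<lambda>e. b e n) n (insert v V) (insert e S) f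
      - band_avg G (\<lambda>e. w e n) (\<lambda>e. b e n) n V S ?f) \<le> (\<Prod>v\<in>V. B v) * (\<Prod>e\<in>S. C e) * Z n"
      using eventually_gt_at_top[of 0]
    proof eventually_elim
      case (elim n)
      have "norm (band_avg G (\<lambda>e. w e n) (\<lambda>e. b e n) n (insert v V) (insert e S) f - band_avg G (\<lambda>e. w e n) (\<lambda>e. b e n) n V S ?f)
        \<le> (\<Prod>v\<in>V. B v) * (\<Prod>e\<in>S. w e n * (2 * real (b e n) + 1)) * Z n"
        unfolding Z_def real_norm_def
        by (rule band_avg_leaf_diff[OF G _ _ elim B(2)]) (use w in auto)
      also have "\<dots> \<le> (\<Prod>v\<in>V. B v) * (\<Prod>e\<in>S. C e) * Z n"
        using C w B(1) Z0 by (intro mult_right_mono mult_left_mono prod_mono prod_nonneg) auto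
      finally show ?case .
    qed
  qed
  from tendsto_add[OF this IH] show ?case unfolding Q by simp
qed

section \<open>The integral of the reduced forest\<close>

text \<open>The factors of different blocks share no coordinates, so Fubini splits off one block at
  a time.\<close>

lemma cube_prod_disjoint:
  fixes s t :: "'p \<Rightarrow> 'k" and c :: "'p \<Rightarrow> real" and E :: "'k set \<Rightarrow> 'p set"
  assumes "finite CC" "\<And>C. C \<in> CC \<Longrightarrow> finite C" "pairwise disjnt CC"
    and E: "\<And>C e. C \<in> CC \<Longrightarrow> e \<in> E C \<Longrightarrow> s e \<in> C \<and> t e \<in> C"
  shows "(LINT x|(\<Pi>\<^sub>M k\<in>\<Union>CC. lborel). (\<Prod>k\<in>\<Union>CC. indicator {0..1} (x k)) * (\<Prod>C\<in>CC. \<Prod>e\<in>E C. of_bool (\<bar>x (s e) - x (t e)\<bar> \<le> c e) :: real))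
    = (\<Prod>C\<in>CC. LINT x|(\<Pi>\<^sub>M k\<in>C. lborel). (\<Prod>k\<in>C. indicator {0..1} (x k)) * (\<Prod>e\<in>E C. of_bool (\<bar>x (s e) - x (t e)\<bar> \<le> c e)))"
  using assms
proof (induction CC)
  case empty
  interpret product_sigma_finite "\<lambda>_. lborel :: real measure" by standard
  show ?case by (simp add: PiM_empty lebesgue_integral_count_space_finite)
next
  case (insert C CC)
  interpret product_sigma_finite "\<lambda>_. lborel :: real measure" by standard
  let ?U = "\<Union>CC"
  let ?b = "\<lambda>x e. of_bool (\<bar>x (s e) - x (t e)\<bar> \<le> c e) :: real"
  have disj: "C \<inter> ?U = {}" using insert.prems(2) insert.hyps(2) by (auto simp: pairwise_insert disjnt_def)
  have finC: "finite C" and finU: "finite ?U" using insert.prems(1) insert.hyps(1) by auto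
  have E: "\<And>e. e \<in> E C \<Longrightarrow> s e \<in> C \<and> t e \<in> C" "\<And>D e. D \<in> CC \<Longrightarrow> e \<in> E D \<Longrightarrow> s e \<in> ?U \<and> t e \<in> ?U"
    using insert.prems(3) by blast+
  define g where "g x = (\<Prod>e\<in>E C. ?b x e) * (\<Prod>D\<in>CC. \<Prod>e\<in>E D. ?b x e)" for x
  have bm: "(\<lambda>x. ?b x e) \<in> borel_measurable (\<Pi>\<^sub>M k\<in>C \<union> ?U. lborel)" if "s e \<in> C \<union> ?U" "t e \<in> C \<union> ?U" for e
  proof -
    have "(\<lambda>x. x (s e) - x (t e)) \<in> borel_measurable (\<Pi>\<^sub>M k\<in>C \<union> ?U. lborel)"
      using that measurable_component_singleton[of "s e" "C \<union> ?U" "\<lambda>_. lborel :: real measure"]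
        measurable_component_singleton[of "t e" "C \<union> ?U" "\<lambda>_. lborel :: real measure"]
      by (intro borel_measurable_diff) auto
    then show ?thesis by measurable
  qed
  have gm: "g \<in> borel_measurable (\<Pi>\<^sub>M k\<in>C \<union> ?U. lborel)"
    unfolding g_def using E by (intro borel_measurable_times borel_measurable_prod bm) auto
  have g1: "\<bar>g x\<bar> \<le> 1" for x
    unfolding g_def abs_mult abs_prod by (intro mult_le_one prod_le_1 prod_nonneg conjI) auto
  have int: "integrable (\<Pi>\<^sub>M k\<in>C \<union> ?U. lborel) (\<lambda>x. (\<Prod>k\<in>C \<union> ?U. indicator {0..1} (x k)) * g x)"
    by (rule cube_integrable[OF _ gm g1]) (use finC finU in auto)
  have split: "(\<Prod>k\<in>C \<union> ?U. indicator {0..1} (merge C ?U (x, y) k)) * g (merge C ?U (x, y))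
     = ((\<Prod>k\<in>C. indicator {0..1} (x k)) * (\<Prod>e\<in>E C. ?b x e))
      * ((\<Prod>k\<in>?U. indicator {0..1} (y k)) * (\<Prod>D\<in>CC. \<Prod>e\<in>E D. ?b y e))" for x y :: "'k \<Rightarrow> real"
  proof -
    let ?m = "merge C ?U (x, y)"
    have mC: "?m k = x k" if "k \<in> C" for k using that by (simp add: merge_def)
    have mU: "?m k = y k" if "k \<in> ?U" for k using that disj by (auto simp: merge_def)
    have "(\<Prod>k\<in>C \<union> ?U. indicator {0..1} (?m k) :: real) = (\<Prod>k\<in>C. indicator {0..1} (x k)) * (\<Prod>k\<in>?U. indicator {0..1} (y k))"
      unfolding prod.union_disjoint[OF finC finU disj] using mC mU by (intro arg_cong2[where f = "(*)"] prod.cong refl) auto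
    moreover have "(\<Prod>e\<in>E C. ?b ?m e) = (\<Prod>e\<in>E C. ?b x e)" using mC E by (intro prod.cong refl) auto
    moreover have "(\<Prod>D\<in>CC. \<Prod>e\<in>E D. ?b ?m e) = (\<Prod>D\<in>CC. \<Prod>e\<in>E D. ?b y e)"
    proof (intro prod.cong refl)
      fix D e assume "D \<in> CC" "e \<in> E D"
      then show "?b ?m e = ?b y e" using mU[of "s e"] mU[of "t e"] E(2) by simp
    qed
    ultimately show ?thesis unfolding g_def by (simp only: mult_ac)
  qed
  have "(LINT x|(\<Pi>\<^sub>M k\<in>\<Union>(insert C CC). lborel). (\<Prod>k\<in>\<Union>(insert C CC). indicator {0..1} (x k)) * (\<Prod>D\<in>insert C CC. \<Prod>e\<in>E D. ?b x e))
    = (LINT x|(\<Pi>\<^sub>M k\<in>C \<union> ?U. lborel). (\<Prod>k\<in>C \<union> ?U. indicator {0..1} (x k)) * g x)"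
    using insert.hyps by (simp add: g_def)
  also have "\<dots> = (LINT x|(\<Pi>\<^sub>M k\<in>C. lborel). LINT y|(\<Pi>\<^sub>M k\<in>?U. lborel).
      (\<Prod>k\<in>C \<union> ?U. indicator {0..1} (merge C ?U (x, y) k)) * g (merge C ?U (x, y)))"
    by (rule product_integral_fold[OF disj finC finU int])
  also have "\<dots> = (LINT x|(\<Pi>\<^sub>M k\<in>C. lborel). (\<Prod>k\<in>C. indicator {0..1} (x k)) * (\<Prod>e\<in>E C. ?b x e))
     * (LINT y|(\<Pi>\<^sub>M k\<in>?U. lborel). (\<Prod>k\<in>?U. indicator {0..1} (y k)) * (\<Prod>D\<in>CC. \<Prod>e\<in>E D. ?b y e))"
    unfolding split integral_mult_right_zero integral_mult_left_zero ..
  also have "(LINT y|(\<Pi>\<^sub>M k\<in>?U. lborel). (\<Prod>k\<in>?U. indicator {0..1} (y k)) * (\<Prod>D\<in>CC. \<Prod>e\<in>E D. ?b y e))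
     = (\<Prod>D\<in>CC. LINT x|(\<Pi>\<^sub>M k\<in>D. lborel). (\<Prod>k\<in>D. indicator {0..1} (x k)) * (\<Prod>e\<in>E D. ?b x e))"
    by (rule insert.IH) (use insert.prems in \<open>auto simp: pairwise_insert\<close>)
  finally show ?case using insert.hyps by simp
qed

definition twin_band :: "('i \<Rightarrow> real) \<Rightarrow> ('e \<Rightarrow> 'i) \<Rightarrow> ('v, 'e) pre_digraph \<Rightarrow> ('v \<Rightarrow> real) \<Rightarrow> 'e \<Rightarrow> real" where
  "twin_band c \<gamma> G x e = of_bool (\<bar>x (tail G e) - x (head G e)\<bar> \<le> c (\<gamma> e))"

lemma p_tree_cube:
  assumes "finite (verts S)"
  shows "p_tree c \<gamma> S = (LINT x|(\<Pi>\<^sub>M v\<in>verts S. lborel). (\<Prod>v\<in>verts S. indicator {0..1} (x v)) *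
      (\<Prod>P\<in>twin_pairs S. twin_band c \<gamma> S x (twin_rep P)))
    / (\<Prod>P\<in>twin_pairs S. 2 * c (\<gamma> (twin_rep P)) - (c (\<gamma> (twin_rep P)))\<^sup>2)"
proof -
  have "indicator (verts S \<rightarrow>\<^sub>E {0..1}) x = (\<Prod>v\<in>verts S. indicator {0..1} (x v) :: real)"
    if x: "x \<in> space (\<Pi>\<^sub>M v\<in>verts S. lborel)" for x :: "'a \<Rightarrow> real"
  proof (cases "x \<in> verts S \<rightarrow>\<^sub>E {0..1}")
    case True
    then show ?thesis by (auto simp: PiE_def Pi_def)
  next
    case False
    then obtain v where "v \<in> verts S" "x v \<notin> {0..1}" using x by (auto simp: space_PiM PiE_def Pi_def)
    then have "(\<Prod>v\<in>verts S. indicator {0..1} (x v) :: real) = 0"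
      using assms by (intro prod_zero bexI[of _ v]) auto
    then show ?thesis using False by simp
  qed
  then show ?thesis
    unfolding p_tree_def set_lebesgue_integral_def twin_band_def
    by (intro arg_cong2[where f = "(/)"] refl Bochner_Integration.integral_cong) simp_all
qed

text \<open>Both ends of a twin pair lie in the same component, so the components split the vertices
  and the twin pairs alike. Thanks to the single integral, the limit never has to be tracked
  component by component.\<close>

lemma p_forest_cube:
  assumes "fin_digraph F"
  shows "p_forest c \<gamma> F = (LINT x|(\<Pi>\<^sub>M v\<in>verts F. lborel). (\<Prod>v\<in>verts F. indicator {0..1} (x v)) *
      (\<Prod>P\<in>twin_pairs F. twin_band c \<gamma> F x (twin_rep P)))
    / (\<Prod>P\<in>twin_pairs F. 2 * c (\<gamma> (twin_rep P)) - (c (\<gamma> (twin_rep P)))\<^sup>2)"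
proof -
  interpret fin_digraph F by fact
  interpret Y: pair_wf_digraph "mk_symmetric F" by (rule wellformed_mk_symmetric)
  define CC where "CC = pre_digraph.sccs_verts (with_proj (mk_symmetric F))"
  have CCim: "CC = Y.scc_of ` verts F" unfolding CC_def Y.sccs_verts_conv_scc_of by simp
  have finCC: "finite CC" unfolding CCim by simp
  have disj: "pairwise disjnt CC"
    unfolding CC_def pairwise_def disjnt_def using Y.sccs_verts_disjoint by blast
  have un: "\<Union>CC = verts F"
  proof
    show "\<Union>CC \<subseteq> verts F" unfolding CCim Y.scc_of_def by (auto dest: Y.reachable_in_verts)
    show "verts F \<subseteq> \<Union>CC" unfolding CCim using Y.in_scc_of_self by auto
  qed
  have sub: "C \<subseteq> verts F" if "C \<in> CC" for C using that un by auto
  have finC: "finite C" if "C \<in> CC" for C by (rule finite_subset[OF sub[OF that] finite_verts])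
  let ?H = "induce_subgraph F"
  \<comment> \<open>\<open>components\<close> is a set of graphs; since different vertex sets induce
    different graphs, the product counts every component once, isolated vertices included.\<close>
  have inj: "inj_on ?H CC"
    by (rule inj_onI) (metis induce_subgraph_verts)
  have comp: "components F = ?H ` CC" by (simp add: components_def CC_def)
  \<comment> \<open>The twin class is the same set of arcs in \<open>F\<close> and in the component,
    and therefore so is the representative chosen by \<open>twin_rep\<close>.\<close>
  have tw: "twins (?H C) e = twins F e" if "e \<in> arcs (?H C)" for C e
    using that by (auto simp: twins_def doubleton_eq_iff)
  have tps: "twin_pairs (?H C) = twins F ` arcs (?H C)" for C
    using tw by (auto simp: twin_pairs_def)
  have self: "e \<in> twins F e" if "e \<in> arcs F" for e using that by (auto simp: twins_def)
  have UN: "twin_pairs F = (\<Union>C\<in>CC. twin_pairs (?H C))"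
  proof -
    have "\<exists>C\<in>CC. e \<in> arcs (?H C)" if "e \<in> arcs F" for e
    proof -
      have "(tail F e, head F e) \<in> parcs (mk_symmetric F)" "(head F e, tail F e) \<in> parcs (mk_symmetric F)"
        using that by (auto simp: parcs_mk_symmetric)
      then have "head F e \<in> Y.scc_of (tail F e)" by (auto simp: Y.scc_of_def)
      moreover have "tail F e \<in> Y.scc_of (tail F e)" using that Y.in_scc_of_self by simp
      ultimately show ?thesis using that unfolding CCim by auto
    qed
    then show ?thesis unfolding tps by (auto simp: twin_pairs_def)
  qed
  have finT: "finite (twin_pairs (?H C))" for C unfolding tps by (auto intro: finite_subset[OF _ finite_arcs])
  have rep: "tail F (twin_rep P) \<in> C \<and> head F (twin_rep P) \<in> C" if "P \<in> twin_pairs (?H C)" for P C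
  proof -
    from that obtain e where e: "e \<in> arcs (?H C)" "P = twins F e" unfolding tps by auto
    then have "e \<in> P" using self by auto
    then have "twin_rep P \<in> P" unfolding twin_rep_def by (rule someI)
    then show ?thesis using e by (auto simp: twins_def doubleton_eq_iff)
  qed
  have tdisj: "twin_pairs (?H C) \<inter> twin_pairs (?H D) = {}" if "C \<in> CC" "D \<in> CC" "C \<noteq> D" for C D
  proof -
    have "C \<inter> D = {}" using disj that by (auto simp: pairwise_def disjnt_def)
    then show ?thesis using rep by blast
  qed
  have prodUN: "(\<Prod>P\<in>twin_pairs F. q P) = (\<Prod>C\<in>CC. \<Prod>P\<in>twin_pairs (?H C). q P)" for q :: "'b set \<Rightarrow> real"
    unfolding UN using finCC finT tdisj by (intro prod.UNION_disjoint) auto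
  have band: "twin_band c \<gamma> (?H C) x e = of_bool (\<bar>x (tail F e) - x (head F e)\<bar> \<le> c (\<gamma> e))" for C x e
    by (simp add: twin_band_def)
  let ?D = "\<lambda>P. 2 * c (\<gamma> (twin_rep P)) - (c (\<gamma> (twin_rep P)))\<^sup>2"
  let ?b = "\<lambda>x P. of_bool (\<bar>x (tail F (twin_rep P)) - x (head F (twin_rep P))\<bar> \<le> c (\<gamma> (twin_rep P))) :: real"
  have "p_forest c \<gamma> F = (\<Prod>C\<in>CC. p_tree c \<gamma> (?H C))"
    unfolding p_forest_def comp by (simp add: prod.reindex[OF inj])
  also have "\<dots> = (\<Prod>C\<in>CC. (LINT x|(\<Pi>\<^sub>M v\<in>C. lborel). (\<Prod>v\<in>C. indicator {0..1} (x v)) * (\<Prod>P\<in>twin_pairs (?H C). ?b x P))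
      / (\<Prod>P\<in>twin_pairs (?H C). ?D P))"
    by (intro prod.cong refl) (subst p_tree_cube, auto simp: finC band)
  also have "\<dots> = (\<Prod>C\<in>CC. (LINT x|(\<Pi>\<^sub>M v\<in>C. lborel). (\<Prod>v\<in>C. indicator {0..1} (x v)) * (\<Prod>P\<in>twin_pairs (?H C). ?b x P)))
      / (\<Prod>P\<in>twin_pairs F. ?D P)"
    unfolding prodUN prod_dividef ..
  also have "(\<Prod>C\<in>CC. (LINT x|(\<Pi>\<^sub>M v\<in>C. lborel). (\<Prod>v\<in>C. indicator {0..1} (x v)) * (\<Prod>P\<in>twin_pairs (?H C). ?b x P)))
     = (LINT x|(\<Pi>\<^sub>M v\<in>\<Union>CC. lborel). (\<Prod>v\<in>\<Union>CC. indicator {0..1} (x v)) * (\<Prod>C\<in>CC. \<Prod>P\<in>twin_pairs (?H C). ?b x P))"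
    by (rule cube_prod_disjoint[symmetric, OF finCC finC disj rep])
  finally show ?thesis unfolding un prodUN twin_band_def .
qed

section \<open>Contraction and the reduced forest\<close>

lemma merged_eq_iff:
  assumes "wf_digraph G" "x \<in> verts G" "y \<in> verts G"
  shows "merged G A x = merged G A y \<longleftrightarrow> (x, y) \<in> (arc_rel G (arcs G \<inter> A))\<^sup>*"
proof -
  let ?r = "(arc_rel G (arcs G \<inter> A))\<^sup>*"
  have sym: "(b, a) \<in> ?r" if "(a, b) \<in> ?r" for a b
    using sym_rtrancl[OF sym_arc_rel] that by (rule symD)
  have m: "merged G A v = {z \<in> verts G. (v, z) \<in> ?r}" if "v \<in> verts G" for v
    unfolding merged_def pre_digraph.scc_of_def reachable_restrict_arcs[OF assms(1) Int_lower1]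
    using that by (blast intro: sym)
  show ?thesis
  proof
    assume "merged G A x = merged G A y"
    then have "y \<in> merged G A x" unfolding m[OF assms(3)] using assms(3) by auto
    then show "(x, y) \<in> ?r" unfolding m[OF assms(2)] by auto
  next
    assume "(x, y) \<in> ?r"
    then show "merged G A x = merged G A y"
      unfolding m[OF assms(2)] m[OF assms(3)] by (blast intro: rtrancl_trans sym)
  qed
qed

text \<open>A partner joins the same ends as its tree arc, so contracting both identifies no more
  vertices than contracting the tree arc alone; hence the contraction is a class map as
  \<open>band_avg_tendsto\<close> requires. Surviving tree arcs keep distinct pairs of ends by
  \<open>class_map_ends_inj\<close>, so they still index the twin pairs.\<close>

theorem cube_integral_reduced_forest:
  fixes G :: "('v, 'e) pre_digraph" and \<gamma> :: "'e \<Rightarrow> 'i" and I2 I3 :: "'i set" and p :: "'e \<Rightarrow> 'e"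
  assumes "fin_digraph G" "grown G (verts G) S" "arcs G = S \<union> p ` S"
    and double: "\<forall>e\<in>S. \<gamma> (p e) = \<gamma> e \<and> {tail G (p e), head G (p e)} = {tail G e, head G e}"
    and "\<forall>i\<in>I3. c i = 1"
  defines "\<kappa> \<equiv> merged G {e \<in> arcs G. \<gamma> e \<in> I2}"
  shows "\<forall>x\<in>verts G. \<forall>y\<in>verts G. \<kappa> x = \<kappa> y \<longleftrightarrow> (x, y) \<in> (arc_rel G (S \<inter> {e. \<gamma> e \<in> I2}))\<^sup>*"
    and "cube_integral G \<kappa> (\<lambda>e. c (\<gamma> e)) (S - {e. \<gamma> e \<in> I2}) (verts G) (\<lambda>_ _. 1)
      = p_forest c \<gamma> (reduced_forest I2 I3 \<gamma> G)"
proof -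
  interpret fin_digraph G by fact
  note p = bspec[OF double]
  let ?L = "{e. \<gamma> e \<in> I2}"
  have single: "arc_rel G {p e} = arc_rel G {e}" if "e \<in> S" for e
    using p[OF that] by (auto simp: arc_rel_def doubleton_eq_iff)
  have arc_rel_UN: "arc_rel G B = (\<Union>e\<in>B. arc_rel G {e})" for B by (simp add: arc_rel_def)
  have "arcs G \<inter> {e \<in> arcs G. \<gamma> e \<in> I2} = (S \<inter> ?L) \<union> p ` (S \<inter> ?L)"
    unfolding assms(3) using p by auto
  moreover have "(\<Union>e\<in>p ` (S \<inter> ?L). arc_rel G {e}) = (\<Union>e\<in>S \<inter> ?L. arc_rel G {e})"
    unfolding image_image[symmetric] using single by (auto intro!: SUP_cong)
  ultimately have rel: "arc_rel G (arcs G \<inter> {e \<in> arcs G. \<gamma> e \<in> I2}) = arc_rel G (S \<inter> ?L)"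
    by (simp only: arc_rel_UN[of "S \<inter> ?L \<union> p ` (S \<inter> ?L)"] arc_rel_UN[of "S \<inter> ?L"] UN_Un sup.idem)
  show \<kappa>: "\<forall>x\<in>verts G. \<forall>y\<in>verts G. \<kappa> x = \<kappa> y \<longleftrightarrow> (x, y) \<in> (arc_rel G (S \<inter> ?L))\<^sup>*"
    unfolding \<kappa>_def rel[symmetric] by (intro ballI merged_eq_iff wf_digraph)
  define F where "F = reduced_forest I2 I3 \<gamma> G"
  define S4 where "S4 = {e \<in> S. \<gamma> e \<notin> I2 \<union> I3}"
  have F: "verts F = \<kappa> ` verts G" "arcs F = {e \<in> arcs G. \<gamma> e \<notin> I2 \<union> I3}"
    "tail F = (\<lambda>e. \<kappa> (tail G e))" "head F = (\<lambda>e. \<kappa> (head G e))"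
    by (auto simp: F_def reduced_forest_def remove_arcs_def contract_arcs_def \<kappa>_def)
  have finF: "fin_digraph F" by unfold_locales (auto simp: F)
  have S4: "S4 \<subseteq> S - ?L" "finite S4" using grown_finite[OF assms(2)] by (auto simp: S4_def)
  have arcsF: "arcs F = S4 \<union> p ` S4" unfolding F assms(3) S4_def using p by auto
  have pF: "{tail F (p e), head F (p e)} = {tail F e, head F e}" if "e \<in> S" for e
    using p[OF that] by (auto simp: F doubleton_eq_iff)
  have inj: "\<forall>d\<in>S4. \<forall>e\<in>S4. {tail F d, head F d} = {tail F e, head F e} \<longrightarrow> d = e"
  proof (intro ballI impI)
    fix d e assume "d \<in> S4" "e \<in> S4" "{tail F d, head F d} = {tail F e, head F e}"
    then show "d = e" using class_map_ends_inj[OF assms(2) \<kappa>, of d e] S4(1) by (auto simp: F)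
  qed
  have "\<forall>e\<in>S4. {tail F (p e), head F (p e)} = {tail F e, head F e}" using pF S4(1) by blast
  note doubled = twins_doubled[OF arcsF this inj]
  have tw: "twins F e = {e, p e}" if "e \<in> S4" for e by (rule doubled(1)[OF that])
  note tpF = doubled(2) and injt = doubled(3)
  \<comment> \<open>The choice may return either twin. This is harmless: the twins agree in label
    and unordered ends, and the band condition is symmetric in the ends.\<close>
  have rep: "twin_rep (twins F e) = e \<or> twin_rep (twins F e) = p e" if "e \<in> S4" for e
  proof -
    have "e \<in> twins F e" using tw[OF that] by simp
    then have "twin_rep (twins F e) \<in> twins F e" unfolding twin_rep_def by (rule someI)
    then show ?thesis using tw[OF that] by auto
  qed
  have label: "\<gamma> (twin_rep (twins F e)) = \<gamma> e" if "e \<in> S4" for e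
  proof -
    have "e \<in> S" using that S4(1) by auto
    from p[OF this] rep[OF that] show ?thesis by metis
  qed
  have band: "twin_band c \<gamma> F x (twin_rep (twins F e)) = twin_band c \<gamma> F x e" if "e \<in> S4" for e x
  proof -
    have "e \<in> S" using that S4(1) by auto
    from pF[OF this] rep[OF that]
    have "{tail F (twin_rep (twins F e)), head F (twin_rep (twins F e))} = {tail F e, head F e}" by metis
    then show ?thesis unfolding twin_band_def label[OF that] by (auto simp: doubleton_eq_iff abs_minus_commute)
  qed
  let ?D = "\<lambda>e. 2 * c (\<gamma> e) - (c (\<gamma> e))\<^sup>2"
  have forest: "p_forest c \<gamma> F = (LINT x|(\<Pi>\<^sub>M k\<in>\<kappa> ` verts G. lborel). (\<Prod>k\<in>\<kappa> ` verts G. indicator {0..1} (x k)) *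
      (\<Prod>e\<in>S4. twin_band c \<gamma> F x e)) / (\<Prod>e\<in>S4. ?D e)"
  proof -
    have "(\<Prod>e\<in>S4. twin_band c \<gamma> F x (twin_rep (twins F e))) = (\<Prod>e\<in>S4. twin_band c \<gamma> F x e)" for x
      using band by (intro prod.cong refl)
    moreover have "(\<Prod>e\<in>S4. ?D (twin_rep (twins F e))) = (\<Prod>e\<in>S4. ?D e)"
      using label by (intro prod.cong refl) simp
    ultimately show ?thesis
      unfolding p_forest_cube[OF finF] tpF prod.reindex[OF injt] F(1) comp_def by (simp only:)
  qed
  \<comment> \<open>Since \<open>c = 1\<close> on \<open>I3\<close>, the factor of such an arc is \<open>1\<close> on the cube, so keeping it amounts to
    removing the arc.\<close>
  have "(\<Prod>k\<in>\<kappa> ` verts G. indicator {0..1} (x k)) *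
     ((\<Prod>e\<in>S - ?L. of_bool (\<bar>x (\<kappa> (tail G e)) - x (\<kappa> (head G e))\<bar> \<le> c (\<gamma> e)) / ?D e) * (\<Prod>v\<in>verts G. 1))
     = (\<Prod>k\<in>\<kappa> ` verts G. indicator {0..1} (x k)) * (\<Prod>e\<in>S4. twin_band c \<gamma> F x e) / (\<Prod>e\<in>S4. ?D e)" for x
  proof (cases "\<forall>k\<in>\<kappa> ` verts G. x k \<in> {0..1}")
    case False
    then obtain k where "k \<in> \<kappa> ` verts G" "x k \<notin> {0..1}" by blast
    then have "(\<Prod>k\<in>\<kappa> ` verts G. indicator {0..1} (x k) :: real) = 0"
      by (intro prod_zero bexI[of _ k]) auto
    then show ?thesis by (simp only: mult_zero_left div_0)
  next
    case True
    have "(\<Prod>e\<in>S - ?L. of_bool (\<bar>x (\<kappa> (tail G e)) - x (\<kappa> (head G e))\<bar> \<le> c (\<gamma> e)) / ?D e)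
      = (\<Prod>e\<in>S4. of_bool (\<bar>x (\<kappa> (tail G e)) - x (\<kappa> (head G e))\<bar> \<le> c (\<gamma> e)) / ?D e :: real)"
    proof (rule prod.mono_neutral_right)
      show "\<forall>e\<in>S - ?L - S4. of_bool (\<bar>x (\<kappa> (tail G e)) - x (\<kappa> (head G e))\<bar> \<le> c (\<gamma> e)) / ?D e = (1::real)"
      proof
        fix e assume e: "e \<in> S - ?L - S4"
        then have "c (\<gamma> e) = 1" using assms(5) by (auto simp: S4_def)
        moreover have "x (\<kappa> (tail G e)) \<in> {0..1}" "x (\<kappa> (head G e)) \<in> {0..1}"
          using True grown_ends[OF assms(2), of e] e by auto
        ultimately show "of_bool (\<bar>x (\<kappa> (tail G e)) - x (\<kappa> (head G e))\<bar> \<le> c (\<gamma> e)) / ?D e = (1::real)" by auto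
      qed
    qed (use S4 grown_finite[OF assms(2)] in auto)
    then show ?thesis by (simp add: prod_dividef twin_band_def F)
  qed
  then show "cube_integral G \<kappa> (\<lambda>e. c (\<gamma> e)) (S - ?L) (verts G) (\<lambda>_ _. 1) = p_forest c \<gamma> (reduced_forest I2 I3 \<gamma> G)"
    unfolding F_def[symmetric] forest cube_integral_def by (simp only: integral_divide_zero)
qed

section \<open>Moments of Wigner matrices\<close>

text \<open>The product is at most the largest factor to the power \<open>card E\<close>, and
  summing over all factors avoids having to know which one is largest. This reduces joint moments to
  moments of single entries; the summand 1 accounts for the empty product.\<close>

lemma prod_norm_le_sum_power:
  fixes z :: "'e \<Rightarrow> complex"
  assumes "finite E"
  shows "cmod (\<Prod>e\<in>E. z e) \<le> 1 + (\<Sum>e\<in>E. cmod (z e) ^ card E)"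
proof (cases "E = {}")
  case False
  have "Max ((\<lambda>e. cmod (z e)) ` E) \<in> (\<lambda>e. cmod (z e)) ` E" using assms False by (intro Max_in) auto
  then obtain d where d: "d \<in> E" "Max ((\<lambda>e. cmod (z e)) ` E) = cmod (z d)" by auto
  have d: "d \<in> E" "\<And>e. e \<in> E \<Longrightarrow> cmod (z e) \<le> cmod (z d)"
    using d(1) assms unfolding d(2)[symmetric] by auto
  have "cmod (\<Prod>e\<in>E. z e) \<le> (\<Prod>e\<in>E. cmod (z d))"
    unfolding prod_norm[symmetric] using d by (intro prod_mono) auto
  also have "\<dots> = cmod (z d) ^ card E" by simp
  also have "\<dots> \<le> (\<Sum>e\<in>E. cmod (z e) ^ card E)"
    using assms d(1) by (intro member_le_sum) auto
  finally show ?thesis by simp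
qed auto

lemma wigner_familyD:
  assumes "wigner_family M I \<beta> X"
  shows wigner_family_prob_space: "prob_space (M n)"
    and wigner_family_cnj: "\<lbrakk>i \<in> I; j \<in> {1..n}; k \<in> {1..n}; \<omega> \<in> space (M n)\<rbrakk> \<Longrightarrow> X n i k j \<omega> = cnj (X n i j k \<omega>)"
    and wigner_family_indep: "prob_space.indep_vars (M n) (\<lambda>_. borel) (\<lambda>(i, j, k). X n i j k)
        {(i, j, k). i \<in> I \<and> 1 \<le> j \<and> j \<le> k \<and> k \<le> n}"
    and wigner_family_variance: "\<lbrakk>i \<in> I; 1 \<le> j; j < k; k \<le> n\<rbrakk> \<Longrightarrow> (LINT \<omega>|M n. X n i j k \<omega>) = 0 \<and>
        (LINT \<omega>|M n. (cmod (X n i j k \<omega>))\<^sup>2) = 1 \<and>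
        (LINT \<omega>|M n. (X n i j k \<omega>)\<^sup>2) = complex_of_real (\<beta> i)"
    and wigner_family_moments: "\<lbrakk>finite J; J \<subseteq> I\<rbrakk> \<Longrightarrow> (SUP n. SUP i\<in>J. SUP j\<in>{1..n}. SUP k\<in>{j..n}.
           \<integral>\<^sup>+ \<omega>. ennreal (cmod (X n i j k \<omega>) ^ l) \<partial>M n) < \<infinity>"
proof -
  note D = assms[unfolded wigner_family_def]
  note D1 = D[THEN conjunct1] and E1 = D[THEN conjunct2]
  note E2 = E1[THEN conjunct2]
  note E3 = E2[THEN conjunct2]
  note E4 = E3[THEN conjunct2]
  note E5 = E4[THEN conjunct2]
  show "prob_space (M n)" using D1 by simp
  show "X n i k j \<omega> = cnj (X n i j k \<omega>)" if "i \<in> I" "j \<in> {1..n}" "k \<in> {1..n}" "\<omega> \<in> space (M n)"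
    using E1[THEN conjunct1, THEN spec, THEN bspec, THEN bspec, THEN bspec, THEN bspec, OF that] .
  show "prob_space.indep_vars (M n) (\<lambda>_. borel) (\<lambda>(i, j, k). X n i j k)
        {(i, j, k). i \<in> I \<and> 1 \<le> j \<and> j \<le> k \<and> k \<le> n}"
    using E3[THEN conjunct1, THEN spec] .
  show "(LINT \<omega>|M n. X n i j k \<omega>) = 0 \<and> (LINT \<omega>|M n. (cmod (X n i j k \<omega>))\<^sup>2) = 1 \<and>
        (LINT \<omega>|M n. (X n i j k \<omega>)\<^sup>2) = complex_of_real (\<beta> i)" if "i \<in> I" "1 \<le> j" "j < k" "k \<le> n"
    using E4[THEN conjunct1, THEN spec, THEN bspec, THEN spec, THEN spec, THEN mp, OF that(1)] that(2-) by simp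
  show "(SUP n. SUP i\<in>J. SUP j\<in>{1..n}. SUP k\<in>{j..n}.
           \<integral>\<^sup>+ \<omega>. ennreal (cmod (X n i j k \<omega>) ^ l) \<partial>M n) < \<infinity>" if "finite J" "J \<subseteq> I"
    using E5[THEN spec, THEN spec, THEN mp, OF conjI[OF that]] .
qed

text \<open>Independence includes measurability on and above the diagonal. Below it, the entry is a
  conjugate of one of those on the sample space.\<close>

lemma wigner_family_measurable:
  assumes W: "wigner_family M I \<beta> X" and "i \<in> I" "j \<in> {1..n}" "k \<in> {1..n}"
  shows "X n i j k \<in> borel_measurable (M n)"
proof -
  interpret prob_space "M n" using wigner_family_prob_space[OF W] .
  have upper: "X n i j k \<in> borel_measurable (M n)" if "j \<in> {1..n}" "k \<in> {1..n}" "j \<le> k" for j k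
  proof -
    have "\<forall>x\<in>{(i, j, k). i \<in> I \<and> 1 \<le> j \<and> j \<le> k \<and> k \<le> n}. random_variable borel ((\<lambda>(i, j, k). X n i j k) x)"
      by (rule wigner_family_indep[OF W, of n, unfolded indep_vars_def, THEN conjunct1])
    from bspec[OF this, of "(i, j, k)"] show ?thesis using that assms(2) by auto
  qed
  show ?thesis
  proof (cases "j \<le> k")
    case True then show ?thesis using upper assms(3,4) by simp
  next
    case False
    then have [measurable]: "X n i k j \<in> borel_measurable (M n)" using upper assms(3,4) by simp
    have "(\<lambda>\<omega>. cnj (X n i k j \<omega>)) \<in> borel_measurable (M n)"
      by (rule borel_measurable_continuous_on[OF continuous_on_cnj[OF continuous_on_id] \<open>X n i k j \<in> _\<close>])
    moreover have "X n i j k \<omega> = cnj (X n i k j \<omega>)" if "\<omega> \<in> space (M n)" for \<omega>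
      by (rule wigner_family_cnj[OF W assms(2,4,3) that])
    ultimately show ?thesis by (subst measurable_cong)
  qed
qed

lemma wigner_family_moment_bound:
  assumes W: "wigner_family M I \<beta> X" and J: "finite J" "J \<subseteq> I"
  obtains C where "0 \<le> C" "\<And>n i j k. i \<in> J \<Longrightarrow> j \<in> {1..n} \<Longrightarrow> k \<in> {1..n} \<Longrightarrow>
    integrable (M n) (\<lambda>\<omega>. cmod (X n i j k \<omega>) ^ l) \<and> (LINT \<omega>|M n. cmod (X n i j k \<omega>) ^ l) \<le> C"
proof -
  define c where "c = (SUP n. SUP i\<in>J. SUP j\<in>{1..n}. SUP k\<in>{j..n}. \<integral>\<^sup>+ \<omega>. ennreal (cmod (X n i j k \<omega>) ^ l) \<partial>M n)"
  have "c < \<infinity>" unfolding c_def by (rule wigner_family_moments[OF W J])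
  then have c: "c = ennreal (enn2real c)" by simp
  have up: "(\<integral>\<^sup>+ \<omega>. ennreal (cmod (X n i j k \<omega>) ^ l) \<partial>M n) \<le> c" if "i \<in> J" "j \<in> {1..n}" "k \<in> {j..n}" for n i j k
    unfolding c_def
    by (rule SUP_upper2[OF UNIV_I[of n]], rule SUP_upper2[OF that(1)], rule SUP_upper2[OF that(2)], rule SUP_upper2[OF that(3)]) simp
  have all: "(\<integral>\<^sup>+ \<omega>. ennreal (cmod (X n i j k \<omega>) ^ l) \<partial>M n) \<le> c" if "i \<in> J" "j \<in> {1..n}" "k \<in> {1..n}" for n i j k
  proof (cases "j \<le> k")
    case True then show ?thesis using up[of i j n k] that by simp
  next
    case False
    have "(\<integral>\<^sup>+ \<omega>. ennreal (cmod (X n i j k \<omega>) ^ l) \<partial>M n) = (\<integral>\<^sup>+ \<omega>. ennreal (cmod (X n i k j \<omega>) ^ l) \<partial>M n)"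
    proof (rule nn_integral_cong)
      fix \<omega> assume "\<omega> \<in> space (M n)"
      then have "X n i k j \<omega> = cnj (X n i j k \<omega>)"
        by (rule wigner_family_cnj[OF W subsetD[OF J(2) that(1)] that(2,3)])
      then show "ennreal (cmod (X n i j k \<omega>) ^ l) = ennreal (cmod (X n i k j \<omega>) ^ l)" by simp
    qed
    then show ?thesis using up[of i k n j] that False by simp
  qed
  show ?thesis
  proof (rule that[of "enn2real c"])
    fix n j k :: nat and i assume *: "i \<in> J" "j \<in> {1..n}" "k \<in> {1..n}"
    have [measurable]: "X n i j k \<in> borel_measurable (M n)"
      by (rule wigner_family_measurable[OF W subsetD[OF J(2) *(1)] *(2,3)])
    have nn: "(\<integral>\<^sup>+ \<omega>. ennreal (cmod (X n i j k \<omega>) ^ l) \<partial>M n) \<le> ennreal (enn2real c)" using all[OF *] c by simp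
    then have int: "integrable (M n) (\<lambda>\<omega>. cmod (X n i j k \<omega>) ^ l)"
      by (intro integrableI_bounded) (auto simp: ennreal_power norm_power intro: le_less_trans)
    moreover have "(LINT \<omega>|M n. cmod (X n i j k \<omega>) ^ l) \<le> enn2real c"
      using nn nn_integral_eq_integral[OF int] by (simp add: ennreal_le_iff)
    ultimately show "integrable (M n) (\<lambda>\<omega>. cmod (X n i j k \<omega>) ^ l) \<and> (LINT \<omega>|M n. cmod (X n i j k \<omega>) ^ l) \<le> enn2real c" ..
  qed simp
qed

text \<open>The order of quantifiers matters: \<open>C\<close> depends on neither the size nor the
  positions, so it can be taken out of the sum over all embeddings.\<close>

lemma wigner_product_bound:
  fixes \<gamma> :: "'e \<Rightarrow> 'i"
  assumes W: "wigner_family M I \<beta> X" and E: "finite E" "\<And>e. e \<in> E \<Longrightarrow> \<gamma> e \<in> I"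
  shows "\<exists>C. \<forall>n r s. (\<forall>e\<in>E. r e \<in> {1..n} \<and> s e \<in> {1..n}) \<longrightarrow>
      integrable (M n) (\<lambda>\<omega>. \<Prod>e\<in>E. X n (\<gamma> e) (r e) (s e) \<omega>) \<and>
      cmod (LINT \<omega>|M n. (\<Prod>e\<in>E. X n (\<gamma> e) (r e) (s e) \<omega>)) \<le> C"
proof -
  have sub: "\<gamma> ` E \<subseteq> I" using E(2) by blast
  obtain C where C: "0 \<le> C" "\<And>n i j k. i \<in> \<gamma> ` E \<Longrightarrow> j \<in> {1..n} \<Longrightarrow> k \<in> {1..n} \<Longrightarrow>
    integrable (M n) (\<lambda>\<omega>. cmod (X n i j k \<omega>) ^ card E) \<and> (LINT \<omega>|M n. cmod (X n i j k \<omega>) ^ card E) \<le> C"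
    using wigner_family_moment_bound[OF W finite_imageI[OF E(1)] sub, where l = "card E"] by blast
  show ?thesis
  proof (intro exI[of _ "1 + real (card E) * C"] allI impI)
    fix n :: nat and r s :: "'e \<Rightarrow> nat"
    assume rs': "\<forall>e\<in>E. r e \<in> {1..n} \<and> s e \<in> {1..n}"
    note rs = bspec[OF rs']
    interpret prob_space "M n" using wigner_family_prob_space[OF W] .
    let ?Z = "\<lambda>e \<omega>. X n (\<gamma> e) (r e) (s e) \<omega>"
    have [measurable]: "?Z e \<in> borel_measurable (M n)" if "e \<in> E" for e
      using wigner_family_measurable[OF W E(2)[OF that]] rs[OF that] by blast
    have ci: "integrable (M n) (\<lambda>\<omega>. cmod (?Z e \<omega>) ^ card E)" "(LINT \<omega>|M n. cmod (?Z e \<omega>) ^ card E) \<le> C"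
      if "e \<in> E" for e using C(2)[of "\<gamma> e" "r e" n "s e"] rs[OF that] that by blast+
    have dom: "integrable (M n) (\<lambda>\<omega>. 1 + (\<Sum>e\<in>E. cmod (?Z e \<omega>) ^ card E))"
      using ci by auto
    have int: "integrable (M n) (\<lambda>\<omega>. \<Prod>e\<in>E. ?Z e \<omega>)"
      by (rule Bochner_Integration.integrable_bound[OF dom])
         (auto intro!: AE_I2 order_trans[OF prod_norm_le_sum_power[OF E(1)]])
    have "cmod (LINT \<omega>|M n. (\<Prod>e\<in>E. ?Z e \<omega>)) \<le> (LINT \<omega>|M n. cmod (\<Prod>e\<in>E. ?Z e \<omega>))"
      by (rule integral_norm_bound)
    also have "\<dots> \<le> (LINT \<omega>|M n. 1 + (\<Sum>e\<in>E. cmod (?Z e \<omega>) ^ card E))"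
      using int by (intro integral_mono dom integrable_norm prod_norm_le_sum_power E)
    also have "\<dots> = 1 + (\<Sum>e\<in>E. LINT \<omega>|M n. cmod (?Z e \<omega>) ^ card E)"
      using ci by (subst Bochner_Integration.integral_add) (auto simp: prob_space)
    also have "\<dots> \<le> 1 + real (card E) * C" using sum_bounded_above[of E _ C] ci by auto
    finally show "integrable (M n) (\<lambda>\<omega>. \<Prod>e\<in>E. ?Z e \<omega>) \<and> cmod (LINT \<omega>|M n. (\<Prod>e\<in>E. ?Z e \<omega>)) \<le> 1 + real (card E) * C"
      using int by blast
  qed
qed

lemma wigner_product_integrable:
  assumes W: "wigner_family M I \<beta> X" and E: "finite E" "\<And>e. e \<in> E \<Longrightarrow> \<gamma> e \<in> I"
    and rs: "\<And>e. e \<in> E \<Longrightarrow> r e \<in> {1..n} \<and> s e \<in> {1..n}"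
  shows "integrable (M n) (\<lambda>\<omega>. \<Prod>e\<in>E. X n (\<gamma> e) (r e) (s e) \<omega>)"
proof -
  obtain C where "\<forall>n r s. (\<forall>e\<in>E. r e \<in> {1..n} \<and> s e \<in> {1..n}) \<longrightarrow>
      integrable (M n) (\<lambda>\<omega>. \<Prod>e\<in>E. X n (\<gamma> e) (r e) (s e) \<omega>) \<and>
      cmod (LINT \<omega>|M n. (\<Prod>e\<in>E. X n (\<gamma> e) (r e) (s e) \<omega>)) \<le> C"
    using wigner_product_bound[OF W E(1), of \<gamma>] E(2) by blast
  from this[rule_format, OF rs] show ?thesis by (rule conjunct1)
qed

text \<open>Two factors of a product of matrix entries are independent unless they come from the same
  entry on or above the diagonal; that entry is the key.\<close>

definition entry_key :: "('e \<Rightarrow> 'i) \<Rightarrow> ('e \<Rightarrow> nat) \<Rightarrow> ('e \<Rightarrow> nat) \<Rightarrow> 'e \<Rightarrow> 'i \<times> nat \<times> nat" where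
  "entry_key \<gamma> r s e = (\<gamma> e, min (r e) (s e), max (r e) (s e))"

lemma entry_key_eq_iff:
  "entry_key \<gamma> r s e = entry_key \<gamma> r s d \<longleftrightarrow> \<gamma> e = \<gamma> d \<and> {r e, s e} = {r d, s d}"
  by (auto simp: entry_key_def doubleton_eq_iff min_def max_def)

text \<open>Each factor is the entry named by its key or the conjugate of that entry. Grouping by
  keys therefore turns the product into one of functions \<open>H k\<close> of independent
  variables.\<close>

lemma wigner_product_factor:
  fixes \<gamma> :: "'e \<Rightarrow> 'i"
  assumes W: "wigner_family M I \<beta> X" and E: "finite E" "\<And>e. e \<in> E \<Longrightarrow> \<gamma> e \<in> I"
    and rs: "\<And>e. e \<in> E \<Longrightarrow> r e \<in> {1..n} \<and> s e \<in> {1..n}"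
  defines "key \<equiv> entry_key \<gamma> r s"
  shows "(LINT \<omega>|M n. (\<Prod>e\<in>E. X n (\<gamma> e) (r e) (s e) \<omega>))
    = (\<Prod>k\<in>key ` E. LINT \<omega>|M n. (\<Prod>e\<in>{e \<in> E. key e = k}. X n (\<gamma> e) (r e) (s e) \<omega>))"
proof -
  interpret prob_space "M n" using wigner_family_prob_space[OF W] .
  let ?Z = "\<lambda>e \<omega>. X n (\<gamma> e) (r e) (s e) \<omega>"
  let ?Y = "\<lambda>(i, j, k). X n i j k"
  define H :: "'i \<times> nat \<times> nat \<Rightarrow> complex \<Rightarrow> complex"
    where "H k z = (\<Prod>e\<in>{e \<in> E. key e = k}. if r e \<le> s e then z else cnj z)" for k z
  have Hm: "H k \<in> borel_measurable borel" for k
    unfolding H_def[abs_def]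
  proof (intro borel_measurable_prod)
    show "(\<lambda>z. if r e \<le> s e then z else cnj z) \<in> borel_measurable borel" for e
      by (cases "r e \<le> s e") (simp_all add: borel_measurable_continuous_onI continuous_on_cnj)
  qed
  have HZ: "H k (?Y k \<omega>) = (\<Prod>e\<in>{e \<in> E. key e = k}. ?Z e \<omega>)" if "\<omega> \<in> space (M n)" for k \<omega>
    unfolding H_def
  proof (intro prod.cong refl)
    fix e assume e: "e \<in> {e \<in> E. key e = k}"
    have "X n (\<gamma> e) (r e) (s e) \<omega> = cnj (X n (\<gamma> e) (s e) (r e) \<omega>)"
      by (rule wigner_family_cnj[OF W]) (use e E rs that in auto)
    then show "(if r e \<le> s e then ?Y k \<omega> else cnj (?Y k \<omega>)) = ?Z e \<omega>"
      using e by (auto simp: key_def entry_key_def min_def max_def)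
  qed
  have sub: "key ` E \<subseteq> {(i, j, k). i \<in> I \<and> 1 \<le> j \<and> j \<le> k \<and> k \<le> n}"
  proof
    fix x assume "x \<in> key ` E"
    then obtain e where e: "e \<in> E" "x = key e" by blast
    show "x \<in> {(i, j, k). i \<in> I \<and> 1 \<le> j \<and> j \<le> k \<and> k \<le> n}"
      using rs[OF e(1)] E(2)[OF e(1)] by (auto simp: e(2) key_def entry_key_def)
  qed
  have ind: "indep_vars (\<lambda>_. borel) (\<lambda>k \<omega>. H k (?Y k \<omega>)) (key ` E)"
    by (rule indep_vars_compose2[OF indep_vars_subset[OF wigner_family_indep[OF W] sub]]) (rule Hm)
  have int: "integrable (M n) (\<lambda>\<omega>. H k (?Y k \<omega>))" for k
  proof -
    have "integrable (M n) (\<lambda>\<omega>. \<Prod>e\<in>{e \<in> E. key e = k}. ?Z e \<omega>)"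
      by (rule wigner_product_integrable[OF W]) (use E rs in auto)
    then show ?thesis by (rule Bochner_Integration.integrable_cong[THEN iffD2, rotated 2]) (auto simp: HZ)
  qed
  have "(LINT \<omega>|M n. (\<Prod>e\<in>E. ?Z e \<omega>)) = (LINT \<omega>|M n. (\<Prod>k\<in>key ` E. H k (?Y k \<omega>)))"
    by (intro Bochner_Integration.integral_cong refl) (simp only: HZ prod.image_gen[OF E(1), of _ key])
  also have "\<dots> = (\<Prod>k\<in>key ` E. LINT \<omega>|M n. H k (?Y k \<omega>))"
    by (rule indep_vars_lebesgue_integral[OF _ ind int]) (use E in auto)
  also have "\<dots> = (\<Prod>k\<in>key ` E. LINT \<omega>|M n. (\<Prod>e\<in>{e \<in> E. key e = k}. ?Z e \<omega>))"
    by (intro prod.cong refl Bochner_Integration.integral_cong) (simp add: HZ)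
  finally show ?thesis .
qed

text \<open>Below the diagonal, the mean and the second moment come from the transposed entry by
  conjugation, which fixes them because 0 and \<open>\<beta> i\<close> are real. The mixed product
  is symmetric in the two indices.\<close>

lemma wigner_entry_moments:
  assumes W: "wigner_family M I \<beta> X" and i: "i \<in> I" and jk: "j \<in> {1..n}" "k \<in> {1..n}" "j \<noteq> k"
  shows "(LINT \<omega>|M n. X n i j k \<omega>) = 0"
    and "(LINT \<omega>|M n. X n i j k \<omega> * X n i k j \<omega>) = 1"
    and "(LINT \<omega>|M n. X n i j k \<omega> * X n i j k \<omega>) = complex_of_real (\<beta> i)"
proof -
  have up: "(LINT \<omega>|M n. X n i j k \<omega>) = 0 \<and> (LINT \<omega>|M n. (cmod (X n i j k \<omega>))\<^sup>2) = 1 \<and>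
      (LINT \<omega>|M n. (X n i j k \<omega>)\<^sup>2) = complex_of_real (\<beta> i)" if "1 \<le> j" "j < k" "k \<le> n" for j k
    by (rule wigner_family_variance[OF W i that])
  have cnj: "X n i k j \<omega> = cnj (X n i j k \<omega>)" if "j \<in> {1..n}" "k \<in> {1..n}" "\<omega> \<in> space (M n)" for j k \<omega>
    using wigner_family_cnj[OF W i that] .
  have mixed: "(LINT \<omega>|M n. X n i j k \<omega> * X n i k j \<omega>) = 1" if "j \<in> {1..n}" "k \<in> {1..n}" "j < k" for j k
  proof -
    have "(LINT \<omega>|M n. X n i j k \<omega> * X n i k j \<omega>) = (LINT \<omega>|M n. complex_of_real ((cmod (X n i j k \<omega>))\<^sup>2))"
      by (intro Bochner_Integration.integral_cong refl) (simp add: cnj[OF that(1,2)] complex_norm_square del: of_real_power)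
    also have "\<dots> = complex_of_real (LINT \<omega>|M n. (cmod (X n i j k \<omega>))\<^sup>2)"
      by (rule integral_complex_of_real)
    finally show ?thesis using up[of j k] that by auto
  qed
  have conj: "(LINT \<omega>|M n. f (X n i j k \<omega>)) = cnj (LINT \<omega>|M n. f (X n i k j \<omega>))"
    if "\<And>z. f (cnj z) = cnj (f z)" for f :: "complex \<Rightarrow> complex"
    unfolding Bochner_Integration.integral_cnj[symmetric]
  proof (intro Bochner_Integration.integral_cong refl)
    fix \<omega> assume "\<omega> \<in> space (M n)"
    then show "f (X n i j k \<omega>) = cnj (f (X n i k j \<omega>))" by (simp only: cnj[OF jk(2,1)] that)
  qed
  show "(LINT \<omega>|M n. X n i j k \<omega>) = 0"
    using up[of j k] up[of k j] conj[of "\<lambda>z. z"] jk by (cases "j < k") auto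
  show "(LINT \<omega>|M n. X n i j k \<omega> * X n i k j \<omega>) = 1"
    using mixed[of j k] mixed[of k j] jk by (cases "j < k") (auto simp: mult.commute)
  show "(LINT \<omega>|M n. X n i j k \<omega> * X n i j k \<omega>) = complex_of_real (\<beta> i)"
    using up[of j k] up[of k j] conj[of "\<lambda>z. z\<^sup>2"] jk by (cases "j < k") (auto simp: power2_eq_square)
qed

text \<open>The arc \<open>e\<close> is alone in its key class, so one factor of the factorized
  expectation is the mean of an off-diagonal entry.\<close>

lemma wigner_product_single:
  assumes W: "wigner_family M I \<beta> X" and E: "finite E" "\<And>e. e \<in> E \<Longrightarrow> \<gamma> e \<in> I"
    and rs: "\<And>e. e \<in> E \<Longrightarrow> r e \<in> {1..n} \<and> s e \<in> {1..n}"
    and e: "e \<in> E" "r e \<noteq> s e" "\<And>d. d \<in> E \<Longrightarrow> \<gamma> d = \<gamma> e \<Longrightarrow> {r d, s d} = {r e, s e} \<Longrightarrow> d = e"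
  shows "(LINT \<omega>|M n. (\<Prod>e\<in>E. X n (\<gamma> e) (r e) (s e) \<omega>)) = 0"
proof -
  have single: "{d \<in> E. entry_key \<gamma> r s d = entry_key \<gamma> r s e} = {e}"
    using e by (auto simp: entry_key_eq_iff)
  have "(LINT \<omega>|M n. X n (\<gamma> e) (r e) (s e) \<omega>) = 0"
    by (rule wigner_entry_moments(1)[OF W]) (use e E rs in auto)
  then have zero: "(LINT \<omega>|M n. (\<Prod>d\<in>{d \<in> E. entry_key \<gamma> r s d = entry_key \<gamma> r s e}. X n (\<gamma> d) (r d) (s d) \<omega>)) = 0"
    unfolding single by simp
  have "(LINT \<omega>|M n. (\<Prod>e\<in>E. X n (\<gamma> e) (r e) (s e) \<omega>))
    = (\<Prod>k\<in>entry_key \<gamma> r s ` E. LINT \<omega>|M n. (\<Prod>d\<in>{d \<in> E. entry_key \<gamma> r s d = k}. X n (\<gamma> d) (r d) (s d) \<omega>))"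
    by (rule wigner_product_factor[OF W E rs])
  also have "\<dots> = 0"
    by (rule prod_zero[OF finite_imageI[OF E(1)]], rule bexI[OF _ imageI[OF e(1)]], rule zero)
  finally show ?thesis .
qed

text \<open>Every key class is a pair \<open>{e, p e}\<close>. Equal row indices give the second
  moment \<open>\<beta>\<close> of an entry; exchanged indices give the product with its conjugate,
  of mean 1.\<close>

lemma wigner_product_pairs:
  fixes \<gamma> :: "'e \<Rightarrow> 'i"
  assumes W: "wigner_family M I \<beta> X" and S: "finite S" and I: "\<And>e. e \<in> S \<Longrightarrow> \<gamma> e \<in> I"
    and rs: "\<And>e. e \<in> S \<Longrightarrow> r e \<in> {1..n} \<and> s e \<in> {1..n} \<and> r e \<noteq> s e"
    and p: "\<And>e. e \<in> S \<Longrightarrow> p e \<noteq> e \<and> \<gamma> (p e) = \<gamma> e \<and> {r (p e), s (p e)} = {r e, s e}"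
    and inj: "\<And>d e. d \<in> S \<Longrightarrow> e \<in> S \<Longrightarrow> {r d, s d} = {r e, s e} \<Longrightarrow> d = e"
  shows "(LINT \<omega>|M n. (\<Prod>e\<in>S \<union> p ` S. X n (\<gamma> e) (r e) (s e) \<omega>))
    = complex_of_real (\<Prod>e\<in>S. if r (p e) = r e then \<beta> (\<gamma> e) else 1)"
proof -
  let ?key = "entry_key \<gamma> r s"
  let ?E = "S \<union> p ` S"
  have keyp: "?key (p e) = ?key e" if "e \<in> S" for e using p[OF that] by (simp add: entry_key_eq_iff)
  have injk: "inj_on ?key S" using inj by (auto simp: inj_on_def entry_key_eq_iff)
  have "?key ` p ` S = ?key ` S" unfolding image_image by (rule image_cong[OF refl keyp])
  then have img: "?key ` ?E = ?key ` S" unfolding image_Un by (simp only: Un_absorb)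
  have cls: "{d \<in> ?E. ?key d = ?key e} = {e, p e}" if e: "e \<in> S" for e
  proof -
    have "d \<in> {e, p e}" if d: "d \<in> ?E" "?key d = ?key e" for d
    proof -
      from d(1) consider "d \<in> S" | c where "c \<in> S" "d = p c" by auto
      then show ?thesis
      proof cases
        case 1 then show ?thesis using inj_onD[OF injk d(2) _ e] by blast
      next
        case 2 then have "?key c = ?key e" using keyp d(2) by auto
        then have "c = e" using inj_onD[OF injk _ 2(1) e] by blast
        then show ?thesis using 2 by auto
      qed
    qed
    then show ?thesis using e keyp[OF e] by auto
  qed
  have rsE: "r e \<in> {1..n} \<and> s e \<in> {1..n}" if e: "e \<in> ?E" for e
  proof -
    from e obtain d where "d \<in> S" "{r e, s e} = {r d, s d}" using p by blast
    then show ?thesis using rs[of d] by (auto simp: doubleton_eq_iff)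
  qed
  have IE: "\<gamma> e \<in> I" if "e \<in> ?E" for e using that I p by auto
  have finE: "finite ?E" using S by simp
  have pair: "(LINT \<omega>|M n. (\<Prod>d\<in>{e, p e}. X n (\<gamma> d) (r d) (s d) \<omega>))
    = complex_of_real (if r (p e) = r e then \<beta> (\<gamma> e) else 1)" if e: "e \<in> S" for e
  proof -
    note mom = wigner_entry_moments[OF W I[OF e], of "r e" n "s e"]
    have two: "(\<Prod>d\<in>{e, p e}. X n (\<gamma> d) (r d) (s d) \<omega>) = X n (\<gamma> e) (r e) (s e) \<omega> * X n (\<gamma> e) (r (p e)) (s (p e)) \<omega>" for \<omega>
    proof -
      have "e \<noteq> p e" and "\<gamma> (p e) = \<gamma> e" using p[OF e] by auto
      then show ?thesis by (simp only: prod.insert finite.intros empty_iff insert_iff not_False_eq_True prod.empty mult_1_right simp_thms)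
    qed
    show ?thesis
    proof (cases "r (p e) = r e")
      case True
      then have "s (p e) = s e" using p[OF e] by (auto simp: doubleton_eq_iff)
      then show ?thesis unfolding two using True mom(3) rs[OF e] by simp
    next
      case False
      then have "r (p e) = s e" "s (p e) = r e" using p[OF e] by (auto simp: doubleton_eq_iff)
      then show ?thesis unfolding two using False mom(2) rs[OF e] by simp
    qed
  qed
  have "(LINT \<omega>|M n. (\<Prod>e\<in>?E. X n (\<gamma> e) (r e) (s e) \<omega>))
    = (\<Prod>k\<in>?key ` ?E. LINT \<omega>|M n. (\<Prod>d\<in>{d \<in> ?E. ?key d = k}. X n (\<gamma> d) (r d) (s d) \<omega>))"
    by (rule wigner_product_factor[OF W finE IE rsE])
  also have "\<dots> = (\<Prod>e\<in>S. LINT \<omega>|M n. (\<Prod>d\<in>{d \<in> ?E. ?key d = ?key e}. X n (\<gamma> d) (r d) (s d) \<omega>))"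
    unfolding img prod.reindex[OF injk] comp_def ..
  also have "\<dots> = (\<Prod>e\<in>S. complex_of_real (if r (p e) = r e then \<beta> (\<gamma> e) else 1))"
    by (rule prod.cong[OF refl]) (simp only: cls pair)
  finally show ?thesis by (simp only: of_real_prod)
qed

section \<open>Injective traces\<close>

definition band_scale :: "'i set \<Rightarrow> ('i \<Rightarrow> real) \<Rightarrow> ('i \<Rightarrow> nat \<Rightarrow> nat) \<Rightarrow> 'i \<Rightarrow> nat \<Rightarrow> real" where
  "band_scale Is c b i n = (if i \<in> Is then (2 * real (b i n)) powr (- 1/2)
     else (2 * c i - (c i)\<^sup>2) powr (- 1/2) * real n powr (- 1/2))"

text \<open>The weight of a twin pair, that is, the square of \<open>band_scale\<close>, in the form
  in which the kernel limits are proved. The degenerate case \<open>b i n = 0\<close> is consistent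
  for a slowly growing label: both \<open>0 powr (- 1/2)\<close> and \<open>1 / 0\<close> are
  0.\<close>

definition band_variance :: "'i set \<Rightarrow> ('i \<Rightarrow> real) \<Rightarrow> ('i \<Rightarrow> nat \<Rightarrow> nat) \<Rightarrow> 'i \<Rightarrow> nat \<Rightarrow> real" where
  "band_variance Is c b i n = (if i \<in> Is then 1 / (2 * real (b i n)) else 1 / ((2 * c i - (c i)\<^sup>2) * real n))"

lemma powr_minus_half_squared: "0 \<le> x \<Longrightarrow> x powr (- 1/2) * x powr (- 1/2) = 1 / (x::real)"
  by (cases "x = 0") (simp_all add: powr_add[symmetric] powr_minus_divide)

lemma band_scale_nonneg: "0 \<le> band_scale Is c b i n"
  by (simp add: band_scale_def)

lemma band_scale_squared:
  assumes "i \<notin> Is \<Longrightarrow> 0 \<le> 2 * c i - (c i)\<^sup>2"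
  shows "band_scale Is c b i n * band_scale Is c b i n = band_variance Is c b i n"
proof (cases "i \<in> Is")
  case True
  then show ?thesis using powr_minus_half_squared[of "2 * real (b i n)"]
    by (simp add: band_scale_def band_variance_def)
next
  case False
  have "band_scale Is c b i n * band_scale Is c b i n
    = ((2 * c i - (c i)\<^sup>2) powr (- 1/2) * (2 * c i - (c i)\<^sup>2) powr (- 1/2)) * (real n powr (- 1/2) * real n powr (- 1/2))"
    using False by (simp add: band_scale_def)
  also have "\<dots> = 1 / (2 * c i - (c i)\<^sup>2) * (1 / real n)"
    using powr_minus_half_squared[OF assms[OF False]] powr_minus_half_squared[of "real n"] by (simp only: of_nat_0_le_iff)
  finally show ?thesis using False by (simp add: band_variance_def)
qed

text \<open>Scaling and band indicators are deterministic, so they leave the expectation; the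
  exchange of sum and integral rests on the integrability of each product of entries.\<close>

lemma injective_trace_expand:
  assumes W: "wigner_family M I \<beta> X" and T: "fin_digraph T" and I: "\<forall>e\<in>arcs T. \<gamma> e \<in> I"
  shows "injective_trace (M n) n (normalized_band Is c b X n) \<gamma> T
    = (\<Sum>\<phi>\<in>injections (verts T) n.
        complex_of_real (band_weight T (\<lambda>e. band_scale Is c b (\<gamma> e) n) (\<lambda>e. b (\<gamma> e) n) (arcs T) \<phi>) *
        (LINT \<omega>|M n. (\<Prod>e\<in>arcs T. X n (\<gamma> e) (\<phi> (head T e)) (\<phi> (tail T e)) \<omega>))) / of_nat n"
proof -
  interpret fin_digraph T by fact
  let ?b = "band_weight T (\<lambda>e. band_scale Is c b (\<gamma> e) n) (\<lambda>e. b (\<gamma> e) n) (arcs T)"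
  let ?Z = "\<lambda>\<phi> \<omega>. \<Prod>e\<in>arcs T. X n (\<gamma> e) (\<phi> (head T e)) (\<phi> (tail T e)) \<omega>"
  have entry: "normalized_band Is c b X n (\<gamma> e) (\<phi> (head T e)) (\<phi> (tail T e)) \<omega>
    = complex_of_real (band_scale Is c b (\<gamma> e) n * of_bool (\<bar>int (\<phi> (tail T e)) - int (\<phi> (head T e))\<bar> \<le> int (b (\<gamma> e) n)))
      * X n (\<gamma> e) (\<phi> (head T e)) (\<phi> (tail T e)) \<omega>" for e \<phi> \<omega>
    by (simp add: normalized_band_def band_matrix_def band_scale_def abs_minus_commute)
  have prod: "(\<Prod>e\<in>arcs T. normalized_band Is c b X n (\<gamma> e) (\<phi> (head T e)) (\<phi> (tail T e)) \<omega>)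
    = complex_of_real (?b \<phi>) * ?Z \<phi> \<omega>" for \<phi> \<omega>
    unfolding entry by (subst prod.distrib) (simp only: band_weight_def of_real_prod)
  have int: "integrable (M n) (?Z \<phi>)" if "\<phi> \<in> injections (verts T) n" for \<phi>
    by (rule wigner_product_integrable[OF W finite_arcs]) (use I that in \<open>auto simp: injections_def\<close>)
  have "injective_trace (M n) n (normalized_band Is c b X n) \<gamma> T
    = (LINT \<omega>|M n. 1 / of_nat n * (\<Sum>\<phi>\<in>injections (verts T) n. complex_of_real (?b \<phi>) * ?Z \<phi> \<omega>))"
    unfolding injective_trace_def prod injections_def ..
  also have "\<dots> = 1 / of_nat n * (LINT \<omega>|M n. (\<Sum>\<phi>\<in>injections (verts T) n. complex_of_real (?b \<phi>) * ?Z \<phi> \<omega>))"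
    by (rule integral_mult_right_zero)
  also have "(LINT \<omega>|M n. (\<Sum>\<phi>\<in>injections (verts T) n. complex_of_real (?b \<phi>) * ?Z \<phi> \<omega>))
    = (\<Sum>\<phi>\<in>injections (verts T) n. LINT \<omega>|M n. complex_of_real (?b \<phi>) * ?Z \<phi> \<omega>)"
    by (rule Bochner_Integration.integral_sum) (rule integrable_mult_right, rule int)
  also have "\<dots> = (\<Sum>\<phi>\<in>injections (verts T) n. complex_of_real (?b \<phi>) * (LINT \<omega>|M n. ?Z \<phi> \<omega>))"
    by (simp only: integral_mult_right_zero)
  finally show ?thesis by (simp only: mult_1_left times_divide_eq_left)
qed

text \<open>Grouping by label the tree arcs that are congruent to their partner gives the exponents.
  Comparing heads suffices to detect congruence, since the unordered ends of twins agree.\<close>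

lemma cong_weight_doubled:
  fixes \<beta> :: "'i \<Rightarrow> real"
  assumes S: "finite S" "grown G V S" and ar: "arcs G = S \<union> p ` S" and I: "\<And>e. e \<in> S \<Longrightarrow> \<gamma> e \<in> I"
    and p: "\<forall>e\<in>S. \<gamma> (p e) = \<gamma> e \<and> {tail G (p e), head G (p e)} = {tail G e, head G e}"
  shows "cong_weight I \<beta> \<gamma> G = (\<Prod>e\<in>S. if head G (p e) = head G e then \<beta> (\<gamma> e) else 1)"
proof -
  have "\<forall>e\<in>S. {tail G (p e), head G (p e)} = {tail G e, head G e}" using p by blast
  note doubled = twins_doubled[OF ar this grown_ends_inj[OF S(2)]]
  define S' where "S' = {e \<in> S. head G (p e) = head G e}"
  have "{P \<in> twin_pairs G. (\<forall>e\<in>P. \<gamma> e = i) \<and> (\<forall>e\<in>P. \<forall>e'\<in>P. tail G e = tail G e' \<and> head G e = head G e')}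
     = twins G ` {e \<in> S'. \<gamma> e = i}" for i
  proof -
    have "(\<forall>d\<in>twins G e. \<gamma> d = i) \<and> (\<forall>d\<in>twins G e. \<forall>d'\<in>twins G e. tail G d = tail G d' \<and> head G d = head G d')
      \<longleftrightarrow> \<gamma> e = i \<and> head G (p e) = head G e" if e: "e \<in> S" for e
    proof -
      have "head G (p e) = head G e \<Longrightarrow> tail G (p e) = tail G e" using bspec[OF p e] by (auto simp: doubleton_eq_iff)
      then show ?thesis unfolding doubled(1)[OF e] using bspec[OF p e] by auto
    qed
    then show ?thesis unfolding doubled(2) S'_def by auto
  qed
  moreover have "inj_on (twins G) {e \<in> S'. \<gamma> e = i}" for i
    by (rule inj_on_subset[OF doubled(3)]) (auto simp: S'_def)
  ultimately have count: "cong_count \<gamma> G i = card {e \<in> S'. \<gamma> e = i}" for i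
    unfolding cong_count_def by (simp add: card_image)
  have fin: "finite S'" using S(1) by (simp add: S'_def)
  have "{i \<in> I. cong_count \<gamma> G i \<noteq> 0} = \<gamma> ` S'"
  proof -
    have "cong_count \<gamma> G i \<noteq> 0 \<longleftrightarrow> i \<in> \<gamma> ` S'" for i
      unfolding count using fin by (auto simp: card_eq_0_iff)
    moreover have "\<gamma> ` S' \<subseteq> I" using I by (auto simp: S'_def)
    ultimately show ?thesis by blast
  qed
  then have "cong_weight I \<beta> \<gamma> G = (\<Prod>i\<in>\<gamma> ` S'. \<Prod>e\<in>{e \<in> S'. \<gamma> e = i}. \<beta> (\<gamma> e))"
    unfolding cong_weight_def count by (auto intro!: prod.cong)
  also have "\<dots> = (\<Prod>e\<in>S'. \<beta> (\<gamma> e))" by (rule prod.image_gen[OF fin, symmetric])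
  also have "\<dots> = (\<Prod>e\<in>S. if head G (p e) = head G e then \<beta> (\<gamma> e) else 1)"
    unfolding S'_def using S(1) by (simp add: prod.inter_filter)
  finally show ?thesis .
qed

text \<open>Twins are subject to the same band condition, and an indicator is its own square. A pair
  thus leaves one indicator and the square of the scale.\<close>

lemma band_weight_doubled:
  assumes S: "finite S" "S \<inter> p ` S = {}" "inj_on p S"
    and p: "\<And>e. e \<in> S \<Longrightarrow> w (p e) = w e \<and> b (p e) = b e \<and> {tail G (p e), head G (p e)} = {tail G e, head G e}"
  shows "band_weight G w b (S \<union> p ` S) \<phi> = band_weight G (\<lambda>e. w e * w e) b S \<phi>"
proof -
  let ?x = "\<lambda>e. w e * of_bool (\<bar>int (\<phi> (tail G e)) - int (\<phi> (head G e))\<bar> \<le> int (b e))"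
  have "?x (p e) = ?x e" if "e \<in> S" for e
    using p[OF that] by (auto simp: doubleton_eq_iff abs_minus_commute)
  then have "(\<Prod>e\<in>p ` S. ?x e) = (\<Prod>e\<in>S. ?x e)" by (simp add: prod.reindex[OF S(3)])
  then have "band_weight G w b (S \<union> p ` S) \<phi> = (\<Prod>e\<in>S. ?x e) * (\<Prod>e\<in>S. ?x e)"
    unfolding band_weight_def using S by (simp add: prod.union_disjoint)
  also have "\<dots> = band_weight G (\<lambda>e. w e * w e) b S \<phi>"
    unfolding band_weight_def prod.distrib[symmetric] by (intro prod.cong) auto
  finally show ?thesis .
qed

theorem theorem4p3p3:
  fixes M :: "nat \<Rightarrow> 'w measure"
    and I I\<^sub>2 I\<^sub>3 I\<^sub>4 :: "'i set"
    and X :: "nat \<Rightarrow> 'i \<Rightarrow> nat \<Rightarrow> nat \<Rightarrow> 'w \<Rightarrow> complex"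
    and \<beta> c :: "'i \<Rightarrow> real"
    and b :: "'i \<Rightarrow> nat \<Rightarrow> nat"
    and T :: "('v, 'e) pre_digraph"
    and \<gamma> :: "'e \<Rightarrow> 'i"
  assumes "I = I\<^sub>2 \<union> I\<^sub>3 \<union> I\<^sub>4"
    and "I\<^sub>2 \<inter> I\<^sub>3 = {}" and "I\<^sub>2 \<inter> I\<^sub>4 = {}" and "I\<^sub>3 \<inter> I\<^sub>4 = {}"
    and "wigner_family M I \<beta> X"
    and "\<And>i. i \<in> I\<^sub>2 \<Longrightarrow> slow_growth (b i)"
    and "\<And>i. i \<in> I\<^sub>3 \<Longrightarrow> full_proportion (b i) (c i)"
    and "\<And>i. i \<in> I\<^sub>4 \<Longrightarrow> proper_proportion (b i) (c i)"
    and "test_graph I \<gamma> T"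
  shows "(\<lambda>n. injective_trace (M n) n (normalized_band I\<^sub>2 c b X n) \<gamma> T)
     \<longlonglongrightarrow> (if colored_double_tree \<gamma> T
          then complex_of_real (p_forest c \<gamma> (reduced_forest I\<^sub>2 I\<^sub>3 \<gamma> T) * cong_weight I \<beta> \<gamma> T)
          else 0)"
proof -
  note W = assms(5)
  have fin: "fin_digraph T" and conn: "connected T" and labels: "\<forall>e\<in>arcs T. \<gamma> e \<in> I"
    using assms(9) by (auto simp: test_graph_def)
  note I = bspec[OF labels]
  interpret fin_digraph T by fact
  let ?E = "arcs T" and ?V = "verts T"
  let ?Z = "\<lambda>n \<phi> \<omega>. \<Prod>e\<in>?E. X n (\<gamma> e) (\<phi> (head T e)) (\<phi> (tail T e)) \<omega>"
  have range: "\<phi> (head T e) \<in> {1..n} \<and> \<phi> (tail T e) \<in> {1..n}" if "\<phi> \<in> injections ?V n" "e \<in> ?E" for \<phi> n e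
    using that by (auto simp: injections_def)
  have inj_ends: "{\<phi> (head T d), \<phi> (tail T d)} = {\<phi> (head T e), \<phi> (tail T e)}
      \<longleftrightarrow> {tail T d, head T d} = {tail T e, head T e}"
    if "\<phi> \<in> injections ?V n" "d \<in> ?E" "e \<in> ?E" for \<phi> n d e
  proof -
    have "inj_on \<phi> ?V" using that by (simp add: injections_def)
    then have eq: "\<phi> x = \<phi> y \<longleftrightarrow> x = y" if "x \<in> ?V" "y \<in> ?V" for x y using that by (auto dest: inj_onD)
    show ?thesis using that(2,3) by (auto simp: doubleton_eq_iff eq)
  qed
  \<comment> \<open>Loops are exempt because diagonal entries need not be centered. If the case
    below fails, they end up among the surplus arcs \<open>R\<close>.\<close>
  show ?thesis
  proof (cases "\<exists>e\<in>?E. tail T e \<noteq> head T e \<and>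
      (\<forall>d\<in>?E. \<gamma> d = \<gamma> e \<and> {tail T d, head T d} = {tail T e, head T e} \<longrightarrow> d = e)")
    case True
    then obtain e where e: "e \<in> ?E" "tail T e \<noteq> head T e"
      "\<And>d. d \<in> ?E \<Longrightarrow> \<gamma> d = \<gamma> e \<Longrightarrow> {tail T d, head T d} = {tail T e, head T e} \<Longrightarrow> d = e" by blast
    have "(LINT \<omega>|M n. ?Z n \<phi> \<omega>) = 0" if \<phi>: "\<phi> \<in> injections ?V n" for n \<phi>
    proof (rule wigner_product_single[OF W finite_arcs, where e = e])
      show "\<phi> (head T e) \<noteq> \<phi> (tail T e)"
        using \<phi> e(1,2) by (auto simp: injections_def dest: inj_onD)
      show "d = e" if "d \<in> ?E" "\<gamma> d = \<gamma> e" "{\<phi> (head T d), \<phi> (tail T d)} = {\<phi> (head T e), \<phi> (tail T e)}" for d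
        using e(3)[OF that(1,2)] inj_ends[OF \<phi> that(1) e(1)] that(3) by blast
    qed (use I e(1) range[OF \<phi>] in auto)
    then have "injective_trace (M n) n (normalized_band I\<^sub>2 c b X n) \<gamma> T = 0" for n
      unfolding injective_trace_expand[OF W fin labels] by simp
    moreover have "\<not> colored_double_tree \<gamma> T"
    proof
      assume "colored_double_tree \<gamma> T"
      then have tw: "card (twins T e) = 2" "\<And>d. d \<in> twins T e \<Longrightarrow> \<gamma> d = \<gamma> e"
        using e(1) by (auto simp: colored_double_tree_def)
      have "twins T e \<subseteq> {e}" using e(3) tw(2) by (auto simp: twins_def)
      then have "card (twins T e) \<le> 1" using card_mono[of "{e}"] by auto
      then show False using tw(1) by simp
    qed
    ultimately show ?thesis by simp
  next
    case False
    obtain S where S: "S \<subseteq> ?E" "grown T ?V S" using grown_spanning_exists[OF fin conn] by blast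
    have finS: "finite S" using grown_finite[OF S(2)] by simp
    have "\<exists>d. d \<in> ?E \<and> d \<noteq> e \<and> \<gamma> d = \<gamma> e \<and> {tail T d, head T d} = {tail T e, head T e}" if "e \<in> S" for e
      using False S(1) that grown_ends[OF S(2) that] by blast
    then obtain p where p: "\<And>e. e \<in> S \<Longrightarrow> p e \<in> ?E \<and> p e \<noteq> e \<and> \<gamma> (p e) = \<gamma> e \<and>
        {tail T (p e), head T (p e)} = {tail T e, head T e}" by metis
    have ends_inj: "d = e" if "d \<in> S" "e \<in> S" "{tail T d, head T d} = {tail T e, head T e}" for d e
      using grown_ends_inj[OF S(2), THEN bspec, THEN bspec, THEN mp, OF that] .
    have disj: "S \<inter> p ` S = {}"
    proof (rule ccontr)
      assume "S \<inter> p ` S \<noteq> {}"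
      then obtain e where "e \<in> S" "p e \<in> S" by blast
      then show False using ends_inj[of "p e" e] p[of e] by blast
    qed
    have injp: "inj_on p S" by (rule inj_onI) (metis ends_inj p)
    have cdt: "colored_double_tree \<gamma> T \<longleftrightarrow> ?E = S \<union> p ` S"
      by (rule colored_double_tree_iff[OF wf_digraph conn S(2,1) p])
    let ?L = "{e. \<gamma> e \<in> I\<^sub>2}"
    let ?w = "\<lambda>e n. band_variance I\<^sub>2 c b (\<gamma> e) n"
    let ?s = "\<lambda>e n. band_scale I\<^sub>2 c b (\<gamma> e) n"
    let ?b = "\<lambda>e n. b (\<gamma> e) n"
    have kernel: "kernel_limit (band_variance I\<^sub>2 c b i) (b i) (if i \<in> I\<^sub>2 then (\<lambda>f. f) else prop_kernel (c i))"
      if "i \<in> I" for i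
    proof (cases "i \<in> I\<^sub>2")
      case True
      then show ?thesis using slow_growth_kernel[OF assms(6)[OF True]] by (simp add: band_variance_def[abs_def])
    next
      case False
      then have "proportional_growth (b i) (c i)"
        using that assms(1,7,8) by (auto simp: full_proportion_def proper_proportion_def)
      from proportional_growth_kernel[OF this] False show ?thesis by (simp add: band_variance_def[abs_def])
    qed
    have scale2: "band_scale I\<^sub>2 c b i n * band_scale I\<^sub>2 c b i n = band_variance I\<^sub>2 c b i n" if "i \<in> I" for i n
    proof (rule band_scale_squared)
      assume "i \<notin> I\<^sub>2"
      then have "0 < c i" "c i \<le> 1"
        using that assms(1,7,8) by (auto simp: full_proportion_def proper_proportion_def proportional_growth_def)
      then have "c i * c i \<le> 2 * c i" by (intro mult_right_mono) auto
      then show "0 \<le> 2 * c i - (c i)\<^sup>2" by (simp add: power2_eq_square)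
    qed
    let ?A = "\<lambda>n. band_avg T (\<lambda>e. ?w e n) (\<lambda>e. ?b e n) n ?V S (\<lambda>_ _. 1)"
    \<comment> \<open>The class map is left arbitrary because the two cases below use different
      ones.\<close>
    have avg: "?A \<longlonglongrightarrow> cube_integral T \<kappa> (\<lambda>e. c (\<gamma> e)) (S - ?L) ?V (\<lambda>_ _. 1)"
      if "\<forall>x\<in>?V. \<forall>y\<in>?V. \<kappa> x = \<kappa> y \<longleftrightarrow> (x, y) \<in> (arc_rel T (S \<inter> ?L))\<^sup>*" for \<kappa> :: "'v \<Rightarrow> 'v set"
    proof (rule band_avg_tendsto[OF S(2) _ that])
      show "kernel_limit (?w e) (?b e) (if e \<in> ?L then (\<lambda>f. f) else prop_kernel (c (\<gamma> e)))" if "e \<in> S" for e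
        using kernel[OF I, of e] that S(1) by auto
    qed auto
    have wS: "band_weight T (\<lambda>e. ?s e n) (\<lambda>e. ?b e n) (S \<union> p ` S) \<phi>
      = band_weight T (\<lambda>e. ?w e n) (\<lambda>e. ?b e n) S \<phi>" for n \<phi>
    proof -
      have "band_weight T (\<lambda>e. ?s e n) (\<lambda>e. ?b e n) (S \<union> p ` S) \<phi>
        = band_weight T (\<lambda>e. ?s e n * ?s e n) (\<lambda>e. ?b e n) S \<phi>"
        by (rule band_weight_doubled[OF finS disj injp]) (use p in auto)
      also have "\<dots> = band_weight T (\<lambda>e. ?w e n) (\<lambda>e. ?b e n) S \<phi>"
        unfolding band_weight_def using scale2 I S(1) by (intro prod.cong) auto
      finally show ?thesis .
    qed
    show ?thesis
    proof (cases "?E = S \<union> p ` S")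
      case True
      define \<kappa> where "\<kappa> = merged T {e \<in> ?E. \<gamma> e \<in> I\<^sub>2}"
      have p': "\<forall>e\<in>S. \<gamma> (p e) = \<gamma> e \<and> {tail T (p e), head T (p e)} = {tail T e, head T e}" using p by blast
      have c3: "\<forall>i\<in>I\<^sub>3. c i = 1" using assms(7) by (auto simp: full_proportion_def)
      note red = cube_integral_reduced_forest[OF fin S(2) True p' c3, folded \<kappa>_def]
      have lim: "?A \<longlonglongrightarrow> p_forest c \<gamma> (reduced_forest I\<^sub>2 I\<^sub>3 \<gamma> T)"
        using avg[OF red(1)] unfolding red(2) .
      have Z: "(LINT \<omega>|M n. ?Z n \<phi> \<omega>) = complex_of_real (cong_weight I \<beta> \<gamma> T)"
        if \<phi>: "\<phi> \<in> injections ?V n" for n \<phi>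
      proof -
        have inj: "inj_on \<phi> ?V" using \<phi> by (simp add: injections_def)
        have "(LINT \<omega>|M n. ?Z n \<phi> \<omega>)
          = complex_of_real (\<Prod>e\<in>S. if \<phi> (head T (p e)) = \<phi> (head T e) then \<beta> (\<gamma> e) else 1)"
          unfolding True
        proof (rule wigner_product_pairs[OF W finS])
          fix e assume e: "e \<in> S"
          then have eE: "e \<in> ?E" using S(1) by blast
          show "\<gamma> e \<in> I" using I eE by blast
          show "\<phi> (head T e) \<in> {1..n} \<and> \<phi> (tail T e) \<in> {1..n} \<and> \<phi> (head T e) \<noteq> \<phi> (tail T e)"
            using range[OF \<phi> eE] grown_ends[OF S(2) e] inj by (auto dest: inj_onD)
          show "p e \<noteq> e \<and> \<gamma> (p e) = \<gamma> e \<and> {\<phi> (head T (p e)), \<phi> (tail T (p e))} = {\<phi> (head T e), \<phi> (tail T e)}"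
            using p[OF e] inj_ends[OF \<phi> _ eE, of "p e"] by blast
        next
          fix d e assume "d \<in> S" "e \<in> S" "{\<phi> (head T d), \<phi> (tail T d)} = {\<phi> (head T e), \<phi> (tail T e)}"
          then show "d = e" using inj_ends[OF \<phi>, of d e] ends_inj[of d e] S(1) by blast
        qed
        also have "(\<Prod>e\<in>S. if \<phi> (head T (p e)) = \<phi> (head T e) then \<beta> (\<gamma> e) else 1)
          = (\<Prod>e\<in>S. if head T (p e) = head T e then \<beta> (\<gamma> e) else 1)"
        proof (rule prod.cong[OF refl])
          fix e assume "e \<in> S"
          then have "head T e \<in> ?V" "head T (p e) \<in> ?V" using p[of e] S(1) by auto
          then have "\<phi> (head T (p e)) = \<phi> (head T e) \<longleftrightarrow> head T (p e) = head T e" using inj by (auto dest: inj_onD)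
          then show "(if \<phi> (head T (p e)) = \<phi> (head T e) then \<beta> (\<gamma> e) else 1) = (if head T (p e) = head T e then \<beta> (\<gamma> e) else 1)"
            by simp
        qed
        also have "\<dots> = cong_weight I \<beta> \<gamma> T"
          by (rule cong_weight_doubled[symmetric, OF finS S(2) True]) (use p I S(1) in auto)
        finally show ?thesis .
      qed
      have "injective_trace (M n) n (normalized_band I\<^sub>2 c b X n) \<gamma> T
        = complex_of_real (?A n * cong_weight I \<beta> \<gamma> T)" for n
      proof -
        have "injective_trace (M n) n (normalized_band I\<^sub>2 c b X n) \<gamma> T
          = (\<Sum>\<phi>\<in>injections ?V n. complex_of_real (band_weight T (\<lambda>e. ?w e n) (\<lambda>e. ?b e n) S \<phi>)
              * complex_of_real (cong_weight I \<beta> \<gamma> T)) / of_nat n"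
          unfolding injective_trace_expand[OF W fin labels]
          by (intro arg_cong2[where f = "(/)"] sum.cong refl arg_cong2[where f = "(*)"] Z)
             (simp_all only: True wS)
        then show ?thesis by (simp add: band_avg_def sum_distrib_right[symmetric])
      qed
      moreover have "(\<lambda>n. complex_of_real (?A n * cong_weight I \<beta> \<gamma> T))
        \<longlonglongrightarrow> complex_of_real (p_forest c \<gamma> (reduced_forest I\<^sub>2 I\<^sub>3 \<gamma> T) * cong_weight I \<beta> \<gamma> T)"
        by (intro tendsto_of_real tendsto_mult lim tendsto_const)
      ultimately show ?thesis using cdt True by simp
    next
      case neq: False
      \<comment> \<open>The surplus: loops, third and further parallel arcs, and arcs that close a
        longer cycle with the tree.\<close>
      define R where "R = ?E - (S \<union> p ` S)"
      have R: "finite R" "R \<noteq> {}" "?E = (S \<union> p ` S) \<union> R" "(S \<union> p ` S) \<inter> R = {}"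
        using neq S(1) p by (auto simp: R_def)
      obtain C where C: "\<And>n r s. (\<forall>e\<in>?E. r e \<in> {1..n} \<and> s e \<in> {1..n}) \<Longrightarrow>
          cmod (LINT \<omega>|M n. (\<Prod>e\<in>?E. X n (\<gamma> e) (r e) (s e) \<omega>)) \<le> C"
        using wigner_product_bound[OF W finite_arcs, of \<gamma>] I by blast
      have wE: "band_weight T (\<lambda>e. ?s e n) (\<lambda>e. ?b e n) ?E \<phi>
          \<le> (\<Prod>e\<in>R. ?s e n) * band_weight T (\<lambda>e. ?w e n) (\<lambda>e. ?b e n) S \<phi>" for n \<phi>
      proof -
        have "band_weight T (\<lambda>e. ?s e n) (\<lambda>e. ?b e n) ?E \<phi>
          = band_weight T (\<lambda>e. ?s e n) (\<lambda>e. ?b e n) (S \<union> p ` S) \<phi> * band_weight T (\<lambda>e. ?s e n) (\<lambda>e. ?b e n) R \<phi>"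
          unfolding band_weight_def R(3) by (rule prod.union_disjoint) (use finS R in auto)
        also have "\<dots> \<le> band_weight T (\<lambda>e. ?s e n) (\<lambda>e. ?b e n) (S \<union> p ` S) \<phi> * (\<Prod>e\<in>R. ?s e n)"
          by (intro mult_left_mono band_weight_nonneg band_scale_nonneg)
             (auto simp: band_weight_def band_scale_nonneg intro!: prod_mono)
        finally show ?thesis unfolding wS by (simp only: mult.commute)
      qed
      have avg0: "(\<lambda>n. \<bar>C\<bar> * ((\<Prod>e\<in>R. ?s e n) * ?A n)) \<longlonglongrightarrow> 0"
      proof -
        have "(\<lambda>n. ?s e n) \<longlonglongrightarrow> 0" if "e \<in> R" for e
        proof -
          have eI: "\<gamma> e \<in> I" using that I by (auto simp: R_def)
          \<comment> \<open>\<open>kernel_limit\<close> speaks of the weight of a twin pair, whereas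
            a surplus arc contributes only its square root; this still tends to 0.\<close>
          have "(\<lambda>n. sqrt (?w e n)) \<longlonglongrightarrow> sqrt 0"
            using kernel[OF eI] by (intro tendsto_real_sqrt) (auto simp: kernel_limit_def)
          moreover have "sqrt (?w e n) = ?s e n" for n
            unfolding scale2[OF eI, symmetric] by (simp add: band_scale_nonneg)
          ultimately show ?thesis by simp
        qed
        then have "(\<lambda>n. \<Prod>e\<in>R. ?s e n) \<longlonglongrightarrow> (\<Prod>e\<in>R. 0)" by (intro tendsto_prod)
        moreover have "(\<Prod>e\<in>R. 0::real) = 0" using R(1,2) by (intro prod_zero) auto
        ultimately have scale0: "(\<lambda>n. \<Prod>e\<in>R. ?s e n) \<longlonglongrightarrow> 0" by (simp only:)
        \<comment> \<open>Only the existence of a finite limit of \<open>?A\<close> matters here, so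
          it is enough to exhibit some class map. Merging along the slowly growing tree arcs alone
          provides one.\<close>
        have "?E \<inter> (S \<inter> ?L) = S \<inter> ?L" using S(1) by blast
        then have "\<forall>x\<in>?V. \<forall>y\<in>?V. merged T (S \<inter> ?L) x = merged T (S \<inter> ?L) y \<longleftrightarrow> (x, y) \<in> (arc_rel T (S \<inter> ?L))\<^sup>*"
          using merged_eq_iff[OF wf_digraph, of _ _ "S \<inter> ?L"] by simp
        from tendsto_mult[OF scale0 avg[OF this]]
        have "(\<lambda>n. (\<Prod>e\<in>R. ?s e n) * ?A n) \<longlonglongrightarrow> 0" by (simp only: mult_zero_left)
        then show ?thesis by (rule tendsto_mult_right_zero)
      qed
      have "(\<lambda>n. injective_trace (M n) n (normalized_band I\<^sub>2 c b X n) \<gamma> T) \<longlonglongrightarrow> 0"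
      proof (rule Lim_null_comparison[OF always_eventually avg0], rule allI)
        fix n
        let ?B = "band_weight T (\<lambda>e. ?s e n) (\<lambda>e. ?b e n) ?E"
        have "cmod (\<Sum>\<phi>\<in>injections ?V n. complex_of_real (?B \<phi>) * (LINT \<omega>|M n. ?Z n \<phi> \<omega>))
          \<le> (\<Sum>\<phi>\<in>injections ?V n. \<bar>C\<bar> * ((\<Prod>e\<in>R. ?s e n) * band_weight T (\<lambda>e. ?w e n) (\<lambda>e. ?b e n) S \<phi>))"
        proof (rule order_trans[OF norm_sum sum_mono])
          fix \<phi> assume \<phi>: "\<phi> \<in> injections ?V n"
          have B0: "0 \<le> ?B \<phi>" by (intro band_weight_nonneg band_scale_nonneg)
          have "cmod (LINT \<omega>|M n. ?Z n \<phi> \<omega>) \<le> C"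
            by (rule C) (use range[OF \<phi>] in blast)
          then have "cmod (LINT \<omega>|M n. ?Z n \<phi> \<omega>) \<le> \<bar>C\<bar>" by linarith
          then have "?B \<phi> * cmod (LINT \<omega>|M n. ?Z n \<phi> \<omega>)
            \<le> ((\<Prod>e\<in>R. ?s e n) * band_weight T (\<lambda>e. ?w e n) (\<lambda>e. ?b e n) S \<phi>) * \<bar>C\<bar>"
            using B0 wE[of n \<phi>] by (intro mult_mono) (auto intro: order_trans)
          then show "cmod (complex_of_real (?B \<phi>) * (LINT \<omega>|M n. ?Z n \<phi> \<omega>))
            \<le> \<bar>C\<bar> * ((\<Prod>e\<in>R. ?s e n) * band_weight T (\<lambda>e. ?w e n) (\<lambda>e. ?b e n) S \<phi>)"
            using B0 by (simp only: norm_mult norm_of_real abs_of_nonneg mult.commute)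
        qed
        also have "\<dots> = \<bar>C\<bar> * ((\<Prod>e\<in>R. ?s e n) * (\<Sum>\<phi>\<in>injections ?V n. band_weight T (\<lambda>e. ?w e n) (\<lambda>e. ?b e n) S \<phi>))"
          by (simp only: sum_distrib_left)
        finally have "cmod (\<Sum>\<phi>\<in>injections ?V n. complex_of_real (?B \<phi>) * (LINT \<omega>|M n. ?Z n \<phi> \<omega>)) / real n
          \<le> \<bar>C\<bar> * ((\<Prod>e\<in>R. ?s e n) * (\<Sum>\<phi>\<in>injections ?V n. band_weight T (\<lambda>e. ?w e n) (\<lambda>e. ?b e n) S \<phi>)) / real n"
          by (rule divide_right_mono) simp
        then show "norm (injective_trace (M n) n (normalized_band I\<^sub>2 c b X n) \<gamma> T) \<le> \<bar>C\<bar> * ((\<Prod>e\<in>R. ?s e n) * ?A n)"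
          unfolding injective_trace_expand[OF W fin labels] band_avg_def norm_divide norm_of_nat
          by (simp only: prod.neutral_const mult_1_right times_divide_eq_right)
      qed
      then show ?thesis using cdt neq by simp
    qed
  qed
qed

end
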